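(* Let $n\ge1$ and let $\lambda=(\lambda_1\ge\dots\ge\lambda_n)$ be a real spectrum. Every fiber $F^{-1}(\Lambda)$ of the Gelfand--Cetlin system on the coadjoint orbit $\mathcal{O}(\lambda)$ of $U(n)$ is an isotropic submanifold of $(\mathcal{O}(\lambda),\omega)$, where $\omega$ is the Kirillov--Kostant--Souriau form.
   Context: $\mathcal{O}(\lambda)$ is the set of Hermitian $n\times n$ complex matrices with spectrum $\lambda$; with $\mathfrak{u}(n)$ the Lie algebra of skew-Hermitian matrices, $T_A\mathcal{O}(\lambda)=\{[B,A]: B\in\mathfrak{u}(n)\}$, and the Kirillov--Kostant--Souriau symplectic form is $\omega_A([H_1,A],[H_2,A])=\sqrt{-1}\,\mathrm{tr}(A[H_1,H_2])$ for $H_1,H_2\in\mathfrak{u}(n)$. For $A\in\mathcal{O}(\lambda)$ let $A_k$ be its upper-left $k\times k$ submatrix, with eigenvalues $F_{1,k}(A)\ge\dots\ge F_{k,k}(A)$. The Gelfand--Cetlin map is $F=(F_{i,j})_{1\le i\le j<n}:\mathcal{O}(\lambda)\to\mathbb{R}^{n(n-1)/2}$, and a fiber is the preimage $F^{-1}(\Lambda)$ of a value $\Lambda$ of $F$. A submanifold is isotropic if $\omega$ restricts to zero on its tangent spaces. *)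

theory Defs
  imports
    "HOL-Analysis.Analysis"
    "Jordan_Normal_Form.Char_Poly"
begin

no_notation Matrix.vec_index (infixl "$" 100)

section \<open>Embedded smooth submanifolds of a Euclidean space\<close>

text \<open>For open \<open>U\<close>, \<open>Ck_on k f U\<close> says that \<open>f\<close> is of class C^k on \<open>U\<close>; as the dimension is
  finite, continuity of the derivative can be tested on each direction \<open>v\<close> separately.\<close>

primrec Ck_on :: "nat \<Rightarrow> ('a::euclidean_space \<Rightarrow> 'b::euclidean_space) \<Rightarrow> 'a set \<Rightarrow> bool" where
  "Ck_on 0 f U \<longleftrightarrow> continuous_on U f"
| "Ck_on (Suc k) f U \<longleftrightarrow> (\<forall>x\<in>U. f differentiable (at x)) \<and>
     (\<forall>v. Ck_on k (\<lambda>x. frechet_derivative f (at x) v) U)"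

definition smooth_on :: "('a::euclidean_space \<Rightarrow> 'b::euclidean_space) \<Rightarrow> 'a set \<Rightarrow> bool" where
  "smooth_on f U \<longleftrightarrow> (\<forall>k. Ck_on k f U)"

definition smooth_diffeo ::
  "'a::euclidean_space set \<Rightarrow> 'a set \<Rightarrow> ('a \<Rightarrow> 'a) \<Rightarrow> ('a \<Rightarrow> 'a) \<Rightarrow> bool" where
  "smooth_diffeo U V f g \<longleftrightarrow> open U \<and> open V \<and> homeomorphism U V f g \<and> smooth_on f U \<and> smooth_on g V"

text \<open>Local slice condition: near each of its points, \<open>M\<close> is straightened to a \<open>d\<close>-dimensional
  linear subspace by a diffeomorphism between open subsets of the ambient space.\<close>

definition embedded_submanifold :: "nat \<Rightarrow> 'a::euclidean_space set \<Rightarrow> bool" where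
  "embedded_submanifold d M \<longleftrightarrow>
     (\<forall>p\<in>M. \<exists>U V f g S. p \<in> U \<and> smooth_diffeo U V f g \<and>
        subspace S \<and> dim S = d \<and> f ` (M \<inter> U) = V \<inter> S)"

text \<open>A submanifold of an embedded submanifold \<open>N\<close> of the ambient space is an embedded submanifold
  of the ambient space that is contained in \<open>N\<close>.\<close>

definition submanifold_of :: "'a::euclidean_space set \<Rightarrow> 'a set \<Rightarrow> bool" where
  "submanifold_of M N \<longleftrightarrow>
     (\<exists>m. embedded_submanifold m N) \<and> (\<exists>d. embedded_submanifold d M) \<and> M \<subseteq> N"

text \<open>Velocities at \<open>p\<close> of smooth curves in \<open>M\<close>.\<close>

definition tangent_space :: "'a::euclidean_space set \<Rightarrow> 'a \<Rightarrow> 'a set" where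
  "tangent_space M p = {v. \<exists>c e. 0 < e \<and> smooth_on c {-e<..<e::real} \<and> c ` {-e<..<e} \<subseteq> M \<and>
     c 0 = p \<and> (c has_vector_derivative v) (at 0)}"

definition isotropic_submanifold ::
  "'a::euclidean_space set \<Rightarrow> ('a \<Rightarrow> 'a \<Rightarrow> 'a \<Rightarrow> real) \<Rightarrow> 'a set \<Rightarrow> bool" where
  "isotropic_submanifold N \<omega> M \<longleftrightarrow> submanifold_of M N \<and>
     (\<forall>p\<in>M. \<forall>X\<in>tangent_space M p. \<forall>Y\<in>tangent_space M p. \<omega> p X Y = 0)"

section \<open>Eigenvalues of leading submatrices\<close>

type_synonym 'n cmat = "complex^'n^'n"

definition conj_transpose :: "'n::finite cmat \<Rightarrow> 'n cmat" where
  "conj_transpose A = (\<chi> i j. cnj (A $ j $ i))"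

definition hermitian :: "'n::finite cmat \<Rightarrow> bool" where
  "hermitian A \<longleftrightarrow> conj_transpose A = A"

definition skew_hermitian :: "'n::finite cmat \<Rightarrow> bool" where
  "skew_hermitian A \<longleftrightarrow> conj_transpose A = - A"

text \<open>The linear order of the index type \<open>'n\<close> identifies it with \<open>{0..<CARD('n)}\<close>.\<close>

definition nth_index :: "nat \<Rightarrow> 'n::{finite,linorder}" where
  "nth_index i = sorted_list_of_set UNIV ! i"

definition leading_submatrix :: "nat \<Rightarrow> 'n::{finite,linorder} cmat \<Rightarrow> complex Matrix.mat" where
  "leading_submatrix k A = Matrix.mat k k (\<lambda>(i, j). A $ nth_index i $ nth_index j)"

text \<open>\<open>eigenval i k A\<close>, for \<open>1 \<le> i \<le> k \<le> CARD('n)\<close>, is the \<open>i\<close>-th largest eigenvalue, counted with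
  multiplicity, of the leading \<open>k \<times> k\<close> submatrix of the Hermitian matrix \<open>A\<close>. The eigenvalues are
  real, so that \<open>Re\<close> is only a change of type.\<close>

definition eigenval :: "nat \<Rightarrow> nat \<Rightarrow> 'n::{finite,linorder} cmat \<Rightarrow> real" where
  "eigenval i k A =
     rev (sorted_list_of_multiset (image_mset Re (proots (char_poly (leading_submatrix k A))))) ! (i - 1)"

section \<open>Coadjoint orbits and the Gelfand--Cetlin system\<close>

text \<open>The spectrum is given by the values \<open>lam 1 \<ge> \<dots> \<ge> lam CARD('n)\<close>.\<close>

definition coadjoint_orbit :: "(nat \<Rightarrow> real) \<Rightarrow> 'n::{finite,linorder} cmat set" where
  "coadjoint_orbit lam =
     {A. hermitian A \<and> (\<forall>i\<in>{1..CARD('n)}. eigenval i CARD('n) A = lam i)}"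

definition bracket :: "'n::finite cmat \<Rightarrow> 'n cmat \<Rightarrow> 'n cmat" where
  "bracket A B = A ** B - B ** A"

text \<open>The value \<open>kks_form A X Y\<close> is meaningful for tangent vectors \<open>X = [H1, A]\<close>, \<open>Y = [H2, A]\<close> of
  the orbit of the Hermitian matrix \<open>A\<close>; it does not depend on the choice of \<open>H1\<close> and \<open>H2\<close>.\<close>

definition kks_form :: "'n::finite cmat \<Rightarrow> 'n cmat \<Rightarrow> 'n cmat \<Rightarrow> real" where
  "kks_form A X Y = (THE w. \<exists>H1 H2. skew_hermitian H1 \<and> skew_hermitian H2 \<and>
     X = bracket H1 A \<and> Y = bracket H2 A \<and>
     complex_of_real w = \<i> * trace (A ** bracket H1 H2))"

lemma cmat_diff_mult: "(P - Q) ** R = P ** R - Q ** R" for P Q R :: "'n::finite cmat"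
  by (simp add: matrix_matrix_mult_def Finite_Cartesian_Product.vec_eq_iff sum_subtractf left_diff_distrib)

lemma cmat_mult_diff: "R ** (P - Q) = R ** P - R ** Q" for P Q R :: "'n::finite cmat"
  by (simp add: matrix_matrix_mult_def Finite_Cartesian_Product.vec_eq_iff sum_subtractf right_diff_distrib)

lemma cmat_uminus_mult: "(- P) ** Q = - (P ** Q)" for P Q :: "'n::finite cmat"
  using cmat_diff_mult[of 0 P Q] by simp

lemma cmat_mult_uminus: "P ** (- Q) = - (P ** Q)" for P Q :: "'n::finite cmat"
  using cmat_mult_diff[of P 0 Q] by simp

lemma conj_transpose_mult: "conj_transpose (A ** B) = conj_transpose B ** conj_transpose A"
  by (simp add: conj_transpose_def matrix_matrix_mult_def Finite_Cartesian_Product.vec_eq_iff mult.commute)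

lemma conj_transpose_diff: "conj_transpose (A - B) = conj_transpose A - conj_transpose B"
  by (simp add: conj_transpose_def Finite_Cartesian_Product.vec_eq_iff)

lemma trace_conj_transpose: "trace (conj_transpose A) = cnj (trace A)"
  by (simp add: conj_transpose_def trace_def)

lemma trace_bracket_left: "trace (A ** bracket H K) = - trace (bracket H A ** K)"
proof -
  have "trace (A ** (K ** H)) = trace (H ** A ** K)"
    using trace_mul_sym[of "A ** K" H] by (simp add: matrix_mul_assoc)
  then show ?thesis
    by (simp add: bracket_def cmat_diff_mult cmat_mult_diff trace_sub matrix_mul_assoc)
qed

lemma trace_bracket_right: "trace (A ** bracket H K) = trace (bracket K A ** H)"
proof -
  have "trace (A ** H ** K) = trace (K ** A ** H)"
    using trace_mul_sym[of "A ** H" K] by (simp add: matrix_mul_assoc)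
  then show ?thesis
    by (simp add: bracket_def cmat_diff_mult cmat_mult_diff trace_sub matrix_mul_assoc)
qed

lemma kks_form_bracket:
  assumes A: "hermitian A" and H: "skew_hermitian H1" "skew_hermitian H2"
  shows "complex_of_real (kks_form A (bracket H1 A) (bracket H2 A)) = \<i> * trace (A ** bracket H1 H2)"
proof -
  have "conj_transpose (A ** bracket H1 H2) = - (bracket H1 H2 ** A)"
    using A H by (simp add: conj_transpose_mult bracket_def conj_transpose_diff
        hermitian_def skew_hermitian_def cmat_uminus_mult cmat_mult_uminus cmat_diff_mult)
  then have "cnj (trace (A ** bracket H1 H2)) = - trace (A ** bracket H1 H2)"
    using trace_conj_transpose[of "A ** bracket H1 H2"] trace_mul_sym[of "bracket H1 H2" A]
    by (simp add: trace_def sum_negf)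
  then have "Re (trace (A ** bracket H1 H2)) = 0"
    by (simp add: complex_eq_iff)
  then have real: "complex_of_real (Re (\<i> * trace (A ** bracket H1 H2))) = \<i> * trace (A ** bracket H1 H2)"
    by (simp add: complex_eq_iff)
  have indep: "trace (A ** bracket K1 K2) = trace (A ** bracket H1 H2)"
    if "bracket H1 A = bracket K1 A" "bracket H2 A = bracket K2 A" for K1 K2
    using trace_bracket_left[of A K1 K2] trace_bracket_left[of A H1 K2]
      trace_bracket_right[of A H1 K2] trace_bracket_right[of A H1 H2] that by simp
  have "kks_form A (bracket H1 A) (bracket H2 A) = Re (\<i> * trace (A ** bracket H1 H2))"
    unfolding kks_form_def
  proof (rule the_equality)
    show "\<exists>K1 K2. skew_hermitian K1 \<and> skew_hermitian K2 \<and> bracket H1 A = bracket K1 A \<and>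
        bracket H2 A = bracket K2 A \<and>
        complex_of_real (Re (\<i> * trace (A ** bracket H1 H2))) = \<i> * trace (A ** bracket K1 K2)"
      using H real by blast
  next
    fix w
    assume "\<exists>K1 K2. skew_hermitian K1 \<and> skew_hermitian K2 \<and> bracket H1 A = bracket K1 A \<and>
        bracket H2 A = bracket K2 A \<and> complex_of_real w = \<i> * trace (A ** bracket K1 K2)"
    then have "complex_of_real w = \<i> * trace (A ** bracket H1 H2)"
      by (auto dest: indep)
    then show "w = Re (\<i> * trace (A ** bracket H1 H2))"
      by (metis Re_complex_of_real)
  qed
  with real show ?thesis by simp
qed

definition gelfand_cetlin :: "'n::{finite,linorder} cmat \<Rightarrow> nat \<times> nat \<Rightarrow> real" where
  "gelfand_cetlin A = restrict (\<lambda>(i, j). eigenval i j A) {(i, j). 1 \<le> i \<and> i \<le> j \<and> j < CARD('n)}"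

definition gelfand_cetlin_fiber ::
  "(nat \<Rightarrow> real) \<Rightarrow> (nat \<times> nat \<Rightarrow> real) \<Rightarrow> 'n::{finite,linorder} cmat set" where
  "gelfand_cetlin_fiber lam \<Lambda> = {A \<in> coadjoint_orbit lam. gelfand_cetlin A = \<Lambda>}"

end

(*
The fiber consists of the Hermitian matrices whose leading k x k blocks A_k have prescribed spectra.
Let b be the column and c the corner entry by which A_(k+1) extends A_k, and P_mu the spectral
projections of A_k. Since det(x - A_(k+1)) = det(x - A_k) (x - c - sum_mu |P_mu b|^2 / (x - mu)),
prescribing the spectrum of A_(k+1) over a given A_k means prescribing c and all norms |P_mu b|.

Smoothness of the fiber: rescaling the components P_mu b to the prescribed norms, for k = 0, 1, ...,
is a smooth retraction of an open set of matrices onto the fiber. Here P_mu is a polynomial in A_k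
with coefficients depending on the prescribed spectrum only. The dimension at a point is the trace
of the derivative of the retraction, and it depends only on the multiplicities.
The orbit through A is straightened near A by a polynomial map with derivative the identity, built
from B - A and q(B), where q is the minimal polynomial of A.

Isotropy: a vector X tangent to the fiber is infinitesimally generated, on the block A_(k+1), by a
skew-Hermitian H_k acting in the first k coordinates only: X_(k+1) = [H_k, A_(k+1)]. Hence the value
tr(A_(k+1) [H, K]) of the form, which depends only on [H, A_(k+1)] and [K, A_(k+1)], equals
tr(A_k [H_k, K_k]), and it descends to the empty block, where it is 0.
*)
theory Submission
  imports Defs "Jordan_Normal_Form.Schur_Decomposition"
begin

no_notation Matrix.vec_index (infixl "$" 100)
no_notation Matrix.scalar_prod (infix "\<bullet>" 70)

section \<open>Smooth maps and submanifolds\<close>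

text \<open>Eigenvalues are not smooth where they collide, so a fiber cannot be treated as a regular
  level set of the Gelfand--Cetlin map. A retraction avoids differentiating eigenvalues: at a fixed
  point its derivative is idempotent, and the trace of an idempotent is its rank. Since a
  submanifold must have one dimension throughout, this trace is computed: step k contributes, for
  every \<mu> with nonzero prescribed norm, the dimension 2m - 1 of a sphere in an eigenspace of
  complex dimension m. A component of prescribed norm 0 cannot be rescaled and is dropped. The
  spectral theorem enters through traces: Schur decomposition gives tr p(A_k), and a Hermitian N
  with tr(N N) = 0 vanishes, so p(A_k) depends only on the values of p on the spectrum. The same
  spheres give isotropy: once the motion generated on A_k is subtracted, the velocity of P_\<mu> b
  is real-orthogonal to P_\<mu> b, and such velocities are exactly the ones that skew-Hermitian
  matrices generate. For the orbit, q(B) = 0 fixes only the set of eigenvalues; the multiplicities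
  are integers, hence locally constant by continuity of traces.\<close>

lemma frechet_derivative_cong_open:
  assumes "open U" "x \<in> U" "\<And>y. y \<in> U \<Longrightarrow> f y = g y"
  shows "frechet_derivative f (at x) = frechet_derivative g (at x)"
proof -
  have "(f has_derivative h) (at x) \<longleftrightarrow> (g has_derivative h) (at x)" for h
    using has_derivative_transform_within_open[of f h x UNIV U g]
      has_derivative_transform_within_open[of g h x UNIV U f] assms by auto
  then show ?thesis by (simp add: frechet_derivative_def)
qed

lemma Ck_on_cong:
  assumes "open U" "\<And>x. x \<in> U \<Longrightarrow> f x = g x"
  shows "Ck_on k f U \<longleftrightarrow> Ck_on k g U"
  using assms(2)
proof (induction k arbitrary: f g)
  case 0
  then show ?case by (simp cong: continuous_on_cong)
next
  case (Suc k)
  have "f differentiable (at x) \<longleftrightarrow> g differentiable (at x)" if "x \<in> U" for x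
    unfolding differentiable_def
    using has_derivative_transform_within_open[of f _ x UNIV U g]
      has_derivative_transform_within_open[of g _ x UNIV U f] assms(1) Suc.prems that by metis
  moreover have "Ck_on k (\<lambda>x. frechet_derivative f (at x) v) U
      \<longleftrightarrow> Ck_on k (\<lambda>x. frechet_derivative g (at x) v) U" for v
    by (rule Suc.IH) (use frechet_derivative_cong_open[OF assms(1) _ Suc.prems] in auto)
  ultimately show ?case unfolding Ck_on.simps(2) by blast
qed

text \<open>Lets C^k arguments use an explicit derivative formula in place of
  \<open>frechet_derivative\<close>, which is defined by choice. The closure lemmas below rest on
  it.\<close>

lemma Ck_on_Suc_iff:
  assumes "open U" and f': "\<And>x. x \<in> U \<Longrightarrow> (f has_derivative f' x) (at x)"
  shows "Ck_on (Suc k) f U \<longleftrightarrow> (\<forall>v. Ck_on k (\<lambda>x. f' x v) U)"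
proof -
  have "Ck_on k (\<lambda>x. frechet_derivative f (at x) v) U \<longleftrightarrow> Ck_on k (\<lambda>x. f' x v) U" for v
    by (rule Ck_on_cong[OF assms(1)]) (use frechet_derivative_at[OF f'] in auto)
  moreover have "f differentiable (at x)" if "x \<in> U" for x
    using f'[OF that] differentiable_def by blast
  ultimately show ?thesis unfolding Ck_on.simps(2) by blast
qed

lemma Ck_on_imp_continuous_on: "Ck_on k f U \<Longrightarrow> continuous_on U f"
  by (cases k) (auto intro!: continuous_at_imp_continuous_on differentiable_imp_continuous_within)

lemma Ck_on_has_derivative:
  "Ck_on (Suc k) f U \<Longrightarrow> x \<in> U \<Longrightarrow> (f has_derivative frechet_derivative f (at x)) (at x)"
  by (metis Ck_on.simps(2) frechet_derivative_works)

lemma Ck_on_frechet_derivative: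
  "Ck_on (Suc k) f U \<Longrightarrow> Ck_on k (\<lambda>x. frechet_derivative f (at x) v) U"
  by simp

declare Ck_on.simps(2) [simp del]

lemma Ck_on_SucD: "Ck_on (Suc k) f U \<Longrightarrow> Ck_on k f U"
proof (induction k arbitrary: f)
  case 0
  then show ?case using Ck_on_imp_continuous_on[OF 0] by simp
next
  case (Suc k)
  then have "\<forall>x\<in>U. f differentiable (at x)" and
    "\<And>v. Ck_on (Suc k) (\<lambda>x. frechet_derivative f (at x) v) U"
    unfolding Ck_on.simps(2)[of "Suc k"] by blast+
  then have "\<forall>x\<in>U. f differentiable (at x)" and
    "\<forall>v. Ck_on k (\<lambda>x. frechet_derivative f (at x) v) U"
    using Suc.IH by blast+
  then show ?case unfolding Ck_on.simps(2) by blast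
qed

lemma Ck_on_subset:
  assumes "Ck_on k f U" "V \<subseteq> U" shows "Ck_on k f V"
  using assms(1)
proof (induction k arbitrary: f)
  case 0
  then show ?case using assms(2) continuous_on_subset by auto
next
  case (Suc k)
  then show ?case using assms(2) unfolding Ck_on.simps(2) by blast
qed

lemma Ck_on_const:
  assumes "open U" shows "Ck_on k (\<lambda>x. c) U"
proof (induction k arbitrary: c)
  case (Suc k)
  show ?case
    using Ck_on_Suc_iff[OF assms has_derivative_const[of c], of k] Suc by blast
qed simp

lemma Ck_on_linear:
  assumes "open U" "bounded_linear f" shows "Ck_on k f U"
proof (cases k)
  case 0
  then show ?thesis using assms by (simp add: linear_continuous_on)
next
  case (Suc m)
  then show ?thesis
    using Ck_on_Suc_iff[OF assms(1) bounded_linear_imp_has_derivative[OF assms(2)], of m]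
      Ck_on_const[OF assms(1)] by blast
qed

lemma Ck_on_add:
  assumes "open U" "Ck_on k f U" "Ck_on k g U" shows "Ck_on k (\<lambda>x. f x + g x) U"
  using assms(2,3)
proof (induction k arbitrary: f g)
  case (Suc k)
  show ?case
    by (subst Ck_on_Suc_iff[OF assms(1), OF has_derivative_add
          [OF Ck_on_has_derivative[OF Suc.prems(1)] Ck_on_has_derivative[OF Suc.prems(2)]]])
      (auto intro!: Suc.IH Ck_on_frechet_derivative Suc.prems)
qed (simp add: continuous_on_add)

text \<open>One product rule for all products in use: scaling, inner product, matrix times matrix
  and matrix times vector.\<close>

lemma Ck_on_bilinear:
  assumes b: "bounded_bilinear b" and "open U" "Ck_on k f U" "Ck_on k g U"
  shows "Ck_on k (\<lambda>x. b (f x) (g x)) U"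
  using assms(3,4)
proof (induction k arbitrary: f g)
  case 0
  then show ?case by (simp add: bounded_bilinear.continuous_on[OF b])
next
  case (Suc k)
  have "Ck_on k (\<lambda>x. b (f x) (frechet_derivative g (at x) v)
      + b (frechet_derivative f (at x) v) (g x)) U" for v
    by (intro Ck_on_add[OF assms(2)] Suc.IH Ck_on_SucD[OF Suc.prems(1)] Ck_on_SucD[OF Suc.prems(2)]
        Ck_on_frechet_derivative Suc.prems)
  then show ?case
    by (subst Ck_on_Suc_iff[OF assms(2), OF bounded_bilinear.FDERIV
          [OF b Ck_on_has_derivative[OF Suc.prems(1)] Ck_on_has_derivative[OF Suc.prems(2)]]])
       auto
qed

lemma Ck_on_linear_comp:
  assumes "bounded_linear h" "open U" "Ck_on k f U" shows "Ck_on k (\<lambda>x. h (f x)) U"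
  using assms(3)
proof (induction k arbitrary: f)
  case 0
  then show ?case using assms(1)
    by (simp add: bounded_linear.continuous_on)
next
  case (Suc k)
  show ?case
    by (subst Ck_on_Suc_iff[OF assms(2), OF bounded_linear.has_derivative
          [OF assms(1) Ck_on_has_derivative[OF Suc.prems(1)]]])
      (auto intro!: Suc.IH Ck_on_frechet_derivative Suc.prems)
qed

lemma Ck_on_sum:
  assumes "open U" "\<And>i. i \<in> I \<Longrightarrow> Ck_on k (f i) U" shows "Ck_on k (\<lambda>x. \<Sum>i\<in>I. f i x) U"
  using assms(2)
  by (induction I rule: infinite_finite_induct) (auto simp: Ck_on_const Ck_on_add assms(1))

lemma linear_apply_Basis:
  fixes f :: "'a::euclidean_space \<Rightarrow> 'b::real_vector"
  assumes "linear f"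
  shows "f v = (\<Sum>b\<in>Basis. (v \<bullet> b) *\<^sub>R f b)"
proof -
  have "f v = f (\<Sum>b\<in>Basis. (v \<bullet> b) *\<^sub>R b)" by (simp add: euclidean_representation)
  also have "\<dots> = (\<Sum>b\<in>Basis. (v \<bullet> b) *\<^sub>R f b)"
    using assms by (simp add: linear_sum linear_cmul)
  finally show ?thesis .
qed

lemma Ck_on_compose:
  fixes f :: "'a::euclidean_space \<Rightarrow> 'b::euclidean_space" and g :: "'b \<Rightarrow> 'c::euclidean_space"
  assumes U: "open U" and "f ` U \<subseteq> V" "Ck_on k f U" "Ck_on k g V"
  shows "Ck_on k (\<lambda>x. g (f x)) U"
  using assms(3,4)
proof (induction k arbitrary: g)
  case 0
  then show ?case using assms(2) continuous_on_compose2[of V g U f] by simp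
next
  case (Suc k)
  have V: "f x \<in> V" if "x \<in> U" for x using that assms(2) by auto
  let ?f = "\<lambda>x. frechet_derivative f (at x)" and ?g = "\<lambda>x. frechet_derivative g (at x)"
  have D: "((\<lambda>x. g (f x)) has_derivative (\<lambda>v. ?g (f x) (?f x v))) (at x)" if "x \<in> U" for x
    using has_derivative_compose[OF Ck_on_has_derivative[OF Suc.prems(1) that]
        Ck_on_has_derivative[OF Suc.prems(2) V[OF that]]] .
  have "Ck_on k (\<lambda>x. ?g (f x) (?f x v)) U" for v
  proof -
    \<comment> \<open>The chain rule produces a direction \<open>?f x v\<close> that moves with
      \<open>x\<close>, whereas \<open>Ck_on\<close> controls fixed directions only. Expanding over
      the basis separates the two dependences.\<close>
    have "Ck_on k (\<lambda>x. \<Sum>b\<in>Basis. (?f x v \<bullet> b) *\<^sub>R ?g (f x) b) U"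
    proof (rule Ck_on_sum[OF U], rule Ck_on_bilinear[OF bounded_bilinear_scaleR U])
      fix b :: 'b
      show "Ck_on k (\<lambda>x. ?f x v \<bullet> b) U"
        by (rule Ck_on_linear_comp[OF bounded_linear_inner_left U
              Ck_on_frechet_derivative[OF Suc.prems(1)]])
      show "Ck_on k (\<lambda>x. ?g (f x) b) U"
        by (rule Suc.IH[OF Ck_on_SucD[OF Suc.prems(1)] Ck_on_frechet_derivative[OF Suc.prems(2)]])
    qed
    moreover have "?g (f x) (?f x v) = (\<Sum>b\<in>Basis. (?f x v \<bullet> b) *\<^sub>R ?g (f x) b)" if "x \<in> U" for x
      by (rule linear_apply_Basis[OF has_derivative_linear
            [OF Ck_on_has_derivative[OF Suc.prems(2) V[OF that]]]])
    ultimately show ?thesis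
      using Ck_on_cong[OF U, of "\<lambda>x. ?g (f x) (?f x v)"] by simp
  qed
  then show ?case by (subst Ck_on_Suc_iff[OF U D]) auto
qed

text \<open>The derivative of h = 1/sqrt(x) is -h^3/2, a polynomial in h, so the induction on
  \<open>k\<close> closes without other functions.\<close>

lemma Ck_on_inverse_sqrt: "Ck_on k (\<lambda>x. inverse (sqrt x)) {0<..}"
proof (induction k)
  case 0
  show ?case by (auto intro!: continuous_intros)
next
  case (Suc k)
  let ?h = "\<lambda>x. inverse (sqrt x)"
  have D: "(?h has_derivative (\<lambda>v. - (v / 2) *\<^sub>R (?h x * (?h x * ?h x)))) (at x)" if "x \<in> {0<..}" for x
  proof -
    have "(?h has_real_derivative - (?h x * (?h x / 2) * ?h x)) (at x)"
      by (rule DERIV_inverse') (use that DERIV_real_sqrt[of x] in auto)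
    then show ?thesis
      unfolding has_field_derivative_def
      by (rule has_derivative_eq_rhs) (simp add: fun_eq_iff)
  qed
  have "Ck_on k (\<lambda>x. - (v / 2) *\<^sub>R (?h x * (?h x * ?h x))) {0<..}" for v :: real
    by (rule Ck_on_linear_comp[OF bounded_linear_scaleR_right open_greaterThan
          Ck_on_bilinear[OF bounded_bilinear_mult open_greaterThan Suc
            Ck_on_bilinear[OF bounded_bilinear_mult open_greaterThan Suc Suc]]])
  then show ?case using Ck_on_Suc_iff[OF open_greaterThan D] by blast
qed

section \<open>Closure properties of smooth maps\<close>

lemma smooth_on_frechet_derivative:
  "smooth_on f U \<Longrightarrow> smooth_on (\<lambda>x. frechet_derivative f (at x) v) U"
  unfolding smooth_on_def using Ck_on_frechet_derivative by blast

lemma smooth_on_has_derivative: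
  "smooth_on f U \<Longrightarrow> x \<in> U \<Longrightarrow> (f has_derivative frechet_derivative f (at x)) (at x)"
  unfolding smooth_on_def using Ck_on_has_derivative by blast

lemma smooth_on_imp_continuous_on: "smooth_on f U \<Longrightarrow> continuous_on U f"
  unfolding smooth_on_def using Ck_on_imp_continuous_on by blast

lemma smooth_on_subset: "smooth_on f U \<Longrightarrow> V \<subseteq> U \<Longrightarrow> smooth_on f V"
  unfolding smooth_on_def using Ck_on_subset by blast

lemma smooth_on_linear: "open U \<Longrightarrow> bounded_linear f \<Longrightarrow> smooth_on f U"
  by (simp add: smooth_on_def Ck_on_linear)

lemma smooth_on_const: "open U \<Longrightarrow> smooth_on (\<lambda>x. c) U"
  by (simp add: smooth_on_def Ck_on_const)

lemma smooth_on_add: "open U \<Longrightarrow> smooth_on f U \<Longrightarrow> smooth_on g U \<Longrightarrow> smooth_on (\<lambda>x. f x + g x) U"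
  by (simp add: smooth_on_def Ck_on_add)

lemma smooth_on_bilinear:
  "bounded_bilinear b \<Longrightarrow> open U \<Longrightarrow> smooth_on f U \<Longrightarrow> smooth_on g U \<Longrightarrow> smooth_on (\<lambda>x. b (f x) (g x)) U"
  by (simp add: smooth_on_def Ck_on_bilinear)

lemma smooth_on_linear_comp:
  "bounded_linear h \<Longrightarrow> open U \<Longrightarrow> smooth_on f U \<Longrightarrow> smooth_on (\<lambda>x. h (f x)) U"
  by (simp add: smooth_on_def Ck_on_linear_comp)

lemma smooth_on_minus:
  assumes "open U" "smooth_on f U" "smooth_on g U" shows "smooth_on (\<lambda>x. f x - g x) U"
  using smooth_on_add[OF assms(1,2) smooth_on_linear_comp
      [OF bounded_linear_minus[OF bounded_linear_ident] assms(1,3)]] by simp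

lemma smooth_on_sum:
  "open U \<Longrightarrow> (\<And>i. i \<in> I \<Longrightarrow> smooth_on (f i) U) \<Longrightarrow> smooth_on (\<lambda>x. \<Sum>i\<in>I. f i x) U"
  by (simp add: smooth_on_def Ck_on_sum)

lemma smooth_on_compose:
  "open U \<Longrightarrow> f ` U \<subseteq> V \<Longrightarrow> smooth_on f U \<Longrightarrow> smooth_on g V \<Longrightarrow> smooth_on (\<lambda>x. g (f x)) U"
  unfolding smooth_on_def using Ck_on_compose by blast

lemma smooth_on_inverse_norm:
  assumes "open U" "smooth_on f U" "\<And>x. x \<in> U \<Longrightarrow> f x \<noteq> 0"
  shows "smooth_on (\<lambda>x. inverse (norm (f x))) U"
proof -
  have "smooth_on (\<lambda>x. f x \<bullet> f x) U"
    by (rule smooth_on_bilinear[OF bounded_bilinear_inner assms(1,2,2)])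
  moreover have "(\<lambda>x. f x \<bullet> f x) ` U \<subseteq> {0<..}"
    using assms(3) by auto
  ultimately show ?thesis
    using smooth_on_compose[OF assms(1), of _ "{0<..}" "\<lambda>x. inverse (sqrt x)"] Ck_on_inverse_sqrt
    by (simp add: smooth_on_def norm_eq_sqrt_inner)
qed

text \<open>Where the scalar factor vanishes, the product rule needs only continuity of the other
  factor: the error is \<open>h y\<close> times \<open>G y - G x\<close>, where the first is O(|y -
  x|) and the second tends to 0. It serves to differentiate an inverse operator known so far to be
  continuous.\<close>

lemma has_derivative_scaleR_vanishing:
  fixes h :: "'a::real_normed_vector \<Rightarrow> real" and G :: "'a \<Rightarrow> 'b::real_normed_vector"
  assumes h: "(h has_derivative h') (at x)" and "h x = 0" and G: "isCont G x"
  shows "((\<lambda>y. h y *\<^sub>R G y) has_derivative (\<lambda>u. h' u *\<^sub>R G x)) (at x)"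
proof -
  let ?e = "\<lambda>y. norm (h y - h x - h' (y - x)) / norm (y - x)"
  have e: "?e \<midarrow>x\<rightarrow> 0" and bl: "bounded_linear h'"
    using h by (simp_all add: has_derivative_iff_norm)
  obtain K where K: "\<And>u. norm (h' u) \<le> norm u * K" using bounded_linear.bounded[OF bl] by blast
  have bd: "norm (h y *\<^sub>R (G y - G x)) / norm (y - x) \<le> (?e y + K) * norm (G y - G x)"
    if "y \<noteq> x" for y
  proof -
    have "\<bar>h y\<bar> \<le> norm (h y - h x - h' (y - x)) + norm (y - x) * K"
      using K[of "y - x"] assms(2) by simp
    then have "\<bar>h y\<bar> / norm (y - x) \<le> ?e y + K"
      using that by (simp add: field_simps)
    then show ?thesis
      using mult_right_mono[of "\<bar>h y\<bar> / norm (y - x)" "?e y + K" "norm (G y - G x)"] by simp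
  qed
  have "(\<lambda>y. norm (G y - G x)) \<midarrow>x\<rightarrow> 0"
    using G by (simp add: isCont_def LIM_zero_iff tendsto_norm_zero_iff)
  then have "(\<lambda>y. (?e y + K) * norm (G y - G x)) \<midarrow>x\<rightarrow> (0 + K) * 0"
    by (intro tendsto_intros e)
  note lim = this
  have "(\<lambda>y. norm (h y *\<^sub>R (G y - G x)) / norm (y - x)) \<midarrow>x\<rightarrow> 0"
  proof (rule tendsto_sandwich[rotated 3])
    show "(\<lambda>y. (?e y + K) * norm (G y - G x)) \<midarrow>x\<rightarrow> 0"
      using lim by (simp only: mult_zero_right)
    show "\<forall>\<^sub>F y in at x. norm (h y *\<^sub>R (G y - G x)) / norm (y - x) \<le> (?e y + K) * norm (G y - G x)"
      unfolding eventually_at_filter using bd by (intro always_eventually) blast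
    show "\<forall>\<^sub>F y in at x. 0 \<le> norm (h y *\<^sub>R (G y - G x)) / norm (y - x)"
      by (intro always_eventually) simp
  qed (rule tendsto_const)
  then have "((\<lambda>y. h y *\<^sub>R (G y - G x)) has_derivative (\<lambda>u. 0)) (at x)"
    unfolding has_derivative_iff_norm using bounded_linear_zero assms(2) by simp
  from has_derivative_add[OF bounded_linear.has_derivative[OF bounded_linear_scaleR_left[of "G x"] h] this]
  show ?thesis by (simp add: scaleR_diff_right)
qed

text \<open>Inversion of operators preserves C^k. With w = G(y0) v one has G(y) v - w = G(y) (F(y0)
  w - F(y) w); together with the uniform bound this gives continuity, then differentiability, and it
  expresses the derivative by \<open>G\<close> and the derivative of \<open>F\<close>, which feeds
  the induction.\<close>

lemma Ck_on_inverse_derivative: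
  fixes F G :: "'a::euclidean_space \<Rightarrow> 'a \<Rightarrow> 'a"
  assumes V: "open V"
    and lin: "\<And>y. y \<in> V \<Longrightarrow> linear (F y)" "\<And>y. y \<in> V \<Longrightarrow> linear (G y)"
    and FG: "\<And>y v. y \<in> V \<Longrightarrow> F y (G y v) = v" and GF: "\<And>y v. y \<in> V \<Longrightarrow> G y (F y v) = v"
    and bound: "\<And>y v. y \<in> V \<Longrightarrow> norm (G y v) \<le> B * norm v"
    and F: "\<And>v. Ck_on k (\<lambda>y. F y v) V"
  shows "Ck_on k (\<lambda>y. G y v) V"
proof -
  have cont: "continuous_on V (\<lambda>y. G y v)" for v
    unfolding continuous_on_def
  proof
    fix y0 assume y0: "y0 \<in> V"
    let ?w = "G y0 v"
    have "((\<lambda>y. F y ?w) \<longlongrightarrow> F y0 ?w) (at y0 within V)"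
      using Ck_on_imp_continuous_on[OF F] y0 by (simp add: continuous_on_def)
    then have "((\<lambda>y. B * norm (F y0 ?w - F y ?w)) \<longlongrightarrow> B * norm (F y0 ?w - F y0 ?w)) (at y0 within V)"
      by (intro tendsto_intros)
    then have lim: "((\<lambda>y. B * norm (F y0 ?w - F y ?w)) \<longlongrightarrow> 0) (at y0 within V)" by simp
    have "norm (G y v - ?w) \<le> B * norm (F y0 ?w - F y ?w)" if "y \<in> V" for y
    proof -
      have "G y v - ?w = G y (F y0 ?w - F y ?w)"
        using that y0 lin(2)[OF that] by (simp add: FG GF linear_diff)
      then show ?thesis using bound[OF that] by simp
    qed
    then have "((\<lambda>y. G y v - ?w) \<longlongrightarrow> 0) (at y0 within V)"
      by (intro Lim_null_comparison[OF _ lim]) (auto simp: eventually_at_filter)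
    then show "((\<lambda>y. G y v) \<longlongrightarrow> ?w) (at y0 within V)"
      by (simp add: LIM_zero_iff)
  qed
  show ?thesis
    using F
  proof (induction k arbitrary: v)
    case 0
    show ?case using cont by simp
  next
    case (Suc k)
    let ?D = "\<lambda>c y. frechet_derivative (\<lambda>y. F y c) (at y)"
    let ?h = "\<lambda>y0 b y. - (\<Sum>c\<in>Basis. (G y0 v \<bullet> c) * ((F y c - F y0 c) \<bullet> b))"
    let ?h' = "\<lambda>y0 b u. - (\<Sum>c\<in>Basis. (G y0 v \<bullet> c) * (?D c y0 u \<bullet> b))"
    have IH: "Ck_on k (\<lambda>y. G y v) V" for v
      by (rule Suc.IH) (use Suc.prems Ck_on_SucD in blast)
    have D: "((\<lambda>y. G y v) has_derivative (\<lambda>u. \<Sum>b\<in>Basis. ?h' y0 b u *\<^sub>R G y0 b)) (at y0)"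
      if y0: "y0 \<in> V" for y0
    proof -
      have F': "((\<lambda>y. F y c) has_derivative ?D c y0) (at y0)" for c
        by (rule Ck_on_has_derivative[OF Suc.prems y0])
      have h': "(?h y0 b has_derivative ?h' y0 b) (at y0)" for b
        by (intro has_derivative_minus has_derivative_sum has_derivative_mult_right
            has_derivative_inner_left) (auto intro!: derivative_eq_intros F')
      have "isCont (\<lambda>y. G y b) y0" for b
        using cont V y0 continuous_on_eq_continuous_at by blast
      then have "((\<lambda>y. ?h y0 b y *\<^sub>R G y b) has_derivative (\<lambda>u. ?h' y0 b u *\<^sub>R G y0 b)) (at y0)" for b
        by (intro has_derivative_scaleR_vanishing h') auto
      then have "((\<lambda>y. G y0 v + (\<Sum>b\<in>Basis. ?h y0 b y *\<^sub>R G y b)) has_derivative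
          (\<lambda>u. 0 + (\<Sum>b\<in>Basis. ?h' y0 b u *\<^sub>R G y0 b))) (at y0)"
        by (intro has_derivative_add has_derivative_sum has_derivative_const)
      \<comment> \<open>The identity for G(y) v - G(y0) v in coordinates: \<open>?h y0 b y\<close>
        is the \<open>b\<close>-coefficient of F(y0) w - F(y) w and vanishes at \<open>y0\<close>,
        as the product rule above requires.\<close>
      moreover have "G y v = G y0 v + (\<Sum>b\<in>Basis. ?h y0 b y *\<^sub>R G y b)" if y: "y \<in> V" for y
      proof -
        let ?w = "G y0 v"
        have "(F y ?w - F y0 ?w) = (\<Sum>c\<in>Basis. (?w \<bullet> c) *\<^sub>R (F y c - F y0 c))"
          using linear_apply_Basis[OF lin(1)[OF y], of ?w] linear_apply_Basis[OF lin(1)[OF y0], of ?w]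
          by (simp add: sum_subtractf scaleR_diff_right)
        then have "?h y0 b y = (F y0 ?w - F y ?w) \<bullet> b" for b
          by (simp add: inner_sum_left inner_diff_left[symmetric] sum_negf[symmetric] minus_diff_eq[symmetric, of "F y0 ?w"]
            del: minus_diff_eq)
        then have "(\<Sum>b\<in>Basis. ?h y0 b y *\<^sub>R G y b) = G y (F y0 ?w - F y ?w)"
          using linear_apply_Basis[OF lin(2)[OF y], of "F y0 ?w - F y ?w"] by simp
        also have "\<dots> = G y v - ?w"
          using y y0 lin(2)[OF y] by (simp add: FG GF linear_diff)
        finally show ?thesis by simp
      qed
      ultimately show ?thesis
        using has_derivative_transform_within_open[OF _ V y0] by fastforce
    qed
    have "Ck_on k (\<lambda>y. \<Sum>b\<in>Basis. ?h' y b u *\<^sub>R G y b) V" for u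
    proof (rule Ck_on_sum[OF V], rule Ck_on_bilinear[OF bounded_bilinear_scaleR V _ IH])
      fix b :: 'a
      show "Ck_on k (\<lambda>y. ?h' y b u) V"
      proof (rule Ck_on_linear_comp[OF bounded_linear_minus[OF bounded_linear_ident] V],
          rule Ck_on_sum[OF V], rule Ck_on_bilinear[OF bounded_bilinear_mult V])
        fix c :: 'a
        show "Ck_on k (\<lambda>y. G y v \<bullet> c) V"
          by (rule Ck_on_linear_comp[OF bounded_linear_inner_left V IH])
        show "Ck_on k (\<lambda>y. ?D c y u \<bullet> b) V"
          by (rule Ck_on_linear_comp[OF bounded_linear_inner_left V
                Ck_on_frechet_derivative[OF Suc.prems]])
      qed
    qed
    then show ?case using Ck_on_Suc_iff[OF V D] by blast
  qed
qed

text \<open>Bootstrapping: the inverse function theorem makes \<open>g\<close> a differentiable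
  homeomorphism. If \<open>g\<close> is C^k, then so are y -> f'(g y) and its inverse, which is the
  derivative of \<open>g\<close>; hence \<open>g\<close> is C^(k+1).\<close>

lemma smooth_inverse_function:
  fixes f :: "'a::euclidean_space \<Rightarrow> 'a"
  assumes U0: "open U0" "p \<in> U0" and f: "smooth_on f U0"
    and p: "(f has_derivative (\<lambda>x. x)) (at p)"
  obtains U V g where "p \<in> U" "U \<subseteq> U0" "smooth_diffeo U V f g"
proof -
  define f' where "f' x = Blinfun (frechet_derivative f (at x))" for x
  have f'_eq: "blinfun_apply (f' x) = frechet_derivative f (at x)" if "x \<in> U0" for x
    unfolding f'_def using has_derivative_bounded_linear[OF smooth_on_has_derivative[OF f that]]
    by (rule bounded_linear_Blinfun_apply)
  have f': "(f has_derivative blinfun_apply (f' x)) (at x)" if "x \<in> U0" for x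
    using smooth_on_has_derivative[OF f that] f'_eq[OF that] by simp
  have cont: "continuous_on U0 f'"
  proof (rule continuous_on_blinfun_componentwise)
    fix b :: 'a
    have "continuous_on U0 (\<lambda>x. frechet_derivative f (at x) b)"
      by (rule smooth_on_imp_continuous_on[OF smooth_on_frechet_derivative[OF f]])
    then show "continuous_on U0 (\<lambda>x. blinfun_apply (f' x) b)"
      by (rule continuous_on_eq) (simp add: f'_eq)
  qed
  have id: "f' p = id_blinfun"
    using has_derivative_unique[OF f'[OF U0(2)] p] by (intro blinfun_eqI) simp
  \<comment> \<open>Within distance 1/2 of the identity an operator satisfies |w| \<le> 2 |f'(x) w|.
    This is the uniform bound on inverses needed above.\<close>
  define U1 where "U1 = {x \<in> U0. dist (f' x) id_blinfun < 1/2}"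
  have "open (U0 \<inter> f' -` ball id_blinfun (1/2))"
    using continuous_open_preimage[OF cont U0(1)] by blast
  then have U1: "open U1"
    unfolding U1_def by (rule back_subst) (auto simp: dist_commute)
  have pU1: "p \<in> U1" unfolding U1_def using U0(2) id by simp
  have U1U0: "U1 \<subseteq> U0" unfolding U1_def by auto
  obtain U V g g' where U: "open U" "U \<subseteq> U1" "p \<in> U" "open V" "homeomorphism U V f g"
    and g': "\<And>y. y \<in> V \<Longrightarrow> (g has_derivative (g' y)) (at y)"
      "\<And>y. y \<in> V \<Longrightarrow> g' y = inv_into UNIV (blinfun_apply (f'(g y)))"
      "\<And>y. y \<in> V \<Longrightarrow> bij (blinfun_apply (f'(g y)))"
  proof (rule inverse_function_theorem[OF U1 _ continuous_on_subset[OF cont U1U0] pU1])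
    show "(f has_derivative blinfun_apply (f' x)) (at x)" if "x \<in> U1" for x
      using f' U1U0 that by blast
    show "id_blinfun o\<^sub>L f' p = id_blinfun" by (simp add: id blinfun_eqI)
  qed (rule that)
  have gV: "g y \<in> U" if "y \<in> V" for y
    using U(5) that by (auto simp: homeomorphism_def)
  let ?F = "\<lambda>y v. blinfun_apply (f' (g y)) v"
  have fg: "?F y (g' y v) = v" if "y \<in> V" for y v
    using g'(2,3)[OF that] by (simp add: bij_is_surj surj_f_inv_f)
  have gf: "g' y (?F y v) = v" if "y \<in> V" for y v
    using g'(2,3)[OF that] by (simp add: bij_is_inj)
  have bound: "norm (g' y v) \<le> 2 * norm v" if y: "y \<in> V" for y v
  proof -
    let ?w = "g' y v"
    have "norm (f' (g y) - id_blinfun) \<le> 1/2"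
      using gV[OF y] U(2) by (force simp: U1_def dist_norm)
    then have "norm (blinfun_apply (f' (g y) - id_blinfun) ?w) \<le> 1/2 * norm ?w"
      using norm_blinfun[of "f' (g y) - id_blinfun" ?w] mult_right_mono[of _ "1/2" "norm ?w"]
      by (meson norm_ge_zero order_trans)
    then have "norm (v - ?w) \<le> 1/2 * norm ?w" using fg[OF y] by (simp add: blinfun.diff_left)
    then show ?thesis using norm_triangle_ineq2[of ?w v] by (simp add: norm_minus_commute)
  qed
  have "Ck_on k g V" for k
  proof (induction k)
    case 0
    show ?case using U(5) by (simp add: homeomorphism_def)
  next
    case (Suc k)
    have F: "Ck_on k (\<lambda>y. ?F y v) V" for v
    proof -
      have "Ck_on k (\<lambda>y. frechet_derivative f (at (g y)) v) V"
        using gV U(2) U1U0 smooth_on_frechet_derivative[OF f]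
        by (intro Ck_on_compose[OF U(4) _ Suc, of U0 "\<lambda>x. frechet_derivative f (at x) v"])
          (auto simp: smooth_on_def)
      moreover have "?F y v = frechet_derivative f (at (g y)) v" if "y \<in> V" for y
        using gV[OF that] U(2) U1U0 f'_eq by (metis subsetD)
      ultimately show ?thesis
        by (subst Ck_on_cong[OF U(4), of "\<lambda>y. ?F y v"]) auto
    qed
    have "Ck_on k (\<lambda>y. g' y v) V" for v
      by (rule Ck_on_inverse_derivative[OF U(4) _ _ fg gf bound F])
        (use g'(1) in \<open>auto intro: has_derivative_linear blinfun.bounded_linear_right
          bounded_linear.linear\<close>)
    then show ?case using Ck_on_Suc_iff[OF U(4) g'(1)] by blast
  qed
  then have "smooth_diffeo U V f g"
    unfolding smooth_diffeo_def using U smooth_on_subset[OF f, of U] U1U0 by (auto simp: smooth_on_def)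
  then show ?thesis using that U U1U0 by blast
qed

section \<open>Criteria for embedded submanifolds\<close>

lemma smooth_diffeo_subset:
  assumes "smooth_diffeo U V f g" "open U'" "U' \<subseteq> U"
  shows "smooth_diffeo U' (f ` U') f g"
proof -
  have h: "homeomorphism U V f g" and o: "open V" using assms(1) by (auto simp: smooth_diffeo_def)
  have "f ` U' = V \<inter> g -` U'"
    using h assms(3) by (auto simp: homeomorphism_def)
  then have op: "open (f ` U')"
    using continuous_open_preimage[of V g U'] h o assms(2) by (auto simp: homeomorphism_def)
  have "f ` U' \<subseteq> V" using h assms(3) by (auto simp: homeomorphism_def)
  then show ?thesis
    unfolding smooth_diffeo_def using assms(1,2) op
    by (intro conjI homeomorphism_of_subsets[OF h assms(3)])
      (auto simp: smooth_diffeo_def intro: smooth_on_subset[OF _ assms(3)] smooth_on_subset)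
qed

lemma embedded_submanifold_sliceI:
  fixes M :: "'a::euclidean_space set"
  assumes "\<And>p. p \<in> M \<Longrightarrow> \<exists>U f S. open U \<and> p \<in> U \<and> smooth_on f U \<and>
    (f has_derivative (\<lambda>x. x)) (at p) \<and> Real_Vector_Spaces.subspace S \<and> Real_Vector_Spaces.dim S = d \<and> (\<forall>x\<in>U. x \<in> M \<longleftrightarrow> f x \<in> S)"
  shows "embedded_submanifold d M"
  unfolding embedded_submanifold_def
proof
  fix p assume "p \<in> M"
  then obtain U0 f S where S: "open U0" "p \<in> U0" "smooth_on f U0" "(f has_derivative (\<lambda>x. x)) (at p)"
    "Real_Vector_Spaces.subspace S" "Real_Vector_Spaces.dim S = d" "\<forall>x\<in>U0. x \<in> M \<longleftrightarrow> f x \<in> S"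
    using assms by blast
  obtain U V g where U: "p \<in> U" "U \<subseteq> U0" "smooth_diffeo U V f g"
    using smooth_inverse_function[OF S(1-4)] by blast
  have "f ` U = V" using U(3) by (auto simp: smooth_diffeo_def homeomorphism_def)
  then have "f ` (M \<inter> U) = V \<inter> S" using S(7) U(2) by blast
  then show "\<exists>U V f g S. p \<in> U \<and> smooth_diffeo U V f g \<and> Real_Vector_Spaces.subspace S \<and> Real_Vector_Spaces.dim S = d \<and> f ` (M \<inter> U) = V \<inter> S"
    using U S by blast
qed

text \<open>The trace, taken over the standard basis, is rewritten in an orthonormal basis of the
  range, on which \<open>T\<close> is the identity. The projection may be oblique.\<close>

lemma dim_range_idempotent:
  fixes T :: "'a::euclidean_space \<Rightarrow> 'a"
  assumes T: "linear T" "\<And>x. T (T x) = T x"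
  shows "real (Real_Vector_Spaces.dim (range T)) = (\<Sum>b\<in>Basis. T b \<bullet> b)"
proof -
  have S: "Real_Vector_Spaces.subspace (range T)" by (rule linear_subspace_image[OF T(1) subspace_UNIV])
  obtain C where C: "C \<subseteq> range T" "pairwise real_inner_class.orthogonal C" "\<And>x. x \<in> C \<Longrightarrow> norm x = 1"
    "independent C" "card C = Real_Vector_Spaces.dim (range T)" "Real_Vector_Spaces.span C = range T"
    by (rule orthonormal_basis_subspace[OF S], rule that)
  have fin: "finite C" using C(4) independent_imp_finite by blast
  have rep: "x = (\<Sum>c\<in>C. (x \<bullet> c) *\<^sub>R c)" if x: "x \<in> range T" for x
  proof -
    let ?y = "x - (\<Sum>c\<in>C. (x \<bullet> c) *\<^sub>R c)"
    have "x \<in> Real_Vector_Spaces.span C" using x C(6) by simp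
    moreover have "(\<Sum>c\<in>C. (x \<bullet> c) *\<^sub>R c) \<in> Real_Vector_Spaces.span C"
      by (intro span_sum span_scale span_base)
    ultimately have "?y \<in> Real_Vector_Spaces.span C" by (rule span_diff)
    moreover have "real_inner_class.orthogonal ?y c" if "c \<in> C" for c
    proof -
      have "(\<Sum>a\<in>C. (x \<bullet> a) * (a \<bullet> c)) = (\<Sum>a\<in>C. if a = c then x \<bullet> c else 0)"
        using C(2,3) that by (intro sum.cong) (auto simp: pairwise_def real_inner_class.orthogonal_def norm_eq_1)
      then show ?thesis
        using that fin by (simp add: real_inner_class.orthogonal_def inner_diff_left inner_sum_left)
    qed
    ultimately have "real_inner_class.orthogonal ?y ?y"
      using orthogonal_to_span by blast
    then show ?thesis by (simp add: orthogonal_self)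
  qed
  have "(\<Sum>b\<in>Basis. T b \<bullet> b) = (\<Sum>b\<in>Basis. \<Sum>c\<in>C. (T b \<bullet> c) * (c \<bullet> b))"
    by (rule sum.cong[OF refl], subst rep) (auto simp: inner_sum_left)
  also have "\<dots> = (\<Sum>c\<in>C. \<Sum>b\<in>Basis. (c \<bullet> b) *\<^sub>R T b \<bullet> c)"
    by (subst sum.swap) (simp add: mult.commute)
  also have "\<dots> = (\<Sum>c\<in>C. T c \<bullet> c)"
  proof (rule sum.cong[OF refl])
    fix c
    show "(\<Sum>b\<in>Basis. (c \<bullet> b) *\<^sub>R T b \<bullet> c) = T c \<bullet> c"
      by (subst (2) linear_apply_Basis[OF T(1)]) (simp add: inner_sum_left)
  qed
  also have "\<dots> = (\<Sum>c\<in>C. 1)"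
  proof (rule sum.cong[OF refl])
    fix c assume c: "c \<in> C"
    then have "T c = c" using C(1) T(2) by auto
    then show "T c \<bullet> c = 1" using C(3)[OF c] by (simp add: norm_eq_1)
  qed
  finally show ?thesis using C(5) by simp
qed

text \<open>Differentiating r(r x) = r x at a fixed point makes the derivative \<open>T\<close>
  idempotent, so the fixed point set looks like the range of \<open>T\<close> there. The trace
  hypothesis is what makes the dimension the same at every point.\<close>

lemma embedded_submanifold_retract:
  fixes M :: "'a::euclidean_space set"
  assumes W: "open W" "M \<subseteq> W" and r: "smooth_on r W" "r ` W \<subseteq> M" "\<And>x. x \<in> M \<Longrightarrow> r x = x"
    and d: "\<And>p. p \<in> M \<Longrightarrow> (\<Sum>b\<in>Basis. frechet_derivative r (at p) b \<bullet> b) = real d"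
  shows "embedded_submanifold d M"
  unfolding embedded_submanifold_def
proof
  fix p assume p: "p \<in> M"
  define T where "T = frechet_derivative r (at p)"
  have pW: "p \<in> W" and rp: "r p = p" using p W r by auto
  have rT: "(r has_derivative T) (at p)" unfolding T_def by (rule smooth_on_has_derivative[OF r(1) pW])
  then have bl: "bounded_linear T" and lin: "linear T"
    by (auto intro: has_derivative_bounded_linear has_derivative_linear)
  have "((\<lambda>x. r (r x)) has_derivative (\<lambda>v. T (T v))) (at p)"
    by (rule has_derivative_compose[OF rT]) (simp add: rp rT)
  then have "(r has_derivative (\<lambda>v. T (T v))) (at p)"
    by (rule has_derivative_transform_within_open[OF _ W(1) pW]) (use r in auto)
  then have TT: "T (T v) = T v" for v using has_derivative_unique[OF rT] by (metis (no_types))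
  have Td: "T (x - y) = T x - T y" for x y using lin by (rule linear_diff)
  \<comment> \<open>\<open>\<phi> \<circ> r = T \<circ> \<phi>\<close>, so that \<open>\<phi>\<close> straightens \<open>M\<close>, the set of fixed points of \<open>r\<close>, to the range of \<open>T\<close>\<close>
  define \<phi> where "\<phi> x = (x - r x) - T (x - r x) + T (r x - p)" for x
  have \<phi>_T: "T (\<phi> x) = T (r x - p)" for x
    using lin by (simp add: \<phi>_def linear_diff linear_add TT)
  have \<phi>r: "\<phi> (r x) = T (\<phi> x)" if "x \<in> W" for x
  proof -
    have "r (r x) = r x" using r that by auto
    then show ?thesis using lin by (simp add: \<phi>_T) (simp add: \<phi>_def linear_0)
  qed
  have sm: "smooth_on \<phi> W"
    unfolding \<phi>_def using W(1) r(1)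
    by (intro smooth_on_add smooth_on_minus smooth_on_linear_comp[OF bl]) (auto intro: smooth_on_linear smooth_on_const)
  have "(\<phi> has_derivative (\<lambda>v. (v - T v) - T (v - T v) + T (T v - 0))) (at p)"
    unfolding \<phi>_def
    by (intro has_derivative_add has_derivative_diff bounded_linear.has_derivative[OF bl]
        has_derivative_ident rT has_derivative_const)
  then have der: "(\<phi> has_derivative (\<lambda>v. v)) (at p)" by (simp add: Td TT)
  obtain U V g where U: "p \<in> U" "U \<subseteq> W" "smooth_diffeo U V \<phi> g"
    using smooth_inverse_function[OF W(1) pW sm der] by blast
  \<comment> \<open>Both \<open>x\<close> and \<open>r x\<close> must lie in \<open>U\<close>, so
    that injectivity of \<open>\<phi>\<close> there turns \<phi>(r x) = \<phi>(x) into r x =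
    x.\<close>
  define U' where "U' = U \<inter> (W \<inter> r -` U)"
  have opU: "open U" using U(3) by (simp add: smooth_diffeo_def)
  have U': "open U'" "U' \<subseteq> U" "p \<in> U'"
    unfolding U'_def using opU U(1) pW rp
      continuous_open_preimage[OF smooth_on_imp_continuous_on[OF r(1)] W(1) opU] by auto
  have inj: "inj_on \<phi> U"
    using U(3) by (auto simp: smooth_diffeo_def homeomorphism_def intro: inj_on_inverseI)
  have "\<phi> ` (M \<inter> U') = \<phi> ` U' \<inter> range T"
  proof (intro equalityI subsetI)
    fix z assume "z \<in> \<phi> ` (M \<inter> U')"
    then obtain x where x: "x \<in> M" "x \<in> U'" "z = \<phi> x" by blast
    have "z = T (\<phi> x)" using \<phi>r[of x] x r(3) W(2) by auto
    then show "z \<in> \<phi> ` U' \<inter> range T" using x by blast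
  next
    fix z assume "z \<in> \<phi> ` U' \<inter> range T"
    then obtain x where x: "x \<in> U'" "z = \<phi> x" "\<phi> x \<in> range T" by blast
    then have "\<phi> (r x) = \<phi> x" using \<phi>r[of x] TT by (auto simp: U'_def)
    then have "r x = x" using inj x(1) by (auto simp: U'_def inj_on_def)
    moreover have "r x \<in> M" using x(1) r(2) by (auto simp: U'_def)
    ultimately show "z \<in> \<phi> ` (M \<inter> U')" using x by auto
  qed
  moreover have "Real_Vector_Spaces.dim (range T) = d"
    using dim_range_idempotent[OF lin TT] d[OF p] by (simp add: T_def)
  moreover have "Real_Vector_Spaces.subspace (range T)" by (rule linear_subspace_image[OF lin subspace_UNIV])
  ultimately show "\<exists>U V f g S. p \<in> U \<and> smooth_diffeo U V f g \<and> Real_Vector_Spaces.subspace S \<and> Real_Vector_Spaces.dim S = d \<and> f ` (M \<inter> U) = V \<inter> S"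
    using U'(3) smooth_diffeo_subset[OF U(3) U'(1,2)] by blast
qed

section \<open>Matrix algebra\<close>

lemma cmat_eqI: "(\<And>i j. A $ i $ j = B $ i $ j) \<Longrightarrow> A = B" for A B :: "'n::finite cmat"
  by (simp add: Finite_Cartesian_Product.vec_eq_iff)

lemma cmat_mult_nth: "(A ** B) $ i $ j = (\<Sum>l\<in>UNIV. A $ i $ l * B $ l $ j)" for A B :: "'n::finite cmat"
  by (simp add: matrix_matrix_mult_def)

lemma conj_transpose_nth [simp]: "conj_transpose A $ i $ j = cnj (A $ j $ i)"
  by (simp add: conj_transpose_def)

lemma bounded_bilinear_cmat_mult: "bounded_bilinear ((**) :: 'n::finite cmat \<Rightarrow> 'n cmat \<Rightarrow> 'n cmat)"
proof -
  have "bilinear ((**) :: 'n cmat \<Rightarrow> 'n cmat \<Rightarrow> 'n cmat)"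
    unfolding bilinear_def
    by (auto intro!: linearI cmat_eqI simp: cmat_mult_nth sum.distrib distrib_left distrib_right
        scaleR_sum_right)
  then show ?thesis by (simp add: bilinear_conv_bounded_bilinear)
qed

lemma bounded_bilinear_cmat_vec: "bounded_bilinear ((*v) :: 'n::finite cmat \<Rightarrow> complex^'n \<Rightarrow> complex^'n)"
proof -
  have "bilinear ((*v) :: 'n cmat \<Rightarrow> complex^'n \<Rightarrow> complex^'n)"
    unfolding bilinear_def
    by (auto intro!: linearI simp: Finite_Cartesian_Product.vec_eq_iff matrix_vector_mult_def sum.distrib
        distrib_left distrib_right scaleR_sum_right)
  then show ?thesis by (simp add: bilinear_conv_bounded_bilinear)
qed

lemmas cmat_scaleR_left = bounded_bilinear.scaleR_left[OF bounded_bilinear_cmat_mult]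
  and cmat_scaleR_right = bounded_bilinear.scaleR_right[OF bounded_bilinear_cmat_mult]
  and cmat_add_left = bounded_bilinear.add_left[OF bounded_bilinear_cmat_mult]
  and cmat_add_right = bounded_bilinear.add_right[OF bounded_bilinear_cmat_mult]
  and cmat_zero_left [simp] = bounded_bilinear.zero_left[OF bounded_bilinear_cmat_mult]
  and cmat_zero_right [simp] = bounded_bilinear.zero_right[OF bounded_bilinear_cmat_mult]
  and cmat_sum_left = bounded_bilinear.sum_left[OF bounded_bilinear_cmat_mult]
  and cmat_sum_right = bounded_bilinear.sum_right[OF bounded_bilinear_cmat_mult]
  and cvec_scaleR_left = bounded_bilinear.scaleR_left[OF bounded_bilinear_cmat_vec]
  and cvec_scaleR_right = bounded_bilinear.scaleR_right[OF bounded_bilinear_cmat_vec]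
  and cvec_add_left = bounded_bilinear.add_left[OF bounded_bilinear_cmat_vec]
  and cvec_diff_left = bounded_bilinear.diff_left[OF bounded_bilinear_cmat_vec]
  and cvec_diff_right = bounded_bilinear.diff_right[OF bounded_bilinear_cmat_vec]
  and cvec_zero_right [simp] = bounded_bilinear.zero_right[OF bounded_bilinear_cmat_vec]
  and cvec_sum_left = bounded_bilinear.sum_left[OF bounded_bilinear_cmat_vec]
  and cvec_sum_right = bounded_bilinear.sum_right[OF bounded_bilinear_cmat_vec]

lemma cvec_assoc: "A *v (B *v v) = (A ** B) *v v" for A B :: "'n::finite cmat"
  by (simp add: matrix_vector_mul_assoc)

lemma trace_cmat_zero [simp]: "trace (0 :: 'n::finite cmat) = 0"
  by (simp add: trace_def)

lemma trace_cmat_commute: "trace (A ** B) = trace (B ** A)" for A B :: "'n::finite cmat"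
  by (rule trace_mul_sym)

lemma conj_transpose_add: "conj_transpose (A + B) = conj_transpose A + conj_transpose B"
  by (simp add: cmat_eqI)

lemma conj_transpose_scaleR: "conj_transpose (r *\<^sub>R A) = r *\<^sub>R conj_transpose A"
  by (simp add: cmat_eqI)

lemma conj_transpose_zero [simp]: "conj_transpose 0 = 0"
  by (simp add: cmat_eqI)

lemma conj_transpose_conj_transpose [simp]: "conj_transpose (conj_transpose A) = A"
  by (simp add: cmat_eqI)

lemma conj_transpose_sum: "conj_transpose (\<Sum>i\<in>I. f i) = (\<Sum>i\<in>I. conj_transpose (f i))"
  by (induction I rule: infinite_finite_induct) (simp_all add: conj_transpose_add)

lemma bounded_linear_conj_transpose: "bounded_linear (conj_transpose :: 'n::finite cmat \<Rightarrow> 'n cmat)"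
  by (intro linear_conv_bounded_linear[THEN iffD1] linearI) (simp_all add: conj_transpose_add conj_transpose_scaleR)

lemma hermitian_nth: "hermitian A \<Longrightarrow> cnj (A $ i $ j) = A $ j $ i"
  unfolding hermitian_def by (metis conj_transpose_nth)

text \<open>For Hermitian \<open>N\<close> this trace is the squared Frobenius norm. It lets
  identities between polynomials of a matrix be checked on traces, without diagonalizing.\<close>

lemma hermitian_square_trace_0:
  assumes "hermitian N" "trace (N ** N) = 0" shows "N = 0"
proof -
  have "(\<Sum>i\<in>UNIV. \<Sum>j\<in>UNIV. (cmod (N $ i $ j))\<^sup>2) = Re (trace (N ** N))"
  proof -
    have "(cmod (N $ i $ j))\<^sup>2 = Re (N $ i $ j * N $ j $ i)" for i j
      by (metis Re_complex_of_real complex_norm_square hermitian_nth[OF assms(1)])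
    then show ?thesis by (simp add: trace_def cmat_mult_nth)
  qed
  then have "(\<Sum>i\<in>UNIV. \<Sum>j\<in>UNIV. (cmod (N $ i $ j))\<^sup>2) = 0" using assms(2) by simp
  then show ?thesis
    by (intro cmat_eqI) (simp add: sum_nonneg_eq_0_iff sum_nonneg)
qed

section \<open>Leading corners\<close>

definition pos :: "'n::{finite,linorder} \<Rightarrow> nat" where
  "pos = inv_into {..<CARD('n)} nth_index"

lemma bij_betw_nth_index: "bij_betw (nth_index :: nat \<Rightarrow> 'n::{finite,linorder}) {..<CARD('n)} UNIV"
  unfolding nth_index_def by (rule bij_betw_nth) simp_all

lemma pos_less: "pos (i :: 'n::{finite,linorder}) < CARD('n)"
  using bij_betw_nth_index inv_into_into[of i nth_index "{..<CARD('n)}"]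
  by (auto simp: pos_def bij_betw_def)

lemma nth_index_pos [simp]: "nth_index (pos i) = i"
  using bij_betw_nth_index[where 'n='a] by (simp add: pos_def bij_betw_def f_inv_into_f)

lemma pos_nth_index [simp]: "i < CARD('n) \<Longrightarrow> pos (nth_index i :: 'n::{finite,linorder}) = i"
  using bij_betw_nth_index[where 'n='n] by (simp add: pos_def bij_betw_def)

lemma pos_eq_iff [simp]: "pos i = pos j \<longleftrightarrow> i = j"
  by (metis nth_index_pos)

lemma sum_nth_index: "(\<Sum>i\<in>UNIV. f i) = (\<Sum>i<CARD('n). f (nth_index i))"
  for f :: "'n::{finite,linorder} \<Rightarrow> _"
  using sum.reindex_bij_betw[OF bij_betw_nth_index, of f] by simp

lemma sum_corner:
  assumes "k \<le> CARD('n::{finite,linorder})"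
  shows "(\<Sum>i\<in>(UNIV::'n set). if pos i < k then f (pos i) else 0) = (\<Sum>i<k. f i)"
proof -
  have "(\<Sum>i<CARD('n). if pos (nth_index i :: 'n) < k then f (pos (nth_index i :: 'n)) else 0)
      = (\<Sum>i<CARD('n). if i < k then f i else 0)"
    by (intro sum.cong) auto
  also have "\<dots> = (\<Sum>i<k. f i)"
    using assms by (intro sum.mono_neutral_cong_right) auto
  finally show ?thesis by (simp add: sum_nth_index)
qed

definition corner :: "nat \<Rightarrow> 'n::{finite,linorder} cmat" where
  "corner k = (\<chi> i j. if i = j \<and> pos i < k then 1 else 0)"

text \<open>Blocks are kept in the full matrix type and padded by zeros, so that \<open>k\<close>
  can vary in an induction; \<open>corner k\<close> is their unit.\<close>

definition block :: "nat \<Rightarrow> 'n::{finite,linorder} cmat \<Rightarrow> 'n cmat" where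
  "block k A = corner k ** A ** corner k"

lemma corner_nth [simp]: "corner k $ i $ j = (if i = j \<and> pos i < k then 1 else 0)"
  by (simp add: corner_def)

lemma corner_mult_nth [simp]: "(corner k ** A) $ i $ j = (if pos i < k then A $ i $ j else 0)"
  for A :: "'n::{finite,linorder} cmat"
proof -
  have "(corner k ** A) $ i $ j = (\<Sum>l\<in>UNIV. if i = l then (if pos i < k then A $ i $ j else 0) else 0)"
    unfolding cmat_mult_nth by (intro sum.cong) auto
  then show ?thesis by simp
qed

lemma mult_corner_nth [simp]: "(A ** corner k) $ i $ j = (if pos j < k then A $ i $ j else 0)"
  for A :: "'n::{finite,linorder} cmat"
proof -
  have "(A ** corner k) $ i $ j = (\<Sum>l\<in>UNIV. if l = j then (if pos j < k then A $ i $ j else 0) else 0)"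
    unfolding cmat_mult_nth by (intro sum.cong) auto
  then show ?thesis by simp
qed

lemma block_nth [simp]: "block k A $ i $ j = (if pos i < k \<and> pos j < k then A $ i $ j else 0)"
  by (simp add: block_def)

lemma corner_vec_nth [simp]: "(corner k *v v) $ i = (if pos i < k then v $ i else 0)"
proof -
  have "(corner k *v v) $ i = (\<Sum>l\<in>UNIV. if i = l then (if pos i < k then v $ i else 0) else 0)"
    unfolding matrix_vector_mult_def vec_lambda_beta by (intro sum.cong) auto
  then show ?thesis by simp
qed

lemma corner_mult_block [simp]: "corner k ** block k A = block k A" "block k A ** corner k = block k A"
  by (auto intro!: cmat_eqI)

lemma corner_mult_corner [simp]: "corner k ** corner k = corner k"
  by (auto intro!: cmat_eqI)

lemma corner_full [simp]: "corner CARD('n) = (Finite_Cartesian_Product.mat 1 :: 'n::{finite,linorder} cmat)"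
  by (intro cmat_eqI) (simp add: pos_less Finite_Cartesian_Product.mat_def)

lemma block_full [simp]: "block CARD('n) A = (A :: 'n::{finite,linorder} cmat)"
  by (intro cmat_eqI) (simp add: pos_less)

lemma block_block: "block k (block m A) = block (min k m) A"
  by (intro cmat_eqI) simp

lemma hermitian_corner [simp]: "hermitian (corner k)"
  unfolding hermitian_def by (intro cmat_eqI) auto

lemma hermitian_block: "hermitian A \<Longrightarrow> hermitian (block k A)"
  unfolding hermitian_def by (intro cmat_eqI) (auto simp: hermitian_def hermitian_nth)

lemma bounded_linear_block: "bounded_linear (block k :: 'n::{finite,linorder} cmat \<Rightarrow> 'n cmat)"
  by (intro linear_conv_bounded_linear[THEN iffD1] linearI) (auto intro!: cmat_eqI)

text \<open>Transports matrices of explicit dimension, for which characteristic polynomials and the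
  Schur decomposition are available, into the padded blocks.\<close>

definition emb :: "nat \<Rightarrow> complex Matrix.mat \<Rightarrow> 'n::{finite,linorder} cmat" where
  "emb k M = (\<chi> i j. if pos i < k \<and> pos j < k then M $$ (pos i, pos j) else 0)"

lemma emb_mult:
  assumes "k \<le> CARD('n)" "M \<in> carrier_mat k k" "N \<in> carrier_mat k k"
  shows "(emb k (M * N) :: 'n::{finite,linorder} cmat) = emb k M ** emb k N"
proof (rule cmat_eqI)
  fix i j :: 'n
  show "emb k (M * N) $ i $ j = (emb k M ** emb k N) $ i $ j"
  proof (cases "pos i < k \<and> pos j < k")
    case True
    have "(emb k M ** emb k N) $ i $ j
        = (\<Sum>l\<in>(UNIV::'n set). if pos l < k then M $$ (pos i, pos l) * N $$ (pos l, pos j) else 0)"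
      using True by (auto simp: cmat_mult_nth emb_def intro!: sum.cong)
    also have "\<dots> = (\<Sum>l<k. M $$ (pos i, l) * N $$ (l, pos j))" by (rule sum_corner[OF assms(1)])
    also have "\<dots> = (M * N) $$ (pos i, pos j)"
      using True assms by (simp add: scalar_prod_def lessThan_atLeast0)
    finally show ?thesis using True by (simp add: emb_def)
  qed (auto simp: emb_def cmat_mult_nth)
qed

lemma emb_one [simp]: "emb k (1\<^sub>m k) = corner k"
  by (intro cmat_eqI) (auto simp: emb_def)

lemma emb_leading_submatrix [simp]: "emb k (leading_submatrix k A) = block k A"
  by (intro cmat_eqI) (auto simp: emb_def leading_submatrix_def)

lemma leading_submatrix_carrier [simp]: "leading_submatrix k A \<in> carrier_mat k k"
  by (simp add: leading_submatrix_def)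

section \<open>Polynomials of a matrix\<close>

text \<open>The constant term is multiplied with \<open>U\<close>, the unit of the corner in which \<open>M\<close> lives.\<close>

definition peval :: "'n::finite cmat \<Rightarrow> real poly \<Rightarrow> 'n cmat \<Rightarrow> 'n cmat" where
  "peval U p M = fold_coeffs (\<lambda>a X. a *\<^sub>R U + M ** X) p 0"

lemma peval_0 [simp]: "peval U 0 M = 0"
  by (simp add: peval_def)

lemma peval_pCons [simp]: "peval U (pCons a p) M = a *\<^sub>R U + M ** peval U p M"
  by (cases "p = 0 \<and> a = 0") (auto simp: peval_def)

lemma peval_add: "peval U (p + q) M = peval U p M + peval U q M"
  by (induction p q rule: poly_induct2) (simp_all add: cmat_add_right scaleR_left_distrib)

lemma peval_smult: "peval U (Polynomial.smult c p) M = c *\<^sub>R peval U p M"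
  by (induction p) (simp_all add: cmat_scaleR_right scaleR_right_distrib)

lemma peval_sum: "peval U (\<Sum>i\<in>I. p i) M = (\<Sum>i\<in>I. peval U (p i) M)"
  by (induction I rule: infinite_finite_induct) (simp_all add: peval_add)

locale corner_algebra =
  fixes U M :: "'n::finite cmat"
  assumes UU: "U ** U = U" and UM: "U ** M = M" and MU: "M ** U = M"
begin

lemma unit_peval [simp]: "U ** peval U p M = peval U p M"
  by (induction p) (simp_all add: cmat_add_right cmat_scaleR_right UU matrix_mul_assoc UM)

lemma peval_unit [simp]: "peval U p M ** U = peval U p M"
  by (induction p) (simp_all add: cmat_add_left cmat_scaleR_left UU matrix_mul_assoc[symmetric])

lemma peval_mult: "peval U (p * q) M = peval U p M ** peval U q M"
  by (induction p) (simp_all add: peval_add peval_smult cmat_add_left cmat_scaleR_left matrix_mul_assoc)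

lemma peval_commute: "peval U p M ** M = M ** peval U p M"
proof -
  have "peval U p M ** peval U [:0, 1:] M = peval U [:0, 1:] M ** peval U p M"
    by (metis mult.commute peval_mult)
  then show ?thesis by (simp add: MU)
qed

lemma hermitian_peval:
  assumes "hermitian U" "hermitian M" shows "hermitian (peval U p M)"
proof (induction p)
  case 0
  show ?case by (simp add: hermitian_def)
next
  case (pCons a p)
  then show ?case using assms
    by (simp add: hermitian_def conj_transpose_add conj_transpose_scaleR conj_transpose_mult peval_commute)
qed

lemma peval_similar:
  assumes "P ** Q = U" "Q ** P = U" "U ** B = B" "B ** U = B" "M = P ** B ** Q" "P ** U = P"
  shows "peval U p M = P ** peval U p B ** Q"
proof (induction p)
  case (pCons a p)
  have "M ** (P ** peval U p B ** Q) = P ** (B ** (Q ** P) ** peval U p B) ** Q"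
    by (simp add: assms(5) matrix_mul_assoc)
  then have "M ** (P ** peval U p B ** Q) = P ** (B ** peval U p B) ** Q"
    by (simp only: assms)
  then show ?case using pCons assms(1,6)
    by (simp add: cmat_add_left cmat_add_right cmat_scaleR_left cmat_scaleR_right)
qed simp

end

lemma corner_algebra_block: "corner_algebra (corner k) (block k A)"
  by unfold_locales simp_all

lemma peval_triangular:
  fixes B :: "'n::{finite,linorder} cmat"
  assumes tri: "\<And>i j. pos j < pos i \<Longrightarrow> B $ i $ j = 0"
  shows "pos j < pos i \<Longrightarrow> peval (corner k) p B $ i $ j = 0"
    and "pos i < k \<Longrightarrow> peval (corner k) p B $ i $ i = poly (map_poly of_real p) (B $ i $ i)"
proof -
  have A: "(pos j < pos i \<longrightarrow> peval (corner k) p B $ i $ j = 0) \<and>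
      (pos i < k \<longrightarrow> peval (corner k) p B $ i $ i = poly (map_poly of_real p) (B $ i $ i))" for i j :: 'n
  proof (induction p arbitrary: i j)
    case (pCons a p)
    let ?X = "peval (corner k) p B"
    \<comment> \<open>In every product treated in this claim and the next, one of the factors lies
      strictly below the diagonal and so vanishes.\<close>
    have 0: "B $ i $ l * ?X $ l $ j = 0" if "pos j < pos i" for i j l
      using tri[of l i] pCons.IH[of j l] that by (cases "pos l < pos i") auto
    have 1: "B $ i $ l * ?X $ l $ i = 0" if "l \<noteq> i" for i l
      using tri[of l i] pCons.IH[of i l] that pos_eq_iff[of i l]
      by (cases "pos l < pos i") (auto simp del: pos_eq_iff)
    have "(B ** ?X) $ i $ i = (\<Sum>l\<in>{i}. B $ i $ l * ?X $ l $ i)"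
      unfolding cmat_mult_nth using 1 by (intro sum.mono_neutral_right) auto
    moreover have "(B ** ?X) $ i $ j = 0" if "pos j < pos i"
      unfolding cmat_mult_nth using 0[OF that] by (intro sum.neutral) simp
    ultimately show ?case using pCons.IH[of i i] pCons.hyps
      by (auto simp: map_poly_pCons of_real_def)
  qed simp
  show "pos j < pos i \<Longrightarrow> peval (corner k) p B $ i $ j = 0"
    and "pos i < k \<Longrightarrow> peval (corner k) p B $ i $ i = poly (map_poly of_real p) (B $ i $ i)"
    using A by blast+
qed

text \<open>Schur triangularization: a polynomial of a triangular matrix carries the values at the
  diagonal entries on its diagonal, and these entries are the roots \<open>as\<close>. Similarity
  preserves the trace.\<close>

lemma trace_peval_block_complex:
  fixes A :: "'n::{finite,linorder} cmat"
  assumes k: "k \<le> CARD('n)" and as: "char_poly (leading_submatrix k A) = (\<Prod>a\<leftarrow>as. [:- a, 1:])"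
  shows "trace (peval (corner k) p (block k A)) = (\<Sum>a\<leftarrow>as. poly (map_poly of_real p) a)"
proof -
  let ?M = "leading_submatrix k A"
  obtain B P Q where s: "schur_decomposition ?M as = (B, P, Q)" by (metis prod_cases3)
  have sim: "similar_mat_wit ?M B P Q" and tri: "upper_triangular B" and diag: "diag_mat B = as"
    using schur_decomposition[OF leading_submatrix_carrier as s] by auto
  have c: "B \<in> carrier_mat k k" "P \<in> carrier_mat k k" "Q \<in> carrier_mat k k"
    and eq: "P * Q = 1\<^sub>m k" "Q * P = 1\<^sub>m k" "?M = P * B * Q"
    using similar_mat_witD2[OF leading_submatrix_carrier sim] by auto
  let ?e = "emb k :: _ \<Rightarrow> 'n cmat"
  interpret corner_algebra "corner k" "block k A" by (rule corner_algebra_block)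
  interpret B: corner_algebra "corner k" "?e B"
    by unfold_locales (auto intro!: cmat_eqI simp: emb_def)
  have PQ: "?e P ** ?e Q = corner k" "?e Q ** ?e P = corner k" "block k A = ?e P ** ?e B ** ?e Q"
    using emb_mult[OF k c(2,3)] emb_mult[OF k c(3,2)] emb_mult[OF k c(2,1)]
      emb_mult[OF k mult_carrier_mat[OF c(2,1)] c(3)] eq by (simp_all flip: emb_leading_submatrix)
  have "peval (corner k) p (block k A) = ?e P ** peval (corner k) p (?e B) ** ?e Q"
    by (rule peval_similar[OF PQ(1,2) _ _ PQ(3)]) (auto intro!: cmat_eqI simp: emb_def)
  then have "trace (peval (corner k) p (block k A)) = trace (?e Q ** (?e P ** peval (corner k) p (?e B)))"
    using trace_cmat_commute by metis
  also have "\<dots> = trace (peval (corner k) p (?e B))"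
    by (simp add: matrix_mul_assoc PQ)
  also have "\<dots> = trace (corner k ** peval (corner k) p (?e B))" by simp
  also have "\<dots> = (\<Sum>i\<in>(UNIV::'n set). if pos i < k then poly (map_poly of_real p) (B $$ (pos i, pos i)) else 0)"
    unfolding trace_def
  proof (intro sum.cong refl)
    fix i :: 'n
    have "pos j < pos i \<Longrightarrow> ?e B $ i $ j = 0" for i j :: 'n
      using tri c(1) by (auto simp: emb_def upper_triangular_def)
    then show "(corner k ** peval (corner k) p (?e B)) $ i $ i =
        (if pos i < k then poly (map_poly of_real p) (B $$ (pos i, pos i)) else 0)"
      using peval_triangular(2)[of "?e B" i k p] by (auto simp: emb_def simp del: B.unit_peval)
  qed
  also have "\<dots> = (\<Sum>i<k. poly (map_poly of_real p) (B $$ (i, i)))" by (rule sum_corner[OF k])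
  also have "\<dots> = (\<Sum>a\<leftarrow>as. poly (map_poly of_real p) a)"
    using c(1) diag by (auto simp: diag_mat_def interv_sum_list_conv_sum_set_nat lessThan_atLeast0)
  finally show ?thesis .
qed

section \<open>Spectra of leading blocks\<close>

text \<open>As a multiset, so that spectra can be compared without sorting;
  \<open>eigenval_eq_iff\<close> translates back to ordered eigenvalues.\<close>

definition eigs :: "nat \<Rightarrow> 'n::{finite,linorder} cmat \<Rightarrow> real multiset" where
  "eigs k A = image_mset Re (proots (char_poly (leading_submatrix k A)))"

lemma size_eigs: "size (eigs k A) = k"
  using degree_monic_char_poly[OF leading_submatrix_carrier[of k A]]
  by (simp add: eigs_def size_proots_complex)

lemma eigenval_eq_iff: "(\<forall>i\<in>{1..k}. eigenval i k A = eigenval i k B) \<longleftrightarrow> eigs k A = eigs k B"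
  for A B :: "'n::{finite,linorder} cmat"
proof
  let ?l = "\<lambda>A. rev (sorted_list_of_multiset (eigs k A))"
  have len: "length (?l A) = k" for A :: "'n cmat"
    using size_eigs[of k A] by (metis length_rev mset_sorted_list_of_multiset size_mset)
  assume *: "\<forall>i\<in>{1..k}. eigenval i k A = eigenval i k B"
  have "?l A = ?l B"
  proof (rule nth_equalityI)
    fix i assume "i < length (?l A)"
    then have "eigenval (Suc i) k A = eigenval (Suc i) k B" using * len by simp
    then show "?l A ! i = ?l B ! i" by (simp add: eigenval_def eigs_def)
  qed (metis len)
  then show "eigs k A = eigs k B" by (metis mset_rev mset_sorted_list_of_multiset)
qed (simp add: eigenval_def eigs_def)

lemma hermitian_eigenvalue_real:
  assumes A: "hermitian A" and a: "eigenvalue (leading_submatrix k (A :: 'n::{finite,linorder} cmat)) a"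
  shows "a = of_real (Re a)"
proof -
  let ?M = "leading_submatrix k A"
  obtain v where v: "v \<in> carrier_vec k" "v \<noteq> 0\<^sub>v k" "?M *\<^sub>v v = a \<cdot>\<^sub>v v"
    using a unfolding eigenvalue_def eigenvector_def by (auto simp: leading_submatrix_def)
  let ?v = "vec_index v"
  \<comment> \<open>The quadratic form of the block at \<open>v\<close>. It equals a |v|^2 and is
    its own conjugate.\<close>
  let ?S = "\<Sum>i<k. \<Sum>j<k. cnj (?v i) * ?M $$ (i, j) * ?v j"
  have "(\<Sum>j<k. ?M $$ (i, j) * ?v j) = a * ?v i" if "i < k" for i
  proof -
    have "vec_index (?M *\<^sub>v v) i = a * ?v i" using v that by simp
    then show ?thesis using that v(1)
      by (simp add: scalar_prod_def leading_submatrix_def lessThan_atLeast0)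
  qed
  then have "?S = (\<Sum>i<k. cnj (?v i) * (a * ?v i))"
    by (intro sum.cong) (auto simp: sum_distrib_left[symmetric] mult.assoc)
  also have "\<dots> = a * of_real (\<Sum>i<k. (cmod (?v i))\<^sup>2)"
    by (simp add: sum_distrib_left complex_norm_square[symmetric, unfolded of_real_power] mult_ac)
  finally have S: "?S = a * of_real (\<Sum>i<k. (cmod (?v i))\<^sup>2)" .
  have "cnj ?S = (\<Sum>i<k. \<Sum>j<k. cnj (?v j) * ?M $$ (j, i) * ?v i)"
    by (auto simp: leading_submatrix_def hermitian_nth[OF A] intro!: sum.cong)
  also have "\<dots> = ?S" by (rule sum.swap)
  finally have "cnj a * of_real (\<Sum>i<k. (cmod (?v i))\<^sup>2) = a * of_real (\<Sum>i<k. (cmod (?v i))\<^sup>2)"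
    unfolding S by simp
  moreover have "(\<Sum>i<k. (cmod (?v i))\<^sup>2) \<noteq> 0"
    using v(1,2) by (subst sum_nonneg_eq_0_iff) (auto simp: vec_eq_iff intro!: eq_vecI)
  ultimately have "cnj a = a" by (metis mult_right_cancel of_real_eq_0_iff)
  then show ?thesis by (metis complex_is_Real_iff Reals_cnj_iff of_real_Re)
qed

lemma char_poly_hermitian:
  fixes A :: "'n::{finite,linorder} cmat"
  assumes A: "hermitian A"
  obtains xs where "mset xs = eigs k A"
    "char_poly (leading_submatrix k A) = (\<Prod>a\<leftarrow>map complex_of_real xs. [:- a, 1:])"
proof -
  obtain as where as: "char_poly (leading_submatrix k A) = (\<Prod>a\<leftarrow>as. [:- a, 1:])"
    using char_poly_factorized[OF leading_submatrix_carrier] by blast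
  have nz: "(\<Prod>a\<leftarrow>bs. [:- a, 1:]) \<noteq> 0" for bs :: "complex list"
    by (induction bs) (auto simp del: mult_pCons_left)
  have "proots (\<Prod>a\<leftarrow>as. [:- a, 1:]) = mset as" by (induction as) (auto simp: proots_mult[OF _ nz] simp del: mult_pCons_left)
  then have m: "mset (map Re as) = eigs k A" by (simp add: eigs_def as)
  have "complex_of_real (Re a) = a" if "a \<in> set as" for a
  proof -
    have "poly (char_poly (leading_submatrix k A)) a = 0"
      unfolding as using that by (induction as) auto
    then show ?thesis using hermitian_eigenvalue_real[OF A, of k a]
        eigenvalue_root_char_poly[OF leading_submatrix_carrier] by metis
  qed
  then have "map complex_of_real (map Re as) = as" by (simp add: map_idI)
  then show thesis using that[OF m] as by simp
qed

lemma trace_peval_block: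
  fixes A :: "'n::{finite,linorder} cmat"
  assumes "hermitian A" "k \<le> CARD('n)"
  shows "trace (peval (corner k) p (block k A)) = of_real (\<Sum>x\<in>#eigs k A. poly p x)"
proof -
  obtain xs where xs: "mset xs = eigs k A"
    "char_poly (leading_submatrix k A) = (\<Prod>a\<leftarrow>map complex_of_real xs. [:- a, 1:])"
    using char_poly_hermitian[OF assms(1)] by blast
  have "(\<Sum>x\<in>#eigs k A. poly p x) = (\<Sum>x\<leftarrow>xs. poly p x)"
    by (metis xs(1) mset_map sum_mset_sum_list)
  moreover have "(\<Sum>a\<leftarrow>map complex_of_real xs. poly (map_poly of_real p) a) = of_real (\<Sum>x\<leftarrow>xs. poly p x)"
    by (induction xs) simp_all
  ultimately show ?thesis using trace_peval_block_complex[OF assms(2) xs(2)] by simp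
qed

text \<open>Put N = (p - q)(A_k). It is Hermitian, and tr(N N) is the sum of (p - q)(x)^2 over the
  eigenvalues, which is 0; so N = 0. This functional calculus replaces the spectral theorem: each
  identity for spectral projections reduces to an identity of values at the eigenvalues.\<close>

lemma peval_block_eq:
  fixes A :: "'n::{finite,linorder} cmat"
  assumes A: "hermitian A" "k \<le> CARD('n)" and pq: "\<And>x. x \<in># eigs k A \<Longrightarrow> poly p x = poly q x"
  shows "peval (corner k) p (block k A) = peval (corner k) q (block k A)"
proof -
  interpret corner_algebra "corner k" "block k A" by (rule corner_algebra_block)
  let ?r = "p - q"
  let ?N = "peval (corner k) ?r (block k A)"
  have "trace (?N ** ?N) = of_real (\<Sum>x\<in>#eigs k A. poly (?r * ?r) x)"
    using trace_peval_block[OF A] by (simp only: peval_mult[symmetric])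
  also have "(\<Sum>x\<in>#eigs k A. poly (?r * ?r) x) = (\<Sum>x\<in>#eigs k A. 0)"
    using pq by (intro arg_cong[where f=sum_mset] image_mset_cong) simp
  finally have "?N = 0"
    by (intro hermitian_square_trace_0 hermitian_peval hermitian_block A) simp_all
  moreover have "?N = peval (corner k) p (block k A) - peval (corner k) q (block k A)"
    by (metis add_diff_cancel_right' diff_add_cancel peval_add)
  ultimately show ?thesis by simp
qed

section \<open>Spectral projections and bordered matrices\<close>

text \<open>The Lagrange basis polynomial of the node \<open>\<mu>\<close> among the nodes
  \<open>S\<close>.\<close>

definition lag :: "real set \<Rightarrow> real \<Rightarrow> real poly" where
  "lag S \<mu> = (\<Prod>\<nu>\<in>S - {\<mu>}. Polynomial.smult (inverse (\<mu> - \<nu>)) [:- \<nu>, 1:])"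

lemma poly_lag:
  assumes "finite S" "x \<in> S"
  shows "poly (lag S \<mu>) x = (if x = \<mu> then 1 else 0)"
proof (cases "x = \<mu>")
  case True
  have "poly (Polynomial.smult (inverse (\<mu> - \<nu>)) [:- \<nu>, 1:]) \<mu> = 1" if "\<nu> \<noteq> \<mu>" for \<nu>
  proof -
    have "poly [:- \<nu>, 1:] \<mu> = \<mu> - \<nu>" by simp
    then show ?thesis unfolding poly_smult using that by (simp only:) simp
  qed
  then show ?thesis using True by (auto simp: lag_def poly_prod simp del: poly_smult poly_pCons intro!: prod.neutral)
next
  case False
  then show ?thesis using assms by (auto simp: lag_def poly_prod)
qed

text \<open>The nodes \<open>S\<close> are a parameter instead of being read off from
  \<open>B\<close>, so the map is polynomial in \<open>B\<close> and smooth everywhere. It is a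
  spectral projection of a block when \<open>S\<close> is the set of its eigenvalues.\<close>

definition proj :: "nat \<Rightarrow> real set \<Rightarrow> real \<Rightarrow> 'n::{finite,linorder} cmat \<Rightarrow> 'n cmat" where
  "proj k S \<mu> B = peval (corner k) (lag S \<mu>) B"

locale spectral_block =
  fixes k :: nat and A :: "'n::{finite,linorder} cmat" and S :: "real set"
  assumes herm: "hermitian A" and k: "k \<le> CARD('n)" and S: "S = set_mset (eigs k A)"
begin

sublocale corner_algebra "corner k" "block k A" by (rule corner_algebra_block)

abbreviation P :: "real \<Rightarrow> 'n cmat" where "P \<mu> \<equiv> proj k S \<mu> (block k A)"

lemma finite_S: "finite S" by (simp add: S)

lemma peval_eqI: "(\<And>x. x \<in> S \<Longrightarrow> poly p x = poly q x) \<Longrightarrow>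
    peval (corner k) p (block k A) = peval (corner k) q (block k A)"
  using peval_block_eq[OF herm k] S by blast

lemma peval_proj: "\<mu> \<in> S \<Longrightarrow> peval (corner k) p (block k A) ** P \<mu> = poly p \<mu> *\<^sub>R P \<mu>"
  unfolding proj_def peval_mult[symmetric] peval_smult[symmetric]
  by (rule peval_eqI) (simp add: poly_lag finite_S)

lemma proj_peval: "\<mu> \<in> S \<Longrightarrow> P \<mu> ** peval (corner k) p (block k A) = poly p \<mu> *\<^sub>R P \<mu>"
  unfolding proj_def peval_mult[symmetric] peval_smult[symmetric]
  by (rule peval_eqI) (simp add: poly_lag finite_S)

lemma proj_mult: "\<mu> \<in> S \<Longrightarrow> \<nu> \<in> S \<Longrightarrow> P \<mu> ** P \<nu> = (if \<mu> = \<nu> then P \<mu> else 0)"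
  using peval_proj[of \<nu> "lag S \<mu>"] by (auto simp: proj_def[symmetric] poly_lag finite_S)

lemma block_proj: "\<mu> \<in> S \<Longrightarrow> block k A ** P \<mu> = \<mu> *\<^sub>R P \<mu>"
  using peval_proj[of \<mu> "[:0, 1:]"] by (simp add: MU)

lemma proj_block: "\<mu> \<in> S \<Longrightarrow> P \<mu> ** block k A = \<mu> *\<^sub>R P \<mu>"
  using proj_peval[of \<mu> "[:0, 1:]"] by (simp add: MU)

lemma corner_proj [simp]: "corner k ** P \<mu> = P \<mu>" and proj_corner [simp]: "P \<mu> ** corner k = P \<mu>"
  by (simp_all add: proj_def)

lemma hermitian_proj: "hermitian (P \<mu>)"
  unfolding proj_def by (intro hermitian_peval hermitian_corner hermitian_block herm)

lemma sum_proj: "(\<Sum>\<mu>\<in>S. P \<mu>) = corner k"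
proof -
  have "(\<Sum>\<mu>\<in>S. P \<mu>) = peval (corner k) (\<Sum>\<mu>\<in>S. lag S \<mu>) (block k A)"
    by (simp add: proj_def peval_sum)
  also have "\<dots> = peval (corner k) [:1:] (block k A)"
    by (rule peval_eqI) (simp add: poly_sum poly_lag finite_S)
  finally show ?thesis by simp
qed

lemma trace_proj: "trace (P \<mu>) = of_nat (count (eigs k A) \<mu>)" if "\<mu> \<in> S"
proof -
  have "(\<Sum>x\<in>#eigs k A. poly (lag S \<mu>) x) = (\<Sum>x\<in>#eigs k A. if x = \<mu> then 1 else 0)"
    using S by (intro arg_cong[where f=sum_mset] image_mset_cong) (simp add: poly_lag finite_S)
  also have "\<dots> = real (count (eigs k A) \<mu>)"
    by (simp add: sum_mset_delta)
  finally show ?thesis unfolding proj_def trace_peval_block[OF herm k] by simp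
qed

end

section \<open>Hermitian inner product and characteristic polynomials of bordered matrices\<close>

definition hinner :: "complex^'n::finite \<Rightarrow> complex^'n \<Rightarrow> complex" where
  "hinner u v = (\<Sum>i\<in>UNIV. cnj (u $ i) * v $ i)"

lemma hinner_adjoint: "hinner u (A *v v) = hinner (conj_transpose A *v u) v"
  by (simp add: hinner_def matrix_vector_mult_def sum_distrib_left sum_distrib_right mult_ac)
    (rule sum.swap)

lemma hinner_self: "hinner u u = of_real ((norm u)\<^sup>2)"
  by (simp add: hinner_def norm_vec_def L2_set_def sum_nonneg complex_norm_square[unfolded of_real_power] mult.commute)

lemma Re_hinner: "Re (hinner u v) = u \<bullet> v"
  by (simp add: hinner_def inner_vec_def inner_complex_def)

lemma hinner_add_right: "hinner u (v + w) = hinner u v + hinner u w"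
  and hinner_scaleR_right: "hinner u (r *\<^sub>R v) = r *\<^sub>R hinner u v"
  and hinner_zero_right [simp]: "hinner u 0 = 0"
  by (simp_all add: hinner_def distrib_left sum.distrib scaleR_sum_right)

lemma hinner_sum_right: "hinner u (\<Sum>i\<in>I. f i) = (\<Sum>i\<in>I. hinner u (f i))"
  by (induction I rule: infinite_finite_induct) (simp_all add: hinner_add_right)

lemma hinner_projection:
  assumes "hermitian P" "P ** P = P" shows "hinner u (P *v u) = of_real ((norm (P *v u))\<^sup>2)"
proof -
  have "hinner u (P *v u) = hinner u (P *v (P *v u))" using assms(2) by (simp add: cvec_assoc)
  also have "\<dots> = hinner (P *v u) (P *v u)"
    using assms(1) by (subst hinner_adjoint) (simp add: hermitian_def)
  finally show ?thesis by (simp add: hinner_self)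
qed

text \<open>Adding the multiples \<open>y i\<close> of the first \<open>k\<close> columns of \<open>x - a\<close> to the last one clears it above the
  diagonal: this is the Schur complement without an inverse matrix.\<close>

lemma char_poly_bordered:
  fixes a :: "nat \<Rightarrow> nat \<Rightarrow> complex"
  assumes y: "\<And>i. i < k \<Longrightarrow> x * y i - (\<Sum>j<k. a i j * y j) = a i k"
  shows "poly (char_poly (Matrix.mat (Suc k) (Suc k) (\<lambda>(i, j). a i j))) x
    = poly (char_poly (Matrix.mat k k (\<lambda>(i, j). a i j))) x * (x - a k k - (\<Sum>j<k. a k j * y j))"
proof -
  let ?X = "\<lambda>m. Matrix.mat m m (\<lambda>(i, j). (if i = j then x else 0) - a i j)"
  let ?U = "Matrix.mat (Suc k) (Suc k) (\<lambda>(i, j). if i = j then 1 else if j = k then y i else 0)"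
  let ?d = "x - a k k - (\<Sum>j<k. a k j * y j)"
  let ?R = "four_block_mat (?X k) (0\<^sub>m k 1) (Matrix.mat 1 k (\<lambda>(i, j). - a k j)) (Matrix.mat 1 1 (\<lambda>_. ?d))"
  have X: "poly (char_poly (Matrix.mat m m (\<lambda>(i, j). a i j))) x = Determinant.det (?X m)" for m
    by (subst char_poly_matrix[of _ m])
      (auto simp: char_matrix_def intro!: arg_cong[where f=Determinant.det] eq_matI)
  have XU: "?X (Suc k) * ?U = ?R"
  proof (rule eq_matI)
    fix i j assume "i < dim_row ?R" "j < dim_col ?R"
    then have i: "i < Suc k" and j: "j < Suc k" by auto
    let ?x = "\<lambda>i l. (if i = l then x else 0) - a i l"
    have "(?X (Suc k) * ?U) $$ (i, j) = (\<Sum>l<Suc k. ?x i l * (if l = j then 1 else if j = k then y l else 0))"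
      using i j by (simp add: scalar_prod_def lessThan_atLeast0)
    also have "\<dots> = ?R $$ (i, j)"
    proof (cases "j < k")
      case True
      then have "(\<Sum>l<Suc k. ?x i l * (if l = j then 1 else if j = k then y l else 0))
          = (\<Sum>l<Suc k. if l = j then ?x i j else 0)"
        by (intro sum.cong) auto
      then show ?thesis using True i by (auto simp: less_Suc_eq)
    next
      case False
      then have jk: "j = k" using j by simp
      have "(\<Sum>l<k. ?x i l * y l) = (\<Sum>l<k. if l = i then x * y i else 0) - (\<Sum>l<k. a i l * y l)"
        unfolding sum_subtractf[symmetric] by (intro sum.cong) (auto simp: algebra_simps)
      moreover have "(\<Sum>l<k. ?x i l * (if l = k then 1 else y l)) = (\<Sum>l<k. ?x i l * y l)"
        by (intro sum.cong) auto
      ultimately have e: "(\<Sum>l<Suc k. ?x i l * (if l = j then 1 else if j = k then y l else 0))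
          = (if i < k then x * y i else 0) - (\<Sum>l<k. a i l * y l) + ?x i k"
        unfolding jk by simp
      show ?thesis unfolding e using jk i y[of i] by (cases "i < k") (auto simp: less_Suc_eq algebra_simps)
    qed
    finally show "(?X (Suc k) * ?U) $$ (i, j) = ?R $$ (i, j)" .
  qed auto
  have "Determinant.det ?U = 1"
    by (subst det_upper_triangular[of _ "Suc k"])
      (auto simp: upper_triangular_def diag_mat_def intro!: prod_list_neutral)
  then have "Determinant.det (?X (Suc k)) = Determinant.det (?X (Suc k) * ?U)"
    by (subst det_mult[of _ "Suc k"]) auto
  also have "\<dots> = Determinant.det (?X k) * Determinant.det (Matrix.mat 1 1 (\<lambda>_. ?d))"
    unfolding XU by (rule det_four_block_mat_upper_right_zero_col) auto
  also have "Determinant.det (Matrix.mat 1 1 (\<lambda>_. ?d)) = ?d"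
    by (subst det_single) auto
  finally show ?thesis by (simp add: X)
qed

definition edge :: "nat \<Rightarrow> 'n::{finite,linorder} cmat \<Rightarrow> complex^'n::{finite,linorder}" where
  "edge k A = (\<chi> i. if pos i < k then A $ i $ nth_index k else 0)"

lemma (in spectral_block) char_poly_Suc:
  assumes kn: "k < CARD('n)" and x: "x \<notin> S"
  shows "poly (char_poly (leading_submatrix (Suc k) A)) (of_real x)
    = poly (char_poly (leading_submatrix k A)) (of_real x) *
      (of_real x - A $ nth_index k $ nth_index k - of_real (\<Sum>\<mu>\<in>S. (norm (P \<mu> *v edge k A))\<^sup>2 / (x - \<mu>)))"
proof -
  let ?a = "\<lambda>i j. A $ nth_index i $ nth_index j" and ?b = "edge k A"
  \<comment> \<open>The resolvent of the block at \<open>x\<close>, applied to the border column and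
    written by spectral projections. It solves the linear system that
    \<open>char_poly_bordered\<close> asks for.\<close>
  define y where "y = (\<Sum>\<mu>\<in>S. inverse (x - \<mu>) *\<^sub>R (P \<mu> *v ?b))"
  have Ey: "corner k *v y = y"
    by (simp add: y_def cvec_sum_right cvec_scaleR_right cvec_assoc)
  have "x *\<^sub>R y - block k A *v y = (\<Sum>\<mu>\<in>S. (inverse (x - \<mu>) * (x - \<mu>)) *\<^sub>R (P \<mu> *v ?b))"
    by (simp add: y_def cvec_sum_right cvec_scaleR_right cvec_assoc block_proj cvec_scaleR_left
        scaleR_sum_right sum_subtractf[symmetric] algebra_simps cong: sum.cong)
  also have "\<dots> = (\<Sum>\<mu>\<in>S. P \<mu> *v ?b)" using x by (intro sum.cong refl, subst left_inverse) auto
  also have "\<dots> = corner k *v ?b" by (simp add: cvec_sum_left[symmetric] sum_proj)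
  also have "\<dots> = ?b" by (simp add: Finite_Cartesian_Product.vec_eq_iff edge_def)
  finally have eq: "x *\<^sub>R y - block k A *v y = ?b" .
  have nth: "pos (nth_index i :: 'n) = i" if "i \<le> k" for i using that kn by simp
  have y0: "y $ j = 0" if "\<not> pos j < k" for j using Ey that by (metis corner_vec_nth)
  have "of_real x * y $ nth_index i - (\<Sum>j<k. ?a i j * y $ nth_index j) = ?a i k" if i: "i < k" for i
  proof -
    have "(\<Sum>j\<in>UNIV. block k A $ nth_index i $ j * y $ j)
        = (\<Sum>j\<in>(UNIV::'n set). if pos j < k then ?a i (pos j) * y $ nth_index (pos j) else 0)"
      using i nth[of i] by (intro sum.cong) auto
    also have "\<dots> = (\<Sum>j<k. ?a i j * y $ nth_index j)" by (rule sum_corner[OF k])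
    finally have "(block k A *v y) $ nth_index i = (\<Sum>j<k. ?a i j * y $ nth_index j)"
      by (simp add: matrix_vector_mult_def)
    then show ?thesis using arg_cong[OF eq, of "\<lambda>v. v $ nth_index i"] i nth[of i]
      by (simp add: edge_def scaleR_conv_of_real[where 'a=complex])
  qed
  note border = char_poly_bordered[of k "of_real x" "\<lambda>i. y $ nth_index i" ?a, OF this]
  have "(\<Sum>j<k. ?a k j * y $ nth_index j)
      = (\<Sum>j\<in>(UNIV::'n set). if pos j < k then ?a k (pos j) * y $ nth_index (pos j) else 0)"
    by (rule sum_corner[OF k, symmetric])
  \<comment> \<open>The border row is the conjugate of the border column, so the Schur complement
    term is the pairing of the column with its resolvent, and orthogonality of the projections
    leaves squared norms.\<close>
  also have "\<dots> = hinner ?b y"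
    unfolding hinner_def by (intro sum.cong) (auto simp: edge_def hermitian_nth[OF herm])
  also have "\<dots> = of_real (\<Sum>\<mu>\<in>S. (norm (P \<mu> *v ?b))\<^sup>2 / (x - \<mu>))"
    unfolding y_def hinner_sum_right hinner_scaleR_right of_real_sum
    by (intro sum.cong refl)
      (simp add: hinner_projection[OF hermitian_proj] proj_mult divide_inverse scaleR_conv_of_real mult.commute)
  finally show ?thesis using border by (simp add: leading_submatrix_def)
qed

text \<open>Clearing denominators gives a polynomial with infinitely many zeros, hence 0. At a node
  \<open>\<mu>\<close> it takes the value \<open>r \<mu>\<close> times a nonzero product.\<close>

lemma partial_fractions_unique:
  fixes r :: "real \<Rightarrow> real"
  assumes S: "finite S" and eq: "\<And>x. x \<notin> S \<Longrightarrow> c + (\<Sum>\<mu>\<in>S. r \<mu> / (x - \<mu>)) = 0"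
  shows "c = 0" "\<forall>\<mu>\<in>S. r \<mu> = 0"
proof -
  define q where "q = [:c:] * (\<Prod>\<nu>\<in>S. [:- \<nu>, 1:])
    + (\<Sum>\<mu>\<in>S. Polynomial.smult (r \<mu>) (\<Prod>\<nu>\<in>S - {\<mu>}. [:- \<nu>, 1:]))"
  have "poly q x = 0" if x: "x \<notin> S" for x
  proof -
    have "(\<Prod>\<nu>\<in>S. x - \<nu>) * r \<mu> / (x - \<mu>) = r \<mu> * (\<Prod>\<nu>\<in>S - {\<mu>}. x - \<nu>)" if "\<mu> \<in> S" for \<mu>
    proof -
      have "x - \<mu> \<noteq> 0" using x that by auto
      then show ?thesis unfolding prod.remove[OF S that, of "\<lambda>\<nu>. x - \<nu>"] by (simp add: mult.assoc)
    qed
    then have "poly q x = (\<Prod>\<nu>\<in>S. x - \<nu>) * (c + (\<Sum>\<mu>\<in>S. r \<mu> / (x - \<mu>)))"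
      by (simp add: q_def poly_prod poly_sum distrib_left sum_distrib_left mult.commute)
    then show ?thesis using eq[OF x] by simp
  qed
  then have "- S \<subseteq> {x. poly q x = 0}" by auto
  moreover have "infinite (- S)" using S by (simp add: infinite_UNIV_char_0 Compl_eq_Diff_UNIV Diff_infinite_finite)
  ultimately have q0: "q = 0" using poly_roots_finite finite_subset by blast
  show r: "\<forall>\<mu>\<in>S. r \<mu> = 0"
  proof
    fix \<mu> assume m: "\<mu> \<in> S"
    have "(\<Prod>\<nu>\<in>S. \<mu> - \<nu>) = 0" using S m by auto
    moreover have "(\<Prod>\<tau>\<in>S - {\<nu>}. \<mu> - \<tau>) = 0" if "\<nu> \<noteq> \<mu>" for \<nu> using S m that by auto
    ultimately have "poly q \<mu> = (\<Sum>\<nu>\<in>S. if \<nu> = \<mu> then r \<mu> * (\<Prod>\<nu>\<in>S - {\<mu>}. \<mu> - \<nu>) else 0)"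
      by (auto simp: q_def poly_prod poly_sum intro!: sum.cong)
    then show "r \<mu> = 0" using q0 S m by auto
  qed
  obtain x where "x \<notin> S" using S ex_new_if_finite infinite_UNIV_char_0 by blast
  then show "c = 0" using eq[of x] r by simp
qed

text \<open>Away from the eigenvalues the common characteristic polynomial of the
  \<open>k\<close>-blocks can be cancelled in \<open>char_poly_Suc\<close>. What remains are two
  partial fraction expansions with equal poles, compared by uniqueness. Conversely, equal data make
  the next characteristic polynomials agree at infinitely many points.\<close>

lemma eigs_Suc_eq_iff:
  fixes A B :: "'n::{finite,linorder} cmat"
  assumes h: "hermitian A" "hermitian B" and k: "k < CARD('n)"
    and eq: "eigs k A = eigs k B" and S: "S = set_mset (eigs k A)"
  shows "eigs (Suc k) A = eigs (Suc k) B \<longleftrightarrow>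
    A $ nth_index k $ nth_index k = B $ nth_index k $ nth_index k \<and>
    (\<forall>\<mu>\<in>S. norm (proj k S \<mu> (block k A) *v edge k A) = norm (proj k S \<mu> (block k B) *v edge k B))"
proof -
  let ?\<chi> = "\<lambda>k A. char_poly (leading_submatrix k (A :: 'n cmat))"
  have L: "(\<Prod>a\<leftarrow>map complex_of_real zs. [:- a, 1:]) = (\<Prod>a\<in>#mset zs. [:- complex_of_real a, 1:])" for zs
    by (induction zs) (auto simp del: mult_pCons_left)
  have char_eq: "eigs m A = eigs m B \<longleftrightarrow> ?\<chi> m A = ?\<chi> m B" for m
  proof
    assume e: "eigs m A = eigs m B"
    obtain xs ys where xy: "mset xs = eigs m A" "?\<chi> m A = (\<Prod>a\<leftarrow>map complex_of_real xs. [:- a, 1:])"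
      "mset ys = eigs m B" "?\<chi> m B = (\<Prod>a\<leftarrow>map complex_of_real ys. [:- a, 1:])"
      using char_poly_hermitian[OF h(1)] char_poly_hermitian[OF h(2)] by metis
    show "?\<chi> m A = ?\<chi> m B" unfolding xy(2,4) L xy(1,3) e ..
  qed (simp add: eigs_def)
  interpret A: spectral_block k A S using h k S by unfold_locales auto
  interpret B: spectral_block k B S using h k S eq by unfold_locales auto
  let ?c = "\<lambda>A :: 'n cmat. A $ nth_index k $ nth_index k"
  let ?r = "\<lambda>\<mu> A. (norm (proj k S \<mu> (block k A) *v edge k A))\<^sup>2"
  have \<chi>: "?\<chi> k A = ?\<chi> k B" using char_eq eq by blast
  have nz: "poly (?\<chi> k A) (of_real x) \<noteq> 0" if "x \<notin> S" for x
  proof -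
    obtain xs where xs: "mset xs = eigs k A" "?\<chi> k A = (\<Prod>a\<leftarrow>map complex_of_real xs. [:- a, 1:])"
      using char_poly_hermitian[OF h(1)] by blast
    have "x \<notin> set xs" using that S xs(1) by (metis set_mset_mset)
    then show ?thesis unfolding xs(2) by (induction xs) auto
  qed
  have real: "?c C = of_real (Re (?c C))" if "hermitian C" for C :: "'n cmat"
    using hermitian_nth[OF that, of "nth_index k" "nth_index k"]
    by (metis Reals_cnj_iff of_real_Re)
  show ?thesis
  proof
    assume "eigs (Suc k) A = eigs (Suc k) B"
    then have e: "?\<chi> (Suc k) A = ?\<chi> (Suc k) B" using char_eq by blast
    have "(Re (?c A) - Re (?c B)) + (\<Sum>\<mu>\<in>S. (?r \<mu> A - ?r \<mu> B) / (x - \<mu>)) = 0" if "x \<notin> S" for x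
    proof -
      have "of_real x - ?c A - of_real (\<Sum>\<mu>\<in>S. ?r \<mu> A / (x - \<mu>))
          = of_real x - ?c B - of_real (\<Sum>\<mu>\<in>S. ?r \<mu> B / (x - \<mu>))"
        using A.char_poly_Suc[OF k that] B.char_poly_Suc[OF k that] e \<chi> nz[OF that] by simp
      from arg_cong[OF this, of Re] show ?thesis
        by (simp add: diff_divide_distrib sum_subtractf)
    qed
    from partial_fractions_unique[OF A.finite_S this]
    show "?c A = ?c B \<and> (\<forall>\<mu>\<in>S. norm (proj k S \<mu> (block k A) *v edge k A) = norm (proj k S \<mu> (block k B) *v edge k B))"
      using real[OF h(1)] real[OF h(2)] by (auto simp: power2_eq_iff_nonneg)
  next
    assume *: "?c A = ?c B \<and> (\<forall>\<mu>\<in>S. norm (proj k S \<mu> (block k A) *v edge k A) = norm (proj k S \<mu> (block k B) *v edge k B))"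
    have "poly (?\<chi> (Suc k) A - ?\<chi> (Suc k) B) (of_real x) = 0" if "x \<notin> S" for x
      using A.char_poly_Suc[OF k that] B.char_poly_Suc[OF k that] * \<chi> by simp
    then have "complex_of_real ` (- S) \<subseteq> {x. poly (?\<chi> (Suc k) A - ?\<chi> (Suc k) B) x = 0}" by auto
    moreover have "infinite (complex_of_real ` (- S))"
      using A.finite_S by (subst finite_image_iff)
        (auto simp: inj_on_def infinite_UNIV_char_0 Compl_eq_Diff_UNIV Diff_infinite_finite)
    ultimately have "?\<chi> (Suc k) A - ?\<chi> (Suc k) B = 0" using poly_roots_finite finite_subset by blast
    then show "eigs (Suc k) A = eigs (Suc k) B" using char_eq by simp
  qed
qed

type_synonym 'n cvec = "complex^'n"

section \<open>The fiber as a smooth retract\<close>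

text \<open>The derivative is 1/|w| times the orthogonal projection that kills the direction of
  \<open>w\<close>. This lost direction is the -1 in the dimension 2m - 1 of a sphere.\<close>

lemma has_derivative_normalize:
  fixes w :: "'a::real_inner"
  assumes "w \<noteq> 0"
  shows "((\<lambda>w. inverse (norm w) *\<^sub>R w) has_derivative
    (\<lambda>v. inverse (norm w) *\<^sub>R v - ((w \<bullet> v) * inverse (norm w) ^ 3) *\<^sub>R w)) (at w)"
proof -
  let ?h = "\<lambda>x. inverse (sqrt x)"
  have pos: "0 < w \<bullet> w" using assms by simp
  have "(?h has_real_derivative - (?h (w \<bullet> w) * (?h (w \<bullet> w) / 2) * ?h (w \<bullet> w))) (at (w \<bullet> w))"
    by (rule DERIV_inverse') (use pos DERIV_real_sqrt in auto)
  then have h: "(?h has_derivative (\<lambda>v. - (?h (w \<bullet> w) * (?h (w \<bullet> w) / 2) * ?h (w \<bullet> w)) * v)) (at (w \<bullet> w))"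
    unfolding has_field_derivative_def .
  have eq: "(\<lambda>w. inverse (norm w) *\<^sub>R w) = (\<lambda>w :: 'a. inverse (sqrt (w \<bullet> w)) *\<^sub>R w)"
    by (simp add: norm_eq_sqrt_inner)
  have "((\<lambda>w. w \<bullet> w) has_derivative (\<lambda>v. w \<bullet> v + v \<bullet> w)) (at w)"
    by (intro has_derivative_inner has_derivative_ident)
  from has_derivative_scaleR[OF has_derivative_compose[OF this h] has_derivative_ident]
  show ?thesis
    unfolding eq by (rule has_derivative_eq_rhs)
      (auto simp: norm_eq_sqrt_inner inner_commute power3_eq_cube fun_eq_iff algebra_simps)
qed

text \<open>Evaluates a derivative on one direction from the restriction to a line. For the
  retraction only a few directions matter, and there the restriction is explicit.\<close>

lemma has_derivative_line:
  assumes f: "(f has_derivative D) (at p)" and eq: "\<And>t. f (p + t *\<^sub>R X) = g t"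
    and g: "(g has_vector_derivative w) (at 0)"
  shows "D X = w"
proof -
  have "((\<lambda>t. p + t *\<^sub>R X) has_derivative (\<lambda>t. 0 + t *\<^sub>R X)) (at 0)"
    by (intro has_derivative_add has_derivative_const bounded_linear_imp_has_derivative bounded_linear_scaleR_left)
  from has_derivative_compose[OF this, of f D] f
  have "(g has_derivative (\<lambda>t. D (t *\<^sub>R X))) (at 0)" by (simp add: eq)
  moreover have "(g has_derivative (\<lambda>t. t *\<^sub>R w)) (at 0)"
    using g by (simp add: has_vector_derivative_def)
  ultimately have "(\<lambda>t. D (t *\<^sub>R X)) = (\<lambda>t. t *\<^sub>R w)" by (rule has_derivative_unique)
  from fun_cong[OF this, of 1] show ?thesis by simp
qed

section \<open>Real traces and the border of a block\<close>

lemma sum_Basis_vec: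
  fixes f :: "'a::euclidean_space^'n::finite \<Rightarrow> 'c::comm_monoid_add"
  shows "(\<Sum>b\<in>Basis. f b) = (\<Sum>i\<in>UNIV. \<Sum>u\<in>Basis. f (axis i u))"
proof -
  have "(Basis :: ('a^'n) set) = (\<lambda>(i, u). axis i u) ` (UNIV \<times> Basis)"
    by (auto simp: Basis_vec_def)
  moreover have inj: "inj_on (\<lambda>(i, u). axis i u :: 'a^'n) (UNIV \<times> Basis)"
    by (auto simp: inj_on_def axis_eq_axis nonzero_Basis)
  ultimately have "(\<Sum>b\<in>Basis. f b) = (\<Sum>(i, u)\<in>UNIV \<times> Basis. f (axis i u))"
    using sum.reindex[OF inj, of f] by (simp add: comp_def case_prod_unfold)
  then show ?thesis by (simp add: sum.cartesian_product)
qed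

lemma sum_Basis_cmat:
  fixes f :: "'n::finite cmat \<Rightarrow> 'c::comm_monoid_add"
  shows "(\<Sum>b\<in>Basis. f b) = (\<Sum>i\<in>UNIV. \<Sum>j\<in>UNIV. \<Sum>u\<in>Basis. f (axis i (axis j u)))"
  by (simp add: sum_Basis_vec)

lemma inner_axis_cmat: "(A :: 'n::finite cmat) \<bullet> axis i (axis j u) = A $ i $ j \<bullet> u"
  by (simp add: inner_axis)

lemma axis_axis_nth: "axis i (axis j u) $ a $ b = (if a = i \<and> b = j then u else 0)"
  by (simp add: axis_def)

text \<open>Each complex coordinate counts for the two real basis vectors 1 and i, which gives the
  factor 2.\<close>

lemma trace_left_mult: "(\<Sum>v\<in>Basis. ((P :: 'n::finite cmat) *v v) \<bullet> v) = 2 * Re (trace P)"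
proof -
  have "(P *v axis i u) $ i = P $ i $ i * u" for i u
  proof -
    have "(P *v axis i u) $ i = (\<Sum>j\<in>UNIV. if j = i then P $ i $ i * u else 0)"
      unfolding matrix_vector_mult_def vec_lambda_beta by (intro sum.cong) (auto simp: axis_def)
    then show ?thesis by simp
  qed
  then show ?thesis
    by (simp add: sum_Basis_vec inner_axis Basis_complex_def inner_complex_def trace_def sum_distrib_left)
qed

text \<open>The Hermitian border that extends a \<open>k\<close>-block, without its diagonal entry.
  Because of the conjugate it is only real-linear in the column.\<close>

definition colrow :: "nat \<Rightarrow> 'n::{finite,linorder} cvec \<Rightarrow> 'n cmat" where
  "colrow k b = (\<chi> i j. if pos i < k \<and> pos j = k then b $ i else if pos i = k \<and> pos j < k then cnj (b $ j) else 0)"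

definition diag_entry :: "nat \<Rightarrow> complex \<Rightarrow> 'n::{finite,linorder} cmat" where
  "diag_entry k c = (\<chi> i j. if pos i = k \<and> pos j = k then c else 0)"

lemma bounded_linear_colrow: "bounded_linear (colrow k :: 'n::{finite,linorder} cvec \<Rightarrow> 'n cmat)"
  by (intro linear_conv_bounded_linear[THEN iffD1] linearI) (auto intro!: cmat_eqI simp: colrow_def)

lemma bounded_linear_edge: "bounded_linear (edge k :: 'n::{finite,linorder} cmat \<Rightarrow> 'n cvec)"
  by (intro linear_conv_bounded_linear[THEN iffD1] linearI)
    (auto simp: edge_def Finite_Cartesian_Product.vec_eq_iff)

lemma edge_nth: "edge k A $ i = (if pos i < k then A $ i $ nth_index k else 0)"
  by (simp add: edge_def)

lemma corner_edge [simp]: "corner k *v edge k A = edge k A"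
  by (simp add: edge_def Finite_Cartesian_Product.vec_eq_iff)

lemma block_Suc:
  fixes A :: "'n::{finite,linorder} cmat"
  assumes "hermitian A" "k < CARD('n)"
  shows "block (Suc k) A = block k A + colrow k (edge k A) + diag_entry k (A $ nth_index k $ nth_index k)"
proof (rule cmat_eqI)
  fix i j :: 'n
  have nth: "nth_index k = l" if "pos l = k" for l :: 'n using that by auto
  show "block (Suc k) A $ i $ j = (block k A + colrow k (edge k A)
      + diag_entry k (A $ nth_index k $ nth_index k)) $ i $ j"
    by (cases "pos i" k rule: linorder_cases; cases "pos j" k rule: linorder_cases)
      (auto simp: colrow_def diag_entry_def edge_nth hermitian_nth[OF assms(1)] nth)
qed

lemma leading_submatrix_block: "l \<le> k \<Longrightarrow> k \<le> CARD('n) \<Longrightarrow>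
    leading_submatrix l (block k A) = leading_submatrix l (A :: 'n::{finite,linorder} cmat)"
  by (auto simp: leading_submatrix_def intro!: eq_matI)

lemma eigs_block: "l \<le> k \<Longrightarrow> k \<le> CARD('n) \<Longrightarrow> eigs l (block k A) = eigs l (A :: 'n::{finite,linorder} cmat)"
  by (simp add: eigs_def leading_submatrix_block)

lemma edge_block: "k < l \<Longrightarrow> k < CARD('n) \<Longrightarrow> edge k (block l A) = edge k (A :: 'n::{finite,linorder} cmat)"
  by (simp add: edge_def Finite_Cartesian_Product.vec_eq_iff)

lemma smooth_on_peval:
  assumes "open U" "smooth_on f U" shows "smooth_on (\<lambda>x. peval E p (f x)) U"
proof (induction p)
  case 0
  show ?case using assms(1) by (simp add: smooth_on_const)
next
  case (pCons a p)
  show ?case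
    unfolding peval_pCons
    by (intro smooth_on_add smooth_on_bilinear[OF bounded_bilinear_cmat_mult] smooth_on_const assms pCons)
qed

text \<open>\<open>R\<close> is a point of the fiber under study. Spectra, norms and diagonal
  entries are read off from it, so the prescribed data are consistent by construction.\<close>

locale gc_reference =
  fixes R :: "'n::{finite,linorder} cmat"
  assumes herm_R: "hermitian R"
begin

definition spec :: "nat \<Rightarrow> real set" where "spec k = set_mset (eigs k R)"

definition radius :: "nat \<Rightarrow> real \<Rightarrow> real" where
  "radius k \<mu> = norm (proj k (spec k) \<mu> (block k R) *v edge k R)"

text \<open>The eigenvalues whose component of the border column ranges over a sphere of positive
  radius. The other components are forced to be 0 and cannot be normalized.\<close>

definition active :: "nat \<Rightarrow> real set" where "active k = {\<mu> \<in> spec k. radius k \<mu> \<noteq> 0}"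

text \<open>At the full size this is the fiber through \<open>R\<close>: the levels below
  \<open>CARD('n)\<close> are the Gelfand--Cetlin values, and the top level is the orbit
  condition.\<close>

definition level_set :: "nat \<Rightarrow> 'n cmat set" where
  "level_set k = {B. hermitian B \<and> (\<forall>l\<le>k. eigs l B = eigs l R)}"

definition fit_edge :: "nat \<Rightarrow> 'n cmat \<Rightarrow> 'n cvec \<Rightarrow> 'n cvec" where
  "fit_edge k B b = (\<Sum>\<mu>\<in>active k. radius k \<mu> *\<^sub>R
     (inverse (norm (proj k (spec k) \<mu> B *v b)) *\<^sub>R (proj k (spec k) \<mu> B *v b)))"

text \<open>The column added in step \<open>k\<close> is projected to the eigenspaces of the block already
  retracted, and each component is rescaled to the norm prescribed by the spectrum of the next block.\<close>

primrec retr :: "nat \<Rightarrow> 'n cmat \<Rightarrow> 'n cmat" where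
  "retr 0 A = 0"
| "retr (Suc k) A = retr k A + colrow k (fit_edge k (retr k A) (edge k A))
     + diag_entry k (R $ nth_index k $ nth_index k)"

primrec retr_dom :: "nat \<Rightarrow> 'n cmat set" where
  "retr_dom 0 = UNIV"
| "retr_dom (Suc k) = {A \<in> retr_dom k. \<forall>\<mu>\<in>active k. proj k (spec k) \<mu> (retr k A) *v edge k A \<noteq> 0}"

section \<open>Smoothness, image and fixed points of the retraction\<close>

lemma finite_spec: "finite (spec k)" and finite_active: "finite (active k)"
  by (simp_all add: spec_def active_def)

lemma smooth_retr: "open (retr_dom k) \<and> smooth_on (retr k) (retr_dom k)"
proof (induction k)
  case 0
  have "retr 0 = (\<lambda>A. 0)" by (simp add: fun_eq_iff)
  then show ?case by (simp add: smooth_on_const)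
next
  case (Suc k)
  let ?W = "retr_dom k"
  let ?w = "\<lambda>\<mu> A. proj k (spec k) \<mu> (retr k A) *v edge k A"
  have op: "open ?W" and sm: "smooth_on (retr k) ?W" using Suc by auto
  have w: "smooth_on (?w \<mu>) ?W" for \<mu>
    unfolding proj_def
    by (rule smooth_on_bilinear[OF bounded_bilinear_cmat_vec op smooth_on_peval[OF op sm]
        smooth_on_linear[OF op bounded_linear_edge]])
  have "open {A \<in> ?W. ?w \<mu> A \<noteq> 0}" for \<mu>
  proof -
    have "{A \<in> ?W. ?w \<mu> A \<noteq> 0} = ?W \<inter> ?w \<mu> -` (- {0})" by auto
    moreover have "open (?W \<inter> ?w \<mu> -` (- {0}))"
      by (rule continuous_open_preimage[OF smooth_on_imp_continuous_on[OF w] op]) (simp add: open_Compl)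
    ultimately show ?thesis by (simp only:)
  qed
  moreover have "retr_dom (Suc k) = ?W \<inter> (\<Inter>\<mu>\<in>active k. {A \<in> ?W. ?w \<mu> A \<noteq> 0})" by auto
  ultimately have op': "open (retr_dom (Suc k))" 
    using open_Int[OF op open_INT[OF finite_active, of k]] by (metis (no_types, lifting))
  have sub: "retr_dom (Suc k) \<subseteq> ?W" by auto
  have w': "smooth_on (?w \<mu>) (retr_dom (Suc k))" for \<mu> by (rule smooth_on_subset[OF w sub])
  have "smooth_on (\<lambda>A. fit_edge k (retr k A) (edge k A)) (retr_dom (Suc k))"
    unfolding fit_edge_def
  proof (rule smooth_on_sum[OF op'])
    fix \<mu> assume m: "\<mu> \<in> active k"
    have 1: "smooth_on (\<lambda>A. inverse (norm (?w \<mu> A))) (retr_dom (Suc k))"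
      by (rule smooth_on_inverse_norm[OF op' w']) (use m in auto)
    have 2: "smooth_on (\<lambda>A. inverse (norm (?w \<mu> A)) *\<^sub>R ?w \<mu> A) (retr_dom (Suc k))"
      by (rule smooth_on_bilinear[OF bounded_bilinear_scaleR op' 1 w'])
    show "smooth_on (\<lambda>A. radius k \<mu> *\<^sub>R (inverse (norm (?w \<mu> A)) *\<^sub>R ?w \<mu> A)) (retr_dom (Suc k))"
      by (rule smooth_on_linear_comp[OF bounded_linear_scaleR_right op' 2])
  qed
  note fit = this
  have eq: "retr (Suc k) = (\<lambda>A. retr k A + colrow k (fit_edge k (retr k A) (edge k A))
      + diag_entry k (R $ nth_index k $ nth_index k))" by (simp add: fun_eq_iff)
  have "smooth_on (retr (Suc k)) (retr_dom (Suc k))"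
    unfolding eq
    by (rule smooth_on_add[OF op' smooth_on_add[OF op' smooth_on_subset[OF sm sub]
        smooth_on_linear_comp[OF bounded_linear_colrow op' fit]] smooth_on_const[OF op']])
  then show ?case using op' by blast
qed

lemma spectral_block_level_set:
  "B \<in> level_set k \<Longrightarrow> k \<le> CARD('n) \<Longrightarrow> spectral_block k B (spec k)"
  by unfold_locales (auto simp: level_set_def spec_def)

lemma level_set_Suc_iff:
  assumes "k < CARD('n)" "B \<in> level_set k"
  shows "B \<in> level_set (Suc k) \<longleftrightarrow> B $ nth_index k $ nth_index k = R $ nth_index k $ nth_index k \<and>
    (\<forall>\<mu>\<in>spec k. norm (proj k (spec k) \<mu> (block k B) *v edge k B) = radius k \<mu>)"
proof -
  have "hermitian B" "eigs k B = eigs k R" using assms(2) by (auto simp: level_set_def)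
  from eigs_Suc_eq_iff[OF this(1) herm_R assms(1) this(2) refl] this assms(2) show ?thesis
    by (auto simp: level_set_def radius_def spec_def le_Suc_eq)
qed

text \<open>The projections in step \<open>k\<close> are taken from the block already retracted. By
  induction it has the prescribed spectrum, so they are orthogonal projections summing to the unit
  of the corner, and rescaling one component does not disturb another. Then
  \<open>level_set_Suc_iff\<close> yields the next spectrum.\<close>

lemma retr_in_level_set:
  "k \<le> CARD('n) \<Longrightarrow> A \<in> retr_dom k \<Longrightarrow> retr k A \<in> level_set k \<and> block k (retr k A) = retr k A"
proof (induction k)
  case 0
  have "eigs 0 (0 :: 'n cmat) = eigs 0 R"
    using size_eigs[of 0 "0 :: 'n cmat"] size_eigs[of 0 R] by simp
  then show ?case by (auto simp: level_set_def hermitian_def intro!: cmat_eqI)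
next
  case (Suc k)
  define B where "B = retr k A"
  define b where "b = fit_edge k B (edge k A)"
  define C where "C = retr (Suc k) A"
  have k: "k < CARD('n)" using Suc by simp
  have B: "B \<in> level_set k" "block k B = B" and B0: "hermitian B"
    using Suc by (auto simp: B_def level_set_def)
  interpret B: spectral_block k B "spec k" using spectral_block_level_set[OF B(1)] k by simp
  let ?P = "\<lambda>\<mu>. proj k (spec k) \<mu> B"
  have C: "C = B + colrow k b + diag_entry k (R $ nth_index k $ nth_index k)"
    by (simp add: C_def B_def b_def)
  have Eb: "corner k *v b = b"
    using B.corner_proj by (simp add: b_def fit_edge_def cvec_sum_right cvec_scaleR_right cvec_assoc B(2))
  then have b0: "b $ i = 0" if "\<not> pos i < k" for i using that by (metis corner_vec_nth)
  have B_out: "B $ i $ j = 0" if "\<not> (pos i < k \<and> pos j < k)" for i j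
    using that B(2) by (metis block_nth)
  have nth: "nth_index k = l" if "pos l = k" for l :: 'n using that by auto
  have CB: "block k C = B"
    using B_out by (intro cmat_eqI) (auto simp: C colrow_def diag_entry_def)
  have CC: "block (Suc k) C = C"
    using B_out by (intro cmat_eqI) (auto simp: C colrow_def diag_entry_def less_Suc_eq)
  have Cb: "edge k C = b"
    using k b0 B_out by (auto simp: C colrow_def diag_entry_def edge_nth Finite_Cartesian_Product.vec_eq_iff)
  have Cc: "C $ nth_index k $ nth_index k = R $ nth_index k $ nth_index k"
    using k B_out by (simp add: C colrow_def diag_entry_def)
  have "hermitian C"
    unfolding hermitian_def
  proof (rule cmat_eqI)
    fix i j
    show "conj_transpose C $ i $ j = C $ i $ j"
      by (cases "pos i" k rule: linorder_cases; cases "pos j" k rule: linorder_cases)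
        (simp_all add: C colrow_def diag_entry_def hermitian_nth[OF B0] hermitian_nth[OF herm_R])
  qed
  moreover have "eigs l C = eigs l R" if "l \<le> k" for l
    using eigs_block[of l k C] eigs_block[of l k B] that k B by (auto simp: CB level_set_def)
  ultimately have Ck: "C \<in> level_set k" by (auto simp: level_set_def)
  have "norm (?P \<mu> *v b) = radius k \<mu>" if m: "\<mu> \<in> spec k" for \<mu>
  proof -
    let ?w = "?P \<mu> *v edge k A"
    have "?P \<mu> *v b = (\<Sum>\<nu>\<in>active k. radius k \<nu> *\<^sub>R
        (inverse (norm (?P \<nu> *v edge k A)) *\<^sub>R ((?P \<mu> ** ?P \<nu>) *v edge k A)))"
      by (simp add: b_def fit_edge_def cvec_sum_right cvec_scaleR_right cvec_assoc)
    \<comment> \<open>Orthogonality leaves the component of \<open>\<mu>\<close> alone. For an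
      inactive \<open>\<mu>\<close> nothing is left, in agreement with its radius 0.\<close>
    also have "\<dots> = (\<Sum>\<nu>\<in>active k. if \<nu> = \<mu> then radius k \<mu> *\<^sub>R (inverse (norm ?w) *\<^sub>R ?w) else 0)"
      using B.proj_mult[OF m] B(2) by (intro sum.cong) (auto simp: active_def)
    finally have e: "?P \<mu> *v b = (if \<mu> \<in> active k then radius k \<mu> *\<^sub>R (inverse (norm ?w) *\<^sub>R ?w) else 0)"
      using finite_active by simp
    show ?thesis
    proof (cases "\<mu> \<in> active k")
      case True
      then have "?w \<noteq> 0" using Suc.prems by (auto simp: B_def)
      then show ?thesis using True e by (simp add: radius_def)
    next
      case False
      then show ?thesis using e m by (simp add: active_def)
    qed
  qed
  then have "C \<in> level_set (Suc k)"
    unfolding level_set_Suc_iff[OF k Ck] by (simp add: CB Cb Cc)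
  then show ?case using CC by (simp add: C_def)
qed

text \<open>On the level set there is nothing to correct: active components already have the
  prescribed norm, and the components missing from the sum are 0.\<close>

lemma retr_level_set:
  "k \<le> CARD('n) \<Longrightarrow> A \<in> level_set k \<Longrightarrow> A \<in> retr_dom k \<and> retr k A = block k A"
proof (induction k)
  case 0
  show ?case by (auto intro!: cmat_eqI)
next
  case (Suc k)
  have k: "k < CARD('n)" and A: "A \<in> level_set k" and hA: "hermitian A"
    using Suc.prems by (auto simp: level_set_def)
  have IH: "A \<in> retr_dom k" "retr k A = block k A" using Suc.IH k A by auto
  interpret A: spectral_block k A "spec k" using spectral_block_level_set[OF A] k by simp
  have c: "A $ nth_index k $ nth_index k = R $ nth_index k $ nth_index k"
    and r: "\<mu> \<in> spec k \<Longrightarrow> norm (A.P \<mu> *v edge k A) = radius k \<mu>" for \<mu>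
    using level_set_Suc_iff[OF k A] Suc.prems by auto
  have r0: "A.P \<mu> *v edge k A = 0 \<longleftrightarrow> radius k \<mu> = 0" if "\<mu> \<in> spec k" for \<mu>
    using r[OF that] by (metis norm_eq_zero)
  have "fit_edge k (block k A) (edge k A) = (\<Sum>\<mu>\<in>active k. A.P \<mu> *v edge k A)"
    unfolding fit_edge_def using r by (intro sum.cong) (auto simp: active_def)
  also have "\<dots> = (\<Sum>\<mu>\<in>spec k. A.P \<mu> *v edge k A)"
    using r0 finite_spec by (intro sum.mono_neutral_left) (auto simp: active_def)
  also have "\<dots> = edge k A" by (simp add: cvec_sum_left[symmetric] A.sum_proj)
  finally have "retr (Suc k) A = block (Suc k) A"
    by (simp add: IH block_Suc[OF hA k] c)
  moreover have "A \<in> retr_dom (Suc k)"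
    using IH r0 by (auto simp: active_def)
  ultimately show ?case by blast
qed

text \<open>The construction is triangular in \<open>k\<close>: step \<open>k\<close> looks at no
  entry outside the \<open>k\<close>-block. Hence the derivative of \<open>retr k\<close> vanishes
  on directions with zero \<open>k\<close>-block.\<close>

lemma retr_cong: "k \<le> CARD('n) \<Longrightarrow> block k A = block k B \<Longrightarrow> retr k A = retr k B"
proof (induction k)
  case (Suc k)
  have "block k A = block k B" using arg_cong[OF Suc.prems(2), of "block k"] by (simp add: block_block)
  moreover have "edge k A = edge k B"
    using arg_cong[OF Suc.prems(2), of "edge k"] Suc.prems(1) by (simp add: edge_block)
  ultimately show ?case using Suc by simp
qed simp

text \<open>Where the norms are already right, the factor \<open>radius k \<mu>\<close> cancels the
  normalization. On each active eigenspace the derivative becomes the projection to the tangent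
  space of a sphere.\<close>

lemma has_derivative_fit_edge:
  assumes "\<And>\<mu>. \<mu> \<in> active k \<Longrightarrow> norm (proj k (spec k) \<mu> B *v b) = radius k \<mu>"
  shows "(fit_edge k B has_derivative (\<lambda>v. \<Sum>\<mu>\<in>active k. proj k (spec k) \<mu> B *v v -
    (((proj k (spec k) \<mu> B *v b) \<bullet> (proj k (spec k) \<mu> B *v v)) / (radius k \<mu>)\<^sup>2) *\<^sub>R (proj k (spec k) \<mu> B *v b))) (at b)"
proof -
  have "((\<lambda>b. radius k \<mu> *\<^sub>R (inverse (norm (proj k (spec k) \<mu> B *v b)) *\<^sub>R (proj k (spec k) \<mu> B *v b)))
     has_derivative (\<lambda>v. proj k (spec k) \<mu> B *v v -
      (((proj k (spec k) \<mu> B *v b) \<bullet> (proj k (spec k) \<mu> B *v v)) / (radius k \<mu>)\<^sup>2) *\<^sub>R (proj k (spec k) \<mu> B *v b))) (at b)"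
    (is "(_ has_derivative ?d \<mu>) _") if m: "\<mu> \<in> active k" for \<mu>
  proof -
    let ?P = "proj k (spec k) \<mu> B"
    let ?w = "?P *v b" and ?r = "radius k \<mu>"
    have r: "norm ?w = ?r" "?r \<noteq> 0" using assms[OF m] m by (auto simp: active_def)
    then have w: "?w \<noteq> 0" by auto
    have lin: "((\<lambda>b. ?P *v b) has_derivative (\<lambda>v. ?P *v v)) (at b)"
      by (rule bounded_linear_imp_has_derivative[OF bounded_bilinear.bounded_linear_right
            [OF bounded_bilinear_cmat_vec]])
    have "((\<lambda>b. ?r *\<^sub>R (inverse (norm (?P *v b)) *\<^sub>R (?P *v b))) has_derivative
      (\<lambda>v. ?r *\<^sub>R (inverse (norm ?w) *\<^sub>R (?P *v v) - ((?w \<bullet> (?P *v v)) * inverse (norm ?w) ^ 3) *\<^sub>R ?w))) (at b)"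
      by (rule has_derivative_scaleR_right[OF has_derivative_compose[OF lin has_derivative_normalize[OF w]]])
    then show ?thesis
      by (rule has_derivative_eq_rhs)
        (use r in \<open>simp add: fun_eq_iff scaleR_diff_right power2_eq_square power3_eq_cube field_simps\<close>)
  qed
  then show ?thesis
    unfolding fit_edge_def[abs_def] by (intro has_derivative_sum)
qed

text \<open>An eigenspace of complex dimension m contributes 2m, the real trace of its projection,
  less 1 for the radial direction.\<close>

lemma trace_fit_edge_derivative:
  assumes B: "B \<in> level_set k" "block k B = B" and k: "k < CARD('n)"
    and r: "\<And>\<mu>. \<mu> \<in> active k \<Longrightarrow> norm (proj k (spec k) \<mu> B *v b) = radius k \<mu>"
  shows "(\<Sum>v\<in>Basis. (\<Sum>\<mu>\<in>active k. proj k (spec k) \<mu> B *v v -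
    (((proj k (spec k) \<mu> B *v b) \<bullet> (proj k (spec k) \<mu> B *v v)) / (radius k \<mu>)\<^sup>2) *\<^sub>R (proj k (spec k) \<mu> B *v b)) \<bullet> v)
    = (\<Sum>\<mu>\<in>active k. 2 * real (count (eigs k R) \<mu>) - 1)"
proof -
  interpret B: spectral_block k B "spec k" using spectral_block_level_set[OF B(1)] k by simp
  have "(\<Sum>v\<in>Basis. (proj k (spec k) \<mu> B *v v -
     (((proj k (spec k) \<mu> B *v b) \<bullet> (proj k (spec k) \<mu> B *v v)) / (radius k \<mu>)\<^sup>2) *\<^sub>R (proj k (spec k) \<mu> B *v b)) \<bullet> v)
    = 2 * real (count (eigs k R) \<mu>) - 1" if m: "\<mu> \<in> active k" for \<mu>
  proof -
    let ?P = "proj k (spec k) \<mu> B"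
    let ?w = "?P *v b" and ?r = "radius k \<mu>"
    have ms: "\<mu> \<in> spec k" and r0: "?r \<noteq> 0" using m by (auto simp: active_def)
    have "hermitian ?P" "?P ** ?P = ?P" using B.hermitian_proj[of \<mu>] B.proj_mult[OF ms ms] B(2) by auto
    then have adj: "?w \<bullet> (?P *v v) = ?w \<bullet> v" for v
      by (simp add: Re_hinner[symmetric] hinner_adjoint hermitian_def cvec_assoc)
    have "eigs k B = eigs k R" using B(1) by (simp add: level_set_def)
    then have tr: "trace ?P = of_nat (count (eigs k R) \<mu>)" using B.trace_proj[OF ms] B(2) by simp
    have "(\<Sum>v\<in>Basis. (?P *v v - ((?w \<bullet> (?P *v v)) / ?r\<^sup>2) *\<^sub>R ?w) \<bullet> v)
        = (\<Sum>v\<in>Basis. (?P *v v) \<bullet> v) - (\<Sum>v\<in>Basis. (?w \<bullet> v) * (?w \<bullet> v)) / ?r\<^sup>2"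
      by (simp add: adj inner_diff_left sum_subtractf sum_divide_distrib)
    also have "(\<Sum>v\<in>Basis. (?w \<bullet> v) * (?w \<bullet> v)) = ?r\<^sup>2"
      using r[OF m] by (simp add: euclidean_inner[symmetric] power2_norm_eq_inner[symmetric])
    finally show ?thesis using r0 by (simp add: trace_left_mult tr)
  qed
  then show ?thesis
    by (simp add: inner_sum_left) (subst sum.swap, simp)
qed

text \<open>Only the diagonal coefficients of the two derivatives enter the traces. They differ just
  in the directions of the new column, where the difference is the derivative of
  \<open>fit_edge\<close>.\<close>

lemma trace_retr_derivative_Suc:
  assumes p: "p \<in> level_set (Suc k)" and k: "k < CARD('n)"
  shows "(\<Sum>b\<in>Basis. frechet_derivative (retr (Suc k)) (at p) b \<bullet> b)
    = (\<Sum>b\<in>Basis. frechet_derivative (retr k) (at p) b \<bullet> b)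
      + (\<Sum>\<mu>\<in>active k. 2 * real (count (eigs k R) \<mu>) - 1)"
proof -
  let ?D = "frechet_derivative (retr k) (at p)" and ?D' = "frechet_derivative (retr (Suc k)) (at p)"
  let ?nk = "nth_index k :: 'n"
  have pk: "p \<in> level_set k" and hp: "hermitian p" using p by (auto simp: level_set_def)
  have dom: "p \<in> retr_dom (Suc k)" "p \<in> retr_dom k" and retr_p: "retr k p = block k p"
    using retr_level_set[OF _ p] retr_level_set[OF _ pk] k by auto
  have D: "(retr k has_derivative ?D) (at p)" and D': "(retr (Suc k) has_derivative ?D') (at p)"
    using smooth_on_has_derivative smooth_retr dom by blast+
  define B where "B = block k p"
  define b where "b = edge k p"
  have B: "B \<in> level_set k" "block k B = B"
    using retr_in_level_set[OF _ dom(2)] k by (auto simp: B_def retr_p)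
  have r: "norm (proj k (spec k) \<mu> B *v b) = radius k \<mu>" if "\<mu> \<in> active k" for \<mu>
    using level_set_Suc_iff[OF k pk] p that by (auto simp: active_def B_def b_def)
  define K where "K = (\<lambda>v. \<Sum>\<mu>\<in>active k. proj k (spec k) \<mu> B *v v -
    (((proj k (spec k) \<mu> B *v b) \<bullet> (proj k (spec k) \<mu> B *v v)) / (radius k \<mu>)\<^sup>2) *\<^sub>R (proj k (spec k) \<mu> B *v b))"
  have K: "(fit_edge k B has_derivative K) (at b)" unfolding K_def by (rule has_derivative_fit_edge[OF r])
  interpret B: spectral_block k B "spec k" using spectral_block_level_set[OF B(1)] k by simp
  have "corner k *v K v = K v" for v
    using B.corner_proj by (simp add: K_def cvec_sum_right cvec_diff_right cvec_scaleR_right cvec_assoc B(2))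
  then have K_out: "K v $ i = 0" if "\<not> pos i < k" for v i using that by (metis corner_vec_nth)
  have const: "retr k (p + t *\<^sub>R X) = B" if "block k X = 0" for X t
  proof -
    have "block k (p + t *\<^sub>R X) = block k p"
      using that bounded_linear_block[of k, where 'n='n] by (simp add: linear_simps)
    then show ?thesis using retr_cong[of k "p + t *\<^sub>R X" p] k by (simp add: retr_p B_def)
  qed
  have D0: "?D X = 0" if "block k X = 0" for X
    using has_derivative_line[OF D const[OF that] has_vector_derivative_const] .
  have edge_line: "edge k (p + t *\<^sub>R X) = b + t *\<^sub>R edge k X" for t X
    using bounded_linear_edge[of k, where 'n='n] by (simp add: linear_simps b_def)
  have D'_line: "?D' X = colrow k (K (edge k X))" if X: "block k X = 0" for X
  proof (rule has_derivative_line[OF D'])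
    show "retr (Suc k) (p + t *\<^sub>R X) = B + colrow k (fit_edge k B (b + t *\<^sub>R edge k X)) + diag_entry k (R $ ?nk $ ?nk)" for t
      by (simp add: const[OF X] edge_line)
    have "((\<lambda>t. b + t *\<^sub>R edge k X) has_derivative (\<lambda>t. 0 + t *\<^sub>R edge k X)) (at 0)"
      by (intro has_derivative_add has_derivative_const bounded_linear_imp_has_derivative bounded_linear_scaleR_left)
    from has_derivative_compose[OF this, of "fit_edge k B" K] K
    have "((\<lambda>t. fit_edge k B (b + t *\<^sub>R edge k X)) has_derivative (\<lambda>t. K (t *\<^sub>R edge k X))) (at 0)" by simp
    from bounded_linear.has_derivative[OF bounded_linear_colrow this]
    have "((\<lambda>t. B + colrow k (fit_edge k B (b + t *\<^sub>R edge k X)) + diag_entry k (R $ ?nk $ ?nk))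
      has_derivative (\<lambda>t. 0 + colrow k (K (t *\<^sub>R edge k X)) + 0)) (at 0)"
      by (intro has_derivative_add has_derivative_const)
    moreover have "0 + colrow k (K (t *\<^sub>R edge k X)) + 0 = t *\<^sub>R colrow k (K (edge k X))" for t
      using linear_cmul[OF has_derivative_linear[OF K]] linear_cmul[OF bounded_linear.linear[OF bounded_linear_colrow]]
      by simp
    ultimately show "((\<lambda>t. B + colrow k (fit_edge k B (b + t *\<^sub>R edge k X)) + diag_entry k (R $ ?nk $ ?nk))
      has_vector_derivative colrow k (K (edge k X))) (at 0)"
      unfolding has_vector_derivative_def by (simp only:)
  qed
  \<comment> \<open>Outside the border, step \<open>k\<close> adds a constant, so these matrix
    entries of the two derivatives agree.\<close>
  have entry: "(?D' X) $ i $ j = (?D X) $ i $ j"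
    if ij: "\<not> (pos i < k \<and> pos j = k)" "\<not> (pos i = k \<and> pos j < k)" for X i j
  proof -
    have bl: "bounded_linear (\<lambda>A :: 'n cmat. A $ i $ j)"
      by (intro linear_conv_bounded_linear[THEN iffD1] linearI) auto
    have "((\<lambda>A. (retr (Suc k) A - retr k A) $ i $ j) has_derivative (\<lambda>X. (?D' X - ?D X) $ i $ j)) (at p)"
      by (rule bounded_linear.has_derivative[OF bl has_derivative_diff[OF D' D]])
    moreover have "(retr (Suc k) A - retr k A) $ i $ j = diag_entry k (R $ ?nk $ ?nk) $ i $ j" for A
      using ij by (auto simp: colrow_def)
    ultimately have "(?D' X - ?D X) $ i $ j = 0"
      by (intro has_derivative_line[OF _ _ has_vector_derivative_const])
    then show ?thesis by simp
  qed
  have pos_k: "pos j = k \<longleftrightarrow> j = ?nk" for j :: 'n using k by auto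
  have term_eq: "?D' (axis i (axis j u)) $ i $ j \<bullet> u - ?D (axis i (axis j u)) $ i $ j \<bullet> u
      = (if j = ?nk then K (axis i u) $ i \<bullet> u else 0)" for i j :: 'n and u
  proof (cases "pos i < k \<and> pos j = k \<or> pos i = k \<and> pos j < k")
    case False
    moreover have "K (axis i u) $ i = 0" if "j = ?nk" using False that k K_out[of i] by simp
    ultimately show ?thesis using entry[of i j] by auto
  next
    case True
    \<comment> \<open>A direction inside the border does not change the \<open>k\<close>-block, so
      \<open>retr k\<close> is constant along it.\<close>
    let ?X = "axis i (axis j u) :: 'n cmat"
    have X: "block k ?X = 0"
    proof (rule cmat_eqI)
      fix a c
      have "\<not> (a = i \<and> c = j \<and> pos a < k \<and> pos c < k)" using True by auto
      then show "block k ?X $ a $ c = 0 $ a $ c" unfolding block_nth axis_axis_nth by auto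
    qed
    show ?thesis
    proof (cases "pos i < k")
      case T: True
      have "pos j = k" using True T by blast
      then have j: "j = ?nk" using pos_k by blast
      have "edge k ?X = axis i u"
        unfolding Finite_Cartesian_Product.vec_eq_iff edge_nth axis_axis_nth
        using T j by (simp add: axis_def)
      then show ?thesis using T j k unfolding D'_line[OF X] D0[OF X] by (simp add: colrow_def)
    next
      case F: False
      \<comment> \<open>The retraction reads only the new column and writes its conjugate into the
        row. So the row directions add nothing to the trace, and the column is not counted
        twice.\<close>
      have *: "pos i = k" "pos j < k" using True F by blast+
      then have "pos j \<noteq> k" by simp
      with * have i: "i = ?nk" "pos j < k" "j \<noteq> ?nk" using pos_k by blast+
      have "edge k ?X = 0"
        unfolding Finite_Cartesian_Product.vec_eq_iff edge_nth axis_axis_nth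
        using i by simp
      then show ?thesis using i linear_0[OF has_derivative_linear[OF K]]
        unfolding D'_line[OF X] D0[OF X] by (simp add: colrow_def)
    qed
  qed
  have "(\<Sum>b\<in>Basis. ?D' b \<bullet> b) - (\<Sum>b\<in>Basis. ?D b \<bullet> b)
      = (\<Sum>i\<in>UNIV. \<Sum>j\<in>UNIV. \<Sum>u\<in>Basis. if j = ?nk then K (axis i u) $ i \<bullet> u else 0)"
    unfolding sum_Basis_cmat inner_axis_cmat sum_subtractf[symmetric] by (simp only: term_eq)
  also have "\<dots> = (\<Sum>i\<in>UNIV. \<Sum>u\<in>Basis. \<Sum>j\<in>UNIV. if j = ?nk then K (axis i u) $ i \<bullet> u else 0)"
    by (intro sum.cong refl) (rule sum.swap)
  also have "\<dots> = (\<Sum>i\<in>UNIV. \<Sum>u\<in>Basis. K (axis i u) $ i \<bullet> u)"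
    by (simp only: sum.delta finite UNIV_I if_True)
  also have "\<dots> = (\<Sum>v\<in>Basis. K v \<bullet> v)"
    unfolding sum_Basis_vec[where f="\<lambda>v. K v \<bullet> v"] inner_axis ..
  also have "\<dots> = (\<Sum>\<mu>\<in>active k. 2 * real (count (eigs k R) \<mu>) - 1)"
    unfolding K_def by (rule trace_fit_edge_derivative[OF B k r])
  finally show ?thesis by simp
qed

lemma embedded_submanifold_level_set:
  "embedded_submanifold (\<Sum>k<CARD('n). \<Sum>\<mu>\<in>active k. 2 * count (eigs k R) \<mu> - 1) (level_set CARD('n))"
proof (rule embedded_submanifold_retract)
  let ?n = "CARD('n)"
  show "open (retr_dom ?n)" "smooth_on (retr ?n) (retr_dom ?n)" using smooth_retr by auto
  show "level_set ?n \<subseteq> retr_dom ?n" using retr_level_set by auto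
  show "retr ?n ` retr_dom ?n \<subseteq> level_set ?n" using retr_in_level_set by auto
  show "retr ?n x = x" if "x \<in> level_set ?n" for x using retr_level_set[OF _ that] by simp
  fix p assume p: "p \<in> level_set ?n"
  have "(\<Sum>b\<in>Basis. frechet_derivative (retr m) (at p) b \<bullet> b)
      = (\<Sum>k<m. \<Sum>\<mu>\<in>active k. 2 * real (count (eigs k R) \<mu>) - 1)" if "m \<le> ?n" for m
    using that
  proof (induction m)
    case 0
    have "retr 0 = (\<lambda>A. 0)" by (simp add: fun_eq_iff)
    then show ?case by simp
  next
    case (Suc m)
    have "p \<in> level_set (Suc m)" using p Suc.prems by (auto simp: level_set_def)
    then have "(\<Sum>b\<in>Basis. frechet_derivative (retr (Suc m)) (at p) b \<bullet> b)
      = (\<Sum>k<m. \<Sum>\<mu>\<in>active k. 2 * real (count (eigs k R) \<mu>) - 1)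
        + (\<Sum>\<mu>\<in>active m. 2 * real (count (eigs m R) \<mu>) - 1)"
      using trace_retr_derivative_Suc[of p m] Suc by (simp del: retr.simps)
    then show ?case by (simp del: retr.simps)
  qed
  \<comment> \<open>An active \<mu> is an eigenvalue, so its multiplicity is at least 1 and the
    subtraction of naturals is not truncated.\<close>
  moreover have "real (2 * count (eigs k R) \<mu> - 1) = 2 * real (count (eigs k R) \<mu>) - 1"
    if "\<mu> \<in> active k" for k \<mu>
  proof -
    have "count (eigs k R) \<mu> \<ge> 1" using that by (auto simp: active_def spec_def Suc_le_eq)
    then show ?thesis by simp
  qed
  then have "real (\<Sum>k<?n. \<Sum>\<mu>\<in>active k. 2 * count (eigs k R) \<mu> - 1)
      = (\<Sum>k<?n. \<Sum>\<mu>\<in>active k. 2 * real (count (eigs k R) \<mu>) - 1)"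
    unfolding of_nat_sum by (intro sum.cong refl)
  ultimately show "(\<Sum>b\<in>Basis. frechet_derivative (retr ?n) (at p) b \<bullet> b)
      = real (\<Sum>k<?n. \<Sum>\<mu>\<in>active k. 2 * count (eigs k R) \<mu> - 1)"
    by (simp only: order_refl)
qed

end

section \<open>Coadjoint orbits\<close>

definition hpart :: "'n::finite cmat \<Rightarrow> 'n cmat" where
  "hpart A = (1/2) *\<^sub>R (A + conj_transpose A)"

lemma hermitian_hpart: "hermitian (hpart A)"
  by (simp add: hpart_def hermitian_def conj_transpose_add conj_transpose_scaleR add.commute)

lemma hpart_hermitian: "hermitian A \<Longrightarrow> hpart A = A"
  by (simp add: hpart_def hermitian_def flip: scaleR_2)

lemma bounded_linear_hpart: "bounded_linear (hpart :: 'n::finite cmat \<Rightarrow> 'n cmat)"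
  unfolding hpart_def[abs_def]
  by (intro bounded_linear_compose[OF bounded_linear_scaleR_right] bounded_linear_add
      bounded_linear_ident bounded_linear_conj_transpose)

section \<open>Real traces of linear and conjugate-linear maps of matrices\<close>

lemma bounded_linear_sandwich: "bounded_linear (\<lambda>X. P ** X ** Q)" for P Q :: "'n::finite cmat"
  by (rule bounded_linear_compose[OF bounded_bilinear.bounded_linear_left[OF bounded_bilinear_cmat_mult, of Q]
      bounded_bilinear.bounded_linear_right[OF bounded_bilinear_cmat_mult, of P]])

lemma sandwich_axis_nth: "(P ** axis i (axis j u) ** Q) $ a $ b = P $ a $ i * u * Q $ j $ b"
  for P Q :: "'n::finite cmat"
proof -
  have 1: "(P ** axis i (axis j u)) $ a $ l = (if l = j then P $ a $ i * u else 0)" for l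
  proof -
    have "(P ** axis i (axis j u)) $ a $ l = (\<Sum>m\<in>UNIV. if m = i then (if l = j then P $ a $ i * u else 0) else 0)"
      unfolding cmat_mult_nth by (intro sum.cong) (auto simp: axis_axis_nth)
    then show ?thesis by simp
  qed
  have "(P ** axis i (axis j u) ** Q) $ a $ b = (\<Sum>l\<in>UNIV. if l = j then P $ a $ i * u * Q $ j $ b else 0)"
    unfolding cmat_mult_nth[of "P ** axis i (axis j u)"] 1 by (intro sum.cong) auto
  then show ?thesis by simp
qed

text \<open>The map X -> P X Q is the tensor product of \<open>P\<close> and the transpose of
  \<open>Q\<close>; its complex trace is the product of the traces.\<close>

lemma trace_sandwich:
  fixes P Q :: "'n::finite cmat"
  shows "(\<Sum>b\<in>Basis. (P ** b ** Q) \<bullet> b) = 2 * Re (trace P * trace Q)"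
proof -
  have "(\<Sum>u\<in>Basis. (p * u * q) \<bullet> u) = 2 * Re (p * q)" for p q :: complex
    by (simp add: Basis_complex_def inner_complex_def algebra_simps)
  then have "(\<Sum>b\<in>Basis. (P ** b ** Q) \<bullet> b) = (\<Sum>i\<in>UNIV. \<Sum>j\<in>UNIV. 2 * Re (P $ i $ i * Q $ j $ j))"
    unfolding sum_Basis_cmat inner_axis_cmat sandwich_axis_nth by (simp only:)
  also have "\<dots> = 2 * Re (trace P * trace Q)"
    unfolding trace_def sum_product unfolding Re_sum sum_distrib_left ..
  finally show ?thesis .
qed

text \<open>A conjugate-linear map anticommutes with multiplication by i, so its real trace is
  0.\<close>

lemma trace_conj_sandwich: "(\<Sum>b\<in>Basis. conj_transpose (P ** b ** Q) \<bullet> b) = 0"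
  for P Q :: "'n::finite cmat"
proof -
  have "(\<Sum>u\<in>Basis. cnj (p * u * q) \<bullet> u) = 0" for p q :: complex
    by (simp add: Basis_complex_def inner_complex_def algebra_simps)
  then show ?thesis
    unfolding sum_Basis_cmat inner_axis_cmat conj_transpose_nth sandwich_axis_nth by simp
qed

locale orbit_point =
  fixes A :: "'n::{finite,linorder} cmat" and X :: "real multiset"
  assumes herm: "hermitian A" and eigs: "eigs CARD('n) A = X"
begin

abbreviation "pv \<equiv> peval (corner CARD('n) :: 'n cmat)"

abbreviation "S \<equiv> set_mset X"

definition Pr :: "real \<Rightarrow> 'n cmat" where "Pr \<mu> = proj CARD('n) S \<mu> A"

sublocale sb: spectral_block "CARD('n)" A S
  by unfold_locales (simp_all add: herm eigs)

lemmas sb_simps = block_full Pr_def[symmetric]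

lemma Pr_mult: "\<mu> \<in> S \<Longrightarrow> \<nu> \<in> S \<Longrightarrow> Pr \<mu> ** Pr \<nu> = (if \<mu> = \<nu> then Pr \<mu> else 0)"
  using sb.proj_mult unfolding sb_simps .

lemma A_Pr: "\<mu> \<in> S \<Longrightarrow> A ** Pr \<mu> = \<mu> *\<^sub>R Pr \<mu>"
  using sb.block_proj unfolding sb_simps .

lemma Pr_A: "\<mu> \<in> S \<Longrightarrow> Pr \<mu> ** A = \<mu> *\<^sub>R Pr \<mu>"
  using sb.proj_block unfolding sb_simps .

lemma pv_Pr: "\<mu> \<in> S \<Longrightarrow> pv p A ** Pr \<mu> = poly p \<mu> *\<^sub>R Pr \<mu>"
  using sb.peval_proj unfolding sb_simps .

lemma hermitian_Pr: "conj_transpose (Pr \<mu>) = Pr \<mu>"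
  using sb.hermitian_proj unfolding sb_simps hermitian_def .

lemma sum_Pr: "(\<Sum>\<mu>\<in>S. Pr \<mu>) = corner CARD('n)"
  using sb.sum_proj unfolding sb_simps .

lemma trace_Pr: "\<mu> \<in> S \<Longrightarrow> trace (Pr \<mu>) = of_nat (count X \<mu>)"
  using sb.trace_proj unfolding sb_simps eigs .

text \<open>The subtracted sum is the part of \<open>Z\<close> that commutes with \<open>A\<close>.
  What stays is the part reached by brackets with \<open>A\<close>.\<close>

definition off :: "'n cmat \<Rightarrow> 'n cmat" where
  "off Z = Z - (\<Sum>\<mu>\<in>S. Pr \<mu> ** Z ** Pr \<mu>)"

lemma bounded_linear_off: "bounded_linear off"
  unfolding off_def[abs_def]
  by (intro bounded_linear_sub bounded_linear_ident bounded_linear_sum bounded_linear_sandwich)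

lemma Pr_diag_Pr:
  assumes "\<mu> \<in> S"
  shows "Pr \<mu> ** (\<Sum>\<nu>\<in>S. Pr \<nu> ** Z \<nu> ** Pr \<nu>) ** Pr \<mu> = Pr \<mu> ** Z \<mu> ** Pr \<mu>"
proof -
  have "Pr \<mu> ** (\<Sum>\<nu>\<in>S. Pr \<nu> ** Z \<nu> ** Pr \<nu>) ** Pr \<mu>
      = (\<Sum>\<nu>\<in>S. (Pr \<mu> ** Pr \<nu>) ** Z \<nu> ** (Pr \<nu> ** Pr \<mu>))"
    by (simp add: cmat_sum_left cmat_sum_right matrix_mul_assoc)
  also have "\<dots> = (\<Sum>\<nu>\<in>S. if \<nu> = \<mu> then Pr \<mu> ** Z \<mu> ** Pr \<mu> else 0)"
    using assms by (intro sum.cong) (auto simp: Pr_mult)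
  finally show ?thesis using assms by simp
qed

lemma Pr_off_Pr: "\<mu> \<in> S \<Longrightarrow> Pr \<mu> ** off Z ** Pr \<mu> = 0"
  by (simp add: off_def cmat_mult_diff cmat_diff_mult Pr_diag_Pr)

lemma off_eq_self: "(\<And>\<mu>. \<mu> \<in> S \<Longrightarrow> Pr \<mu> ** Z ** Pr \<mu> = 0) \<Longrightarrow> off Z = Z"
  by (simp add: off_def)

lemma conj_sandwich: "conj_transpose (Pr \<mu> ** Z ** Pr \<nu>) = Pr \<nu> ** conj_transpose Z ** Pr \<mu>"
  by (simp add: conj_transpose_mult hermitian_Pr matrix_mul_assoc)

lemma off_conj_transpose: "off (conj_transpose Z) = conj_transpose (off Z)"
  by (simp add: off_def conj_transpose_diff conj_transpose_sum conj_sandwich)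

text \<open>This is the tangent space of the orbit at \<open>A\<close>, and the linear model onto
  which \<open>chart\<close> straightens the orbit.\<close>

definition slice :: "'n cmat set" where
  "slice = {Z. hermitian Z \<and> (\<forall>\<mu>\<in>S. Pr \<mu> ** Z ** Pr \<mu> = 0)}"

lemma subspace_slice: "Real_Vector_Spaces.subspace slice"
  by (auto simp: slice_def Real_Vector_Spaces.subspace_def hermitian_def conj_transpose_add conj_transpose_scaleR
      cmat_add_left cmat_add_right cmat_scaleR_left cmat_scaleR_right)

text \<open>\<open>slice\<close> is the range of the idempotent Z -> hpart (off Z), so its dimension
  is a trace. The conjugate half of \<open>hpart\<close> contributes 0, and half the real trace of
  \<open>off\<close> remains.\<close>

lemma dim_slice: "Real_Vector_Spaces.dim slice = (CARD('n))\<^sup>2 - (\<Sum>\<mu>\<in>S. (count X \<mu>)\<^sup>2)"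
proof -
  let ?T = "\<lambda>Z. hpart (off Z)"
  have bl: "bounded_linear ?T" by (rule bounded_linear_compose[OF bounded_linear_hpart bounded_linear_off])
  have in_slice: "?T Z \<in> slice" for Z
  proof -
    have "Pr \<mu> ** conj_transpose (off Z) ** Pr \<mu> = 0" if "\<mu> \<in> S" for \<mu>
      unfolding off_conj_transpose[symmetric] by (rule Pr_off_Pr[OF that])
    then show ?thesis
      by (simp add: slice_def hermitian_hpart)
        (simp add: hpart_def cmat_scaleR_left cmat_scaleR_right cmat_add_left cmat_add_right Pr_off_Pr)
  qed
  have on_slice: "?T Z = Z" if "Z \<in> slice" for Z
    using that by (simp add: slice_def off_eq_self hpart_hermitian)
  have "range ?T = slice"
  proof
    show "range ?T \<subseteq> slice" using in_slice by blast
    show "slice \<subseteq> range ?T" using on_slice by (metis rangeI subsetI)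
  qed
  then have "real (Real_Vector_Spaces.dim slice) = (\<Sum>b\<in>Basis. ?T b \<bullet> b)"
    using dim_range_idempotent[OF bounded_linear.linear[OF bl]] in_slice on_slice by simp
  also have "\<dots> = (\<Sum>b\<in>Basis. (off b \<bullet> b + conj_transpose (off b) \<bullet> b) / 2)"
    by (simp add: hpart_def inner_add_left)
  also have "\<dots> = ((\<Sum>b\<in>Basis. off b \<bullet> b) + (\<Sum>b\<in>Basis. conj_transpose (off b) \<bullet> b)) / 2"
    by (simp only: sum.distrib sum_divide_distrib[symmetric])
  also have "(\<Sum>b\<in>Basis. off b \<bullet> b) = 2 * (real CARD('n))\<^sup>2 - 2 * (\<Sum>\<mu>\<in>S. (real (count X \<mu>))\<^sup>2)"
  proof -
    have "(\<Sum>b\<in>Basis. off b \<bullet> b) = (\<Sum>b\<in>(Basis :: 'n cmat set). b \<bullet> b)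
        - (\<Sum>\<mu>\<in>S. \<Sum>b\<in>Basis. (Pr \<mu> ** b ** Pr \<mu>) \<bullet> b)"
      by (simp only: off_def inner_diff_left inner_sum_left sum_subtractf sum.swap[where A=Basis and B=S])
    also have "(\<Sum>b\<in>(Basis :: 'n cmat set). b \<bullet> b) = 2 * (real CARD('n))\<^sup>2"
      by (simp add: power2_eq_square)
    also have "(\<Sum>\<mu>\<in>S. \<Sum>b\<in>Basis. (Pr \<mu> ** b ** Pr \<mu>) \<bullet> b) = 2 * (\<Sum>\<mu>\<in>S. (real (count X \<mu>))\<^sup>2)"
      unfolding trace_sandwich sum_distrib_left
      by (intro sum.cong refl) (simp add: trace_Pr power2_eq_square)
    finally show ?thesis .
  qed
  also have "(\<Sum>b\<in>Basis. conj_transpose (off b) \<bullet> b) = 0"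
  proof -
    \<comment> \<open>The identity map is written as a sandwich by the unit, so that the trace
      formula for conjugated sandwiches also covers this term.\<close>
    have off_eq: "off b = corner CARD('n) ** b ** corner CARD('n) - (\<Sum>\<mu>\<in>S. Pr \<mu> ** b ** Pr \<mu>)" for b
      by (simp add: off_def)
    have "(\<Sum>b\<in>Basis. conj_transpose (off b) \<bullet> b)
        = (\<Sum>b\<in>Basis. conj_transpose (corner CARD('n) ** b ** (corner CARD('n) :: 'n cmat)) \<bullet> b)
        - (\<Sum>\<mu>\<in>S. \<Sum>b\<in>Basis. conj_transpose (Pr \<mu> ** b ** Pr \<mu>) \<bullet> b)"
      unfolding off_eq
      by (simp only: conj_transpose_diff conj_transpose_sum inner_diff_left inner_sum_left sum_subtractf
          sum.swap[where A=Basis and B=S])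
    then show ?thesis by (simp only: trace_conj_sandwich sum.neutral_const diff_self)
  qed
  finally have "real (Real_Vector_Spaces.dim slice) = real ((CARD('n))\<^sup>2) - real (\<Sum>\<mu>\<in>S. (count X \<mu>)\<^sup>2)" by simp
  then show ?thesis by linarith
qed

section \<open>The polynomial chart of the orbit\<close>

definition q :: "real poly" where "q = (\<Prod>\<nu>\<in>S. [:- \<nu>, 1:])"

lemma poly_q: "poly q x = 0 \<longleftrightarrow> x \<in> S"
  by (auto simp: q_def poly_prod)

lemma pderiv_q_nz: "\<mu> \<in> S \<Longrightarrow> poly (pderiv q) \<mu> \<noteq> 0"
proof -
  assume m: "\<mu> \<in> S"
  have "q = [:- \<mu>, 1:] * (\<Prod>\<nu>\<in>S - {\<mu>}. [:- \<nu>, 1:])"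
    unfolding q_def by (rule prod.remove) (use m in auto)
  then have "poly (pderiv q) \<mu> = poly (\<Prod>\<nu>\<in>S - {\<mu>}. [:- \<nu>, 1:]) \<mu>"
    by (simp only: pderiv_mult poly_add poly_mult) (simp add: pderiv_pCons)
  then show ?thesis by (auto simp: poly_prod)
qed

text \<open>Between two copies of \<open>Pr \<mu>\<close> the matrix \<open>A\<close> acts as the
  scalar \<open>\<mu>\<close> from both sides, so the noncommutative product rule collapses to the
  ordinary derivative. This is the diagonal case of the Daleckii--Krein formula.\<close>

lemma peval_derivative:
  "\<exists>D. (pv p has_derivative D) (at A) \<and>
    (\<forall>Z. \<forall>\<mu>\<in>S. Pr \<mu> ** D Z ** Pr \<mu> = poly (pderiv p) \<mu> *\<^sub>R (Pr \<mu> ** Z ** Pr \<mu>))"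
proof (induction p)
  case 0
  have "pv 0 = (\<lambda>M. 0)" by (simp add: fun_eq_iff)
  then show ?case by (intro exI[of _ "\<lambda>_. 0"]) simp
next
  case (pCons a p)
  then obtain D where D: "(pv p has_derivative D) (at A)"
    "\<And>Z \<mu>. \<mu> \<in> S \<Longrightarrow> Pr \<mu> ** D Z ** Pr \<mu> = poly (pderiv p) \<mu> *\<^sub>R (Pr \<mu> ** Z ** Pr \<mu>)" by blast
  let ?D = "\<lambda>Z. A ** D Z + Z ** pv p A"
  have "pv (pCons a p) = (\<lambda>M. a *\<^sub>R corner CARD('n) + M ** pv p M)" by (simp add: fun_eq_iff)
  moreover have "((\<lambda>M. a *\<^sub>R corner CARD('n) + M ** pv p M) has_derivative (\<lambda>Z. 0 + ?D Z)) (at A)"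
    by (intro has_derivative_add has_derivative_const
        bounded_bilinear.FDERIV[OF bounded_bilinear_cmat_mult] has_derivative_ident D(1))
  ultimately have "(pv (pCons a p) has_derivative ?D) (at A)" by simp
  moreover have "Pr \<mu> ** ?D Z ** Pr \<mu> = poly (pderiv (pCons a p)) \<mu> *\<^sub>R (Pr \<mu> ** Z ** Pr \<mu>)"
    if m: "\<mu> \<in> S" for \<mu> Z
  proof -
    have "Pr \<mu> ** ?D Z ** Pr \<mu> = (Pr \<mu> ** A) ** D Z ** Pr \<mu> + Pr \<mu> ** Z ** (pv p A ** Pr \<mu>)"
      by (simp only: cmat_add_left cmat_add_right matrix_mul_assoc)
    also have "\<dots> = \<mu> *\<^sub>R (Pr \<mu> ** D Z ** Pr \<mu>) + poly p \<mu> *\<^sub>R (Pr \<mu> ** Z ** Pr \<mu>)"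
      by (simp only: Pr_A[OF m] pv_Pr[OF m] cmat_scaleR_left cmat_scaleR_right)
    also have "\<dots> = poly (pderiv (pCons a p)) \<mu> *\<^sub>R (Pr \<mu> ** Z ** Pr \<mu>)"
      by (simp add: D(2)[OF m] pderiv_pCons algebra_simps)
    finally show ?thesis .
  qed
  ultimately show ?case by blast
qed

text \<open>The correction term makes the derivative of \<open>herm_chart\<close> at \<open>A\<close> the identity, while it
  vanishes on Hermitian matrices with spectrum in \<open>S\<close>.\<close>

definition herm_chart :: "'n cmat \<Rightarrow> 'n cmat" where
  "herm_chart B = off (B - A) + (\<Sum>\<mu>\<in>S. inverse (poly (pderiv q) \<mu>) *\<^sub>R (Pr \<mu> ** pv q B ** Pr \<mu>))"

text \<open>The skew-Hermitian part is carried along unchanged. This extends the chart to the full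
  ambient space of matrices and makes its vanishing part of the condition to lie in
  \<open>slice\<close>.\<close>

definition chart :: "'n cmat \<Rightarrow> 'n cmat" where
  "chart B = (B - hpart B) + herm_chart (hpart B)"

lemma smooth_chart: "smooth_on chart UNIV"
proof -
  have h: "smooth_on hpart (UNIV :: 'n cmat set)" by (rule smooth_on_linear[OF open_UNIV bounded_linear_hpart])
  have 1: "smooth_on (\<lambda>B. off (hpart B - A)) UNIV"
    by (rule smooth_on_linear_comp[OF bounded_linear_off open_UNIV
          smooth_on_minus[OF open_UNIV h smooth_on_const[OF open_UNIV]]])
  have "smooth_on (\<lambda>B. inverse (poly (pderiv q) \<mu>) *\<^sub>R (Pr \<mu> ** pv q (hpart B) ** Pr \<mu>)) UNIV" for \<mu>
    by (rule smooth_on_linear_comp[OF bounded_linear_scaleR_right open_UNIV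
          smooth_on_linear_comp[OF bounded_linear_sandwich open_UNIV smooth_on_peval[OF open_UNIV h]]])
  then have 2: "smooth_on (\<lambda>B. \<Sum>\<mu>\<in>S. inverse (poly (pderiv q) \<mu>) *\<^sub>R (Pr \<mu> ** pv q (hpart B) ** Pr \<mu>)) UNIV"
    by (rule smooth_on_sum[OF open_UNIV])
  show ?thesis
    unfolding chart_def[abs_def] herm_chart_def
    by (rule smooth_on_add[OF open_UNIV smooth_on_minus[OF open_UNIV
          smooth_on_linear[OF open_UNIV bounded_linear_ident] h] smooth_on_add[OF open_UNIV 1 2]])
qed

lemma chart_derivative: "(chart has_derivative (\<lambda>Z. Z)) (at A)"
proof -
  obtain D where D: "(pv q has_derivative D) (at A)"
    "\<And>Z \<mu>. \<mu> \<in> S \<Longrightarrow> Pr \<mu> ** D Z ** Pr \<mu> = poly (pderiv q) \<mu> *\<^sub>R (Pr \<mu> ** Z ** Pr \<mu>)"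
    using peval_derivative by blast
  have "(herm_chart has_derivative (\<lambda>Z. off (Z - 0) +
      (\<Sum>\<mu>\<in>S. inverse (poly (pderiv q) \<mu>) *\<^sub>R (Pr \<mu> ** D Z ** Pr \<mu>)))) (at A)"
    unfolding herm_chart_def[abs_def]
    by (intro has_derivative_add has_derivative_sum has_derivative_scaleR_right
        bounded_linear.has_derivative[OF bounded_linear_off] bounded_linear.has_derivative[OF bounded_linear_sandwich]
        has_derivative_diff has_derivative_ident has_derivative_const D(1))
  moreover have "off (Z - 0) + (\<Sum>\<mu>\<in>S. inverse (poly (pderiv q) \<mu>) *\<^sub>R (Pr \<mu> ** D Z ** Pr \<mu>)) = Z" for Z
    using pderiv_q_nz by (simp add: off_def D(2))
  ultimately have g: "(herm_chart has_derivative (\<lambda>Z. Z)) (at A)" by simp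
  have h: "(hpart has_derivative hpart) (at A)"
    by (rule bounded_linear_imp_has_derivative[OF bounded_linear_hpart])
  have "((\<lambda>B. herm_chart (hpart B)) has_derivative (\<lambda>Z. hpart Z)) (at A)"
    using has_derivative_compose[OF h, of herm_chart "\<lambda>Z. Z"] g by (simp add: hpart_hermitian[OF herm])
  then have "(chart has_derivative (\<lambda>Z. (Z - hpart Z) + hpart Z)) (at A)"
    unfolding chart_def[abs_def] by (intro has_derivative_add has_derivative_diff has_derivative_ident h)
  then show ?thesis by simp
qed

lemma hermitian_pv: "hermitian B \<Longrightarrow> hermitian (pv p B)"
  using corner_algebra.hermitian_peval[OF corner_algebra_block hermitian_corner hermitian_block, of B "CARD('n)"]
  unfolding block_full .

lemma hermitian_herm_chart: "hermitian B \<Longrightarrow> hermitian (herm_chart B)"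
  using herm hermitian_pv[of B q]
  by (simp add: herm_chart_def hermitian_def conj_transpose_add conj_transpose_sum conj_transpose_scaleR
      conj_sandwich conj_transpose_diff off_conj_transpose[symmetric])

lemma Pr_herm_chart_Pr: "\<mu> \<in> S \<Longrightarrow>
  Pr \<mu> ** herm_chart B ** Pr \<mu> = inverse (poly (pderiv q) \<mu>) *\<^sub>R (Pr \<mu> ** pv q B ** Pr \<mu>)"
proof -
  assume m: "\<mu> \<in> S"
  have "(\<Sum>\<nu>\<in>S. inverse (poly (pderiv q) \<nu>) *\<^sub>R (Pr \<nu> ** pv q B ** Pr \<nu>))
      = (\<Sum>\<nu>\<in>S. Pr \<nu> ** (inverse (poly (pderiv q) \<nu>) *\<^sub>R pv q B) ** Pr \<nu>)"
    by (simp add: cmat_scaleR_left cmat_scaleR_right)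
  then show ?thesis
    using m by (simp add: herm_chart_def cmat_add_left cmat_add_right Pr_off_Pr Pr_diag_Pr)
      (simp add: cmat_scaleR_left cmat_scaleR_right)
qed

text \<open>The skew part of \<open>chart B\<close> is that of \<open>B\<close>, so it must vanish;
  after that the diagonal compressions of \<open>chart B\<close> see only those of q(B), up to the
  nonzero factor 1/q'(\<mu>).\<close>

lemma chart_in_slice_iff: "chart B \<in> slice \<longleftrightarrow> hermitian B \<and> (\<forall>\<mu>\<in>S. Pr \<mu> ** pv q B ** Pr \<mu> = 0)"
proof
  assume c: "chart B \<in> slice"
  let ?K = "B - hpart B"
  have gh: "hermitian (herm_chart (hpart B))" by (rule hermitian_herm_chart[OF hermitian_hpart])
  have "hermitian (chart B)" using c by (simp add: slice_def)
  then have "conj_transpose ?K = ?K"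
    using gh by (simp add: chart_def hermitian_def conj_transpose_add)
  moreover have "conj_transpose ?K = - ?K"
    by (rule cmat_eqI) (auto simp: hpart_def complex_eq_iff field_simps)
  ultimately have "?K = - ?K" by (simp only:)
  then have "?K + ?K = 0" by (metis add.right_inverse)
  then have "?K = 0" by (metis scaleR_2 scaleR_eq_0_iff zero_neq_numeral)
  then have B: "hpart B = B" by simp
  then have "hermitian B" using hermitian_hpart[of B] by simp
  moreover have "Pr \<mu> ** pv q B ** Pr \<mu> = 0" if "\<mu> \<in> S" for \<mu>
    using c Pr_herm_chart_Pr[OF that, of B] pderiv_q_nz[OF that] that by (simp add: slice_def chart_def B)
  ultimately show "hermitian B \<and> (\<forall>\<mu>\<in>S. Pr \<mu> ** pv q B ** Pr \<mu> = 0)" by blast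
next
  assume *: "hermitian B \<and> (\<forall>\<mu>\<in>S. Pr \<mu> ** pv q B ** Pr \<mu> = 0)"
  then show "chart B \<in> slice"
    by (simp add: slice_def chart_def hpart_hermitian hermitian_herm_chart Pr_herm_chart_Pr)
qed

text \<open>On matrices without diagonal blocks, bracketing with \<open>A\<close> multiplies the
  (\<mu>, \<nu>) block by \<mu> - \<nu>, and \<open>\<Phi>\<close> divides by it again. The terms
  with \<mu> = \<nu> drop out because \<open>inverse 0 = 0\<close>.\<close>

lemma off_diagonal_bound:
  "\<exists>C>0. \<forall>N. (\<forall>\<mu>\<in>S. Pr \<mu> ** N ** Pr \<mu> = 0) \<longrightarrow> norm N \<le> C * norm (A ** N - N ** A)"
proof -
  define \<Phi> where "\<Phi> Y = (\<Sum>\<mu>\<in>S. \<Sum>\<nu>\<in>S. inverse (\<mu> - \<nu>) *\<^sub>R (Pr \<mu> ** Y ** Pr \<nu>))" for Y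
  have "bounded_linear \<Phi>"
    unfolding \<Phi>_def[abs_def]
    by (intro bounded_linear_sum bounded_linear_compose[OF bounded_linear_scaleR_right] bounded_linear_sandwich)
  then obtain C where C: "C > 0" "\<And>Y. norm (\<Phi> Y) \<le> norm Y * C" using bounded_linear.pos_bounded by blast
  have "N = \<Phi> (A ** N - N ** A)" if N: "\<forall>\<mu>\<in>S. Pr \<mu> ** N ** Pr \<mu> = 0" for N
  proof -
    have "N = (\<Sum>\<mu>\<in>S. Pr \<mu>) ** N ** (\<Sum>\<nu>\<in>S. Pr \<nu>)" by (simp add: sum_Pr)
    also have "\<dots> = (\<Sum>\<mu>\<in>S. \<Sum>\<nu>\<in>S. Pr \<mu> ** N ** Pr \<nu>)"
      by (simp add: cmat_sum_left cmat_sum_right) (rule sum.swap)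
    also have "\<dots> = \<Phi> (A ** N - N ** A)"
      unfolding \<Phi>_def
    proof (intro sum.cong refl)
      fix \<mu> \<nu> assume m: "\<mu> \<in> S" "\<nu> \<in> S"
      have "Pr \<mu> ** (A ** N - N ** A) ** Pr \<nu> = (Pr \<mu> ** A) ** N ** Pr \<nu> - Pr \<mu> ** N ** (A ** Pr \<nu>)"
        by (simp only: cmat_diff_mult cmat_mult_diff matrix_mul_assoc)
      also have "\<dots> = (\<mu> - \<nu>) *\<^sub>R (Pr \<mu> ** N ** Pr \<nu>)"
        by (simp only: Pr_A[OF m(1)] A_Pr[OF m(2)] cmat_scaleR_left cmat_scaleR_right scaleR_left_diff_distrib)
      finally show "Pr \<mu> ** N ** Pr \<nu> = inverse (\<mu> - \<nu>) *\<^sub>R (Pr \<mu> ** (A ** N - N ** A) ** Pr \<nu>)"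
        using N m by (cases "\<mu> = \<nu>") simp_all
    qed
    finally show ?thesis .
  qed
  then have "norm N \<le> C * norm (A ** N - N ** A)" if "\<forall>\<mu>\<in>S. Pr \<mu> ** N ** Pr \<mu> = 0" for N
    using C(2)[of "A ** N - N ** A"] that by (simp add: mult.commute)
  then show ?thesis using C(1) by blast
qed

text \<open>q(B) = 0 puts all eigenvalues into \<open>S\<close>, by the trace of q(B)^2. The trace
  of a Lagrange polynomial of \<open>B\<close> is then a multiplicity, and two integers at distance
  below 1 coincide.\<close>

lemma eigs_eqI:
  assumes B: "hermitian B" and q0: "pv q B = 0"
    and near: "\<And>\<mu>. \<mu> \<in> S \<Longrightarrow> \<bar>Re (trace (pv (lag S \<mu>) B)) - real (count X \<mu>)\<bar> < 1"
  shows "eigs CARD('n) B = X"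
proof -
  have tr: "trace (pv p B) = of_real (\<Sum>x\<in>#eigs CARD('n) B. poly p x)" for p
    using trace_peval_block[OF B order_refl, of p] by simp
  interpret corner_algebra "corner CARD('n)" B
    using corner_algebra_block[of "CARD('n)" B] by simp
  have "complex_of_real (\<Sum>x\<in>#eigs CARD('n) B. poly (q * q) x) = 0"
    using tr[of "q * q"] by (simp only: peval_mult q0 cmat_zero_left trace_cmat_zero)
  then have 0: "(\<Sum>x\<in>#eigs CARD('n) B. poly (q * q) x) = 0"
    by (simp only: of_real_eq_0_iff)
  have nn: "\<forall>x\<in>#M. f x = 0" if "(\<Sum>x\<in>#M. f x) = 0" "\<And>x. f x \<ge> 0" for M and f :: "real \<Rightarrow> real"
    using that(1)
  proof (induction M)
    case (add x M)
    have "(\<Sum>x\<in>#M. f x) \<ge> 0" using that(2) by (induction M) auto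
    then show ?case using add that(2)[of x] by auto
  qed simp
  have sub: "x \<in> S" if "x \<in># eigs CARD('n) B" for x
  proof -
    have "poly (q * q) x = 0" using nn[OF 0] that by simp
    then show ?thesis using poly_q[of x] by simp
  qed
  have cnt: "count (eigs CARD('n) B) \<mu> = count X \<mu>" if m: "\<mu> \<in> S" for \<mu>
  proof -
    have "(\<Sum>x\<in>#eigs CARD('n) B. poly (lag S \<mu>) x) = (\<Sum>x\<in>#eigs CARD('n) B. if x = \<mu> then 1 else 0)"
      using sub by (intro arg_cong[where f=sum_mset] image_mset_cong) (simp add: poly_lag)
    also have "\<dots> = real (count (eigs CARD('n) B) \<mu>)" by (simp add: sum_mset_delta)
    finally have "\<bar>real (count (eigs CARD('n) B) \<mu>) - real (count X \<mu>)\<bar> < 1"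
      using near[OF m] tr[of "lag S \<mu>"] by (simp only: Re_complex_of_real)
    then show ?thesis by linarith
  qed
  show ?thesis
  proof (rule multiset_eqI)
    fix x
    show "count (eigs CARD('n) B) x = count X x"
      using cnt[of x] sub[of x] by (metis count_eq_zero_iff)
  qed
qed

text \<open>The chart controls only the diagonal blocks of N = q(B). When they vanish, |N| \<le> C
  |[A, N]|, and since N commutes with \<open>B\<close>, the bracket equals [A - B, N]. For
  \<open>B\<close> close to \<open>A\<close> this forces N = 0.\<close>

lemma slice_chart:
  "\<exists>U. open U \<and> A \<in> U \<and> (\<forall>B\<in>U. hermitian B \<and> eigs CARD('n) B = X \<longleftrightarrow> chart B \<in> slice)"
proof -
  obtain C where C: "C > 0" "\<And>N. \<forall>\<mu>\<in>S. Pr \<mu> ** N ** Pr \<mu> = 0 \<Longrightarrow> norm N \<le> C * norm (A ** N - N ** A)"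
    using off_diagonal_bound by blast
  obtain K where K: "K > 0" "\<And>Y Z. norm ((Y :: 'n cmat) ** (Z :: 'n cmat)) \<le> norm Y * norm Z * K"
    using bounded_bilinear.pos_bounded[OF bounded_bilinear_cmat_mult] by blast
  \<comment> \<open>The radius makes 2 C K |A - B| < 1, where \<open>K\<close> bounds the matrix
    product. The remaining conditions keep the multiplicities.\<close>
  define U where "U = ball A (1 / (2 * C * K)) \<inter>
    (\<Inter>\<mu>\<in>S. {B. \<bar>Re (trace (pv (lag S \<mu>) B)) - real (count X \<mu>)\<bar> < 1})"
  have cont: "continuous_on UNIV (\<lambda>B. \<bar>Re (trace (pv p B)) - c\<bar>)" for p c
  proof -
    have "continuous_on UNIV (pv p)"
      using smooth_on_imp_continuous_on[OF smooth_on_peval[OF open_UNIV smooth_on_linear[OF open_UNIV bounded_linear_ident]]] .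
    then show ?thesis unfolding trace_def by (intro continuous_intros)
  qed
  have "open U"
    unfolding U_def by (intro open_Int open_INT ballI open_Collect_less cont) auto
  moreover have "A \<in> U"
  proof -
    have "trace (pv (lag S \<mu>) A) = of_nat (count X \<mu>)" if "\<mu> \<in> S" for \<mu>
      using trace_Pr[OF that] by (simp add: Pr_def proj_def)
    then show ?thesis using C(1) K(1) by (simp add: U_def)
  qed
  moreover have "hermitian B \<and> eigs CARD('n) B = X \<longleftrightarrow> chart B \<in> slice" if B: "B \<in> U" for B
  proof
    assume *: "hermitian B \<and> eigs CARD('n) B = X"
    then have "pv q B = pv 0 B"
      using peval_block_eq[of B "CARD('n)" q 0] poly_q by simp
    then show "chart B \<in> slice" unfolding chart_in_slice_iff using * by simp
  next
    assume "chart B \<in> slice"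
    then have hB: "hermitian B" and N0: "\<forall>\<mu>\<in>S. Pr \<mu> ** pv q B ** Pr \<mu> = 0"
      unfolding chart_in_slice_iff by auto
    let ?N = "pv q B" and ?E = "A - B"
    interpret corner_algebra "corner CARD('n)" B
      using corner_algebra_block[of "CARD('n)" B] by simp
    have "norm ?N \<le> C * norm (A ** ?N - ?N ** A)" by (rule C(2)[OF N0])
    \<comment> \<open>\<open>B\<close> commutes with its own polynomial \<open>?N\<close>, so
      \<open>A\<close> may be replaced by the small difference \<open>?E\<close>.\<close>
    also have "A ** ?N - ?N ** A = ?E ** ?N - ?N ** ?E"
      using peval_commute[of q] by (simp add: cmat_diff_mult cmat_mult_diff)
    also have "norm (?E ** ?N - ?N ** ?E) \<le> 2 * (norm ?E * norm ?N * K)"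
      using norm_triangle_ineq4[of "?E ** ?N" "?N ** ?E"] K(2)[of ?E ?N] K(2)[of ?N ?E] by (simp add: mult.commute)
    finally have le: "norm ?N \<le> (2 * C * K * norm ?E) * norm ?N" using C(1) by (simp add: mult_ac)
    have "2 * C * K * norm ?E < 1"
      using B C(1) K(1) by (simp add: U_def dist_norm field_simps)
    then have "?N = 0"
      using le mult_strict_right_mono[of "2 * C * K * norm ?E" 1 "norm ?N"] by (cases "?N = 0") auto
    then show "hermitian B \<and> eigs CARD('n) B = X"
      using eigs_eqI[OF hB] B hB by (auto simp: U_def)
  qed
  ultimately show ?thesis by blast
qed

end

lemma embedded_submanifold_orbit:
  "embedded_submanifold ((CARD('n))\<^sup>2 - (\<Sum>\<mu>\<in>set_mset X. (count X \<mu>)\<^sup>2))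
    {A :: 'n::{finite,linorder} cmat. hermitian A \<and> eigs CARD('n) A = X}"
proof (rule embedded_submanifold_sliceI)
  fix A :: "'n cmat" assume "A \<in> {A. hermitian A \<and> eigs CARD('n) A = X}"
  then interpret orbit_point A X by unfold_locales auto
  obtain U where U: "open U" "A \<in> U" "\<forall>B\<in>U. hermitian B \<and> eigs CARD('n) B = X \<longleftrightarrow> chart B \<in> slice"
    using slice_chart by blast
  show "\<exists>U f S. open U \<and> A \<in> U \<and> smooth_on f U \<and> (f has_derivative (\<lambda>x. x)) (at A) \<and>
      Real_Vector_Spaces.subspace S \<and> Real_Vector_Spaces.dim S = (CARD('n))\<^sup>2 - (\<Sum>\<mu>\<in>set_mset X. (count X \<mu>)\<^sup>2) \<and>
      (\<forall>x\<in>U. x \<in> {A. hermitian A \<and> eigs CARD('n) A = X} \<longleftrightarrow> f x \<in> S)"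
    using U smooth_on_subset[OF smooth_chart] chart_derivative subspace_slice dim_slice
    by (intro exI[of _ U] exI[of _ chart] exI[of _ slice]) simp
qed

section \<open>Isotropy\<close>

definition outer :: "'n::finite cvec \<Rightarrow> 'n cvec \<Rightarrow> 'n cmat" where
  "outer u v = (\<chi> i j. u $ i * cnj (v $ j))"

lemma outer_nth [simp]: "outer u v $ i $ j = u $ i * cnj (v $ j)"
  by (simp add: outer_def)

lemma outer_vec: "outer u v *v w = hinner v w *s u"
  by (simp add: Finite_Cartesian_Product.vec_eq_iff matrix_vector_mult_def hinner_def sum_distrib_left sum_distrib_right mult_ac)

lemma mult_outer: "A ** outer u v = outer (A *v u) v"
  by (rule cmat_eqI) (simp add: cmat_mult_nth matrix_vector_mult_def sum_distrib_right mult.assoc)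

lemma outer_mult: "outer u v ** A = outer u (conj_transpose A *v v)"
  by (rule cmat_eqI) (simp add: cmat_mult_nth matrix_vector_mult_def sum_distrib_left mult_ac)

lemma conj_transpose_outer: "conj_transpose (outer u v) = outer v u"
  by (rule cmat_eqI) (simp add: mult.commute)

lemma outer_scaleR: "outer (r *\<^sub>R u) v = r *\<^sub>R outer u v" "outer u (r *\<^sub>R v) = r *\<^sub>R outer u v"
  by (auto intro!: cmat_eqI)

lemma skew_inner: "skew_hermitian H \<Longrightarrow> u \<bullet> (H *v u) = 0"
proof -
  assume "skew_hermitian H"
  then have "hinner u (H *v u) = hinner ((- H) *v u) u" by (simp add: hinner_adjoint skew_hermitian_def)
  also have "\<dots> = - cnj (hinner u (H *v u))"
    by (simp add: hinner_def matrix_vector_mult_def sum_negf mult.commute)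
  finally have "Re (hinner u (H *v u)) = 0" by (simp add: complex_eq_iff)
  then show ?thesis by (simp add: Re_hinner)
qed

text \<open>The unitary group acts transitively on spheres, so a vector real-orthogonal to
  \<open>b\<close> is the velocity of an infinitesimal unitary motion. \<open>Q\<close> is assembled
  from \<open>b\<close> and \<open>\<xi>\<close> alone and so stays inside any eigenspace that
  contains both.\<close>

lemma skew_generator:
  fixes b \<xi> :: "'n::finite cvec"
  assumes b: "b \<noteq> 0" and re: "b \<bullet> \<xi> = 0"
  obtains Q where "skew_hermitian Q" "Q *v b = \<xi>"
    "\<And>P. hermitian P \<Longrightarrow> P *v b = b \<Longrightarrow> P *v \<xi> = \<xi> \<Longrightarrow> P ** Q = Q \<and> Q ** P = Q"
    "\<And>A \<mu>. hermitian A \<Longrightarrow> A *v b = \<mu> *\<^sub>R b \<Longrightarrow> A *v \<xi> = \<mu> *\<^sub>R \<xi> \<Longrightarrow> A ** Q = \<mu> *\<^sub>R Q \<and> Q ** A = \<mu> *\<^sub>R Q"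
proof -
  define r where "r = inverse ((norm b)\<^sup>2)"
  define z where "z = hinner \<xi> b"
  \<comment> \<open>The first term sends \<open>b\<close> to \<xi> - r z b, with z purely imaginary
    by the orthogonality. The second term, skew-Hermitian for the same reason, restores r z
    b.\<close>
  define Q where "Q = r *\<^sub>R (outer \<xi> b - outer b \<xi>) + r\<^sup>2 *\<^sub>R outer (z *s b) b"
  have "Re z = 0" using re by (simp add: z_def Re_hinner inner_commute)
  then have z: "cnj z = - z" by (simp add: complex_eq_iff)
  have r: "of_real r * hinner b b = 1" using b by (simp add: r_def hinner_self flip: of_real_mult)
  have "conj_transpose (outer (z *s b) b) = - outer (z *s b) b"
    by (rule cmat_eqI) (simp add: z mult_ac)
  then have "skew_hermitian Q"
    by (simp add: skew_hermitian_def Q_def conj_transpose_add conj_transpose_diff conj_transpose_scaleR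
        conj_transpose_outer algebra_simps)
  moreover have "Q *v b = \<xi>"
  proof -
    have "(Q *v b) $ i = \<xi> $ i" for i
    proof -
      have "(Q *v b) $ i = of_real r * (hinner b b * \<xi> $ i - z * b $ i) + of_real r * (of_real r * hinner b b) * (z * b $ i)"
        by (simp add: Q_def cvec_add_left cvec_scaleR_left cvec_diff_left outer_vec z_def[symmetric]
            scaleR_conv_of_real[where 'a=complex] power2_eq_square mult_ac)
      also have "of_real r * (of_real r * hinner b b) * (z * b $ i) = of_real r * (z * b $ i)"
        unfolding r by simp
      also have "of_real r * (hinner b b * \<xi> $ i - z * b $ i) + of_real r * (z * b $ i) = (of_real r * hinner b b) * \<xi> $ i"
        by (simp add: algebra_simps)
      finally show ?thesis using r by simp
    qed
    then show ?thesis by (simp add: Finite_Cartesian_Product.vec_eq_iff)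
  qed
  moreover have eigen: "A ** Q = \<mu> *\<^sub>R Q \<and> Q ** A = \<mu> *\<^sub>R Q"
    if A: "hermitian A" "A *v b = \<mu> *\<^sub>R b" "A *v \<xi> = \<mu> *\<^sub>R \<xi>" for A \<mu>
  proof -
    have "A *v (z *s b) = \<mu> *\<^sub>R (z *s b)"
      using A(2) by (simp add: vector_scalar_commute) (simp add: Finite_Cartesian_Product.vec_eq_iff)
    moreover have "conj_transpose A = A" using A(1) by (simp add: hermitian_def)
    ultimately show ?thesis
      using A(2,3)
      by (simp add: Q_def cmat_add_left cmat_add_right cmat_scaleR_left cmat_scaleR_right cmat_diff_mult
          cmat_mult_diff mult_outer outer_mult outer_scaleR algebra_simps)
  qed
  moreover have "P ** Q = Q \<and> Q ** P = Q"
    if "hermitian P" "P *v b = b" "P *v \<xi> = \<xi>" for P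
    using eigen[of P 1] that by simp
  ultimately show thesis using that by blast
qed

text \<open>Bracketing with \<open>H\<close> is a derivation that kills the unit \<open>U\<close>,
  so a motion of \<open>M\<close> generated by \<open>H\<close> moves every polynomial of
  \<open>M\<close> by the same generator. Applied to \<open>lag\<close>, this differentiates
  spectral projections along a curve.\<close>

lemma peval_vector_derivative:
  assumes M: "(M has_vector_derivative bracket H (M t)) (at t)" and H: "H ** U = U ** H"
  shows "((\<lambda>s. peval U p (M s)) has_vector_derivative bracket H (peval U p (M t))) (at t)"
proof (induction p)
  case 0
  show ?case by (simp add: bracket_def)
next
  case (pCons a p)
  have "((\<lambda>s. a *\<^sub>R U + M s ** peval U p (M s)) has_vector_derivative
      0 + (M t ** bracket H (peval U p (M t)) + bracket H (M t) ** peval U p (M t))) (at t)"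
    by (intro has_vector_derivative_add has_vector_derivative_const
        bounded_bilinear.has_vector_derivative[OF bounded_bilinear_cmat_mult] M pCons)
  then show ?case
    unfolding peval_pCons by (rule has_vector_derivative_eq_rhs)
      (simp add: bracket_def cmat_add_left cmat_add_right cmat_scaleR_left cmat_scaleR_right H
        cmat_diff_mult cmat_mult_diff matrix_mul_assoc)
qed

lemma vector_derivative_const_near:
  assumes "(f has_vector_derivative d) (at (0::real))" "0 < e" "\<And>t. t \<in> {-e<..<e} \<Longrightarrow> f t = c"
  shows "d = 0"
proof -
  have "((\<lambda>_. c) has_vector_derivative d) (at 0)"
    by (rule has_vector_derivative_transform_within_open[OF assms(1), of "{-e<..<e}"]) (use assms(2,3) in auto)
  then show ?thesis using vector_derivative_at[OF has_vector_derivative_const] vector_derivative_at by metis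
qed

lemma bracket_add_left: "bracket (H + K) A = bracket H A + bracket K A"
  and bracket_add_right: "bracket H (A + B) = bracket H A + bracket H B"
  by (simp_all add: bracket_def cmat_add_left cmat_add_right)

lemma corner_block_absorb:
  assumes "block k H = H" shows "corner k ** H = H" "H ** corner k = H"
  using assms corner_mult_block by metis+

text \<open>The infinitesimal form of conjugation by a unitary g of the first \<open>k\<close>
  coordinates, which replaces the border column b by g b. Skewness of \<open>H\<close> makes the row
  follow.\<close>

lemma bracket_colrow:
  fixes H :: "'n::{finite,linorder} cmat"
  assumes skew: "skew_hermitian H" and H: "block k H = H"
  shows "bracket H (colrow k b) = colrow k (H *v (corner k *v b))"
proof (rule cmat_eqI)
  fix i j :: 'n
  have H0: "H $ i $ j = 0" if "\<not> (pos i < k \<and> pos j < k)" for i j using that H by (metis block_nth)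
  have Hc: "cnj (H $ i $ j) = - H $ j $ i" for i j
    using arg_cong[OF skew[unfolded skew_hermitian_def], of "\<lambda>M. M $ j $ i"] by simp
  have 1: "(H ** colrow k b) $ i $ j = (if pos i < k \<and> pos j = k then (H *v (corner k *v b)) $ i else 0)"
  proof (cases "pos i < k \<and> pos j = k")
    case True
    then show ?thesis
      unfolding cmat_mult_nth matrix_vector_mult_def[of H] vec_lambda_beta by (auto simp: colrow_def intro!: sum.cong)
  next
    case False
    have "H $ i $ l * colrow k b $ l $ j = 0" for l
      using H0[of i l] False by (cases "pos i < k \<and> pos l < k") (auto simp: colrow_def)
    then show ?thesis using False unfolding cmat_mult_nth by auto
  qed
  have 2: "(colrow k b ** H) $ i $ j = (if pos i = k \<and> pos j < k then - cnj ((H *v (corner k *v b)) $ j) else 0)"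
  proof (cases "pos i = k \<and> pos j < k")
    case True
    have "colrow k b $ i $ l * H $ l $ j = - cnj (H $ j $ l * (corner k *v b) $ l)" for l
      using True by (simp add: colrow_def Hc)
    then show ?thesis using True by (simp add: cmat_mult_nth matrix_vector_mult_def[of H] sum_negf)
  next
    case False
    have "colrow k b $ i $ l * H $ l $ j = 0" for l
      using H0[of l j] False by (cases "pos l < k \<and> pos j < k") (auto simp: colrow_def)
    then show ?thesis using False unfolding cmat_mult_nth by auto
  qed
  show "bracket H (colrow k b) $ i $ j = colrow k (H *v (corner k *v b)) $ i $ j"
    by (auto simp: bracket_def 1 2 colrow_def[of k "H *v _"])
qed

lemma bracket_diag_entry:
  fixes H :: "'n::{finite,linorder} cmat"
  assumes "block k H = H" shows "bracket H (diag_entry k c) = 0"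
proof -
  have H0: "H $ i $ j = 0" if "\<not> (pos i < k \<and> pos j < k)" for i j using that assms by (metis block_nth)
  have "H $ i $ l * diag_entry k c $ l $ j = 0" "diag_entry k c $ i $ l * H $ l $ j = 0" for i j l
    using H0[of i l] H0[of l j] by (auto simp: diag_entry_def)
  then show ?thesis
    by (intro cmat_eqI) (simp add: bracket_def cmat_mult_nth)
qed

section \<open>Skew-Hermitian generators of tangent vectors and vanishing of the form\<close>

context gc_reference
begin

text \<open>A vector tangent to the level set is generated on the \<open>(k + 1)\<close>-block by a skew-Hermitian matrix
  of the \<open>k\<close>-block: the generator of the smaller block is corrected on each eigenspace so that it
  also moves the new column.\<close>

lemma tangent_generator_step:
  assumes p: "p \<in> level_set CARD('n)" and X: "X \<in> tangent_space (level_set CARD('n)) p"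
    and k: "k < CARD('n)"
    and H': "skew_hermitian H'" "block k H' = H'" "bracket H' (block k p) = block k X"
  shows "\<exists>H. skew_hermitian H \<and> block k H = H \<and> bracket H (block (Suc k) p) = block (Suc k) X"
proof -
  let ?nk = "nth_index k :: 'n"
  obtain c e where e: "0 < e" and sub: "c ` {-e<..<e} \<subseteq> level_set CARD('n)"
    and c0: "c 0 = p" and dc: "(c has_vector_derivative X) (at 0)"
    using X unfolding tangent_space_def by blast
  have c: "c t \<in> level_set CARD('n)" if "t \<in> {-e<..<e}" for t using sub that by blast
  have ck: "c t \<in> level_set k" "c t \<in> level_set (Suc k)" "hermitian (c t)" if "t \<in> {-e<..<e}" for t
    using c[OF that] k by (auto simp: level_set_def)
  have pk: "p \<in> level_set k" and hp: "hermitian p" using p k by (auto simp: level_set_def)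
  interpret B: spectral_block k p "spec k" using spectral_block_level_set[OF pk] k by simp
  define b where "b = edge k p"
  \<comment> \<open>The part of the velocity of the column that \<open>H'\<close> does not account
    for.\<close>
  define \<xi> where "\<xi> = edge k X - H' *v b"
  have hX: "hermitian X"
  proof -
    have "((\<lambda>t. conj_transpose (c t) - c t) has_vector_derivative conj_transpose X - X) (at 0)"
      by (intro has_vector_derivative_diff bounded_linear.has_vector_derivative[OF bounded_linear_conj_transpose] dc)
    from vector_derivative_const_near[OF this e, of 0] show ?thesis using ck(3) by (simp add: hermitian_def)
  qed
  have Xkk: "X $ ?nk $ ?nk = 0"
  proof -
    have bl: "bounded_linear (\<lambda>A :: 'n cmat. A $ ?nk $ ?nk)"
      by (intro linear_conv_bounded_linear[THEN iffD1] linearI) auto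
    show ?thesis
      by (rule vector_derivative_const_near[OF bounded_linear.has_vector_derivative[OF bl dc] e])
        (use level_set_Suc_iff[OF k ck(1)] ck(2) in auto)
  qed
  have db: "((\<lambda>t. edge k (c t)) has_vector_derivative edge k X) (at 0)"
    by (rule bounded_linear.has_vector_derivative[OF bounded_linear_edge dc])
  have "((\<lambda>t. block k (c t)) has_vector_derivative block k X) (at 0)"
    by (rule bounded_linear.has_vector_derivative[OF bounded_linear_block dc])
  then have dB: "((\<lambda>t. block k (c t)) has_vector_derivative bracket H' (block k (c 0))) (at 0)"
    by (simp add: H'(3) c0)
  have H'E: "H' ** corner k = corner k ** H'" using corner_block_absorb[OF H'(2)] by simp
  \<comment> \<open>Moving along, the projection contributes [H', P_\<mu>] b and the column
    contributes P_\<mu> b'. Together they are the motion by \<open>H'\<close> plus the component of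
    \<open>\<xi>\<close>.\<close>
  have dw: "((\<lambda>t. proj k (spec k) \<mu> (block k (c t)) *v edge k (c t)) has_vector_derivative
      H' *v (B.P \<mu> *v b) + B.P \<mu> *v \<xi>) (at 0)" for \<mu>
  proof -
    have "((\<lambda>t. proj k (spec k) \<mu> (block k (c t)) *v edge k (c t)) has_vector_derivative
      proj k (spec k) \<mu> (block k (c 0)) *v edge k X + bracket H' (proj k (spec k) \<mu> (block k (c 0))) *v edge k (c 0)) (at 0)"
      by (rule bounded_bilinear.has_vector_derivative[OF bounded_bilinear_cmat_vec
            peval_vector_derivative[OF dB H'E, of "lag (spec k) \<mu>", folded proj_def] db])
    then show ?thesis
      by (rule has_vector_derivative_eq_rhs)
        (simp add: c0 b_def[symmetric] \<xi>_def bracket_def cvec_diff_left cvec_diff_right cvec_assoc)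
  qed
  have norm_w: "norm (proj k (spec k) \<mu> (block k (c t)) *v edge k (c t)) = radius k \<mu>"
    if "\<mu> \<in> spec k" "t \<in> {-e<..<e}" for \<mu> t
    using level_set_Suc_iff[OF k ck(1)[OF that(2)]] ck(2)[OF that(2)] that(1) by blast
  have norm_b: "norm (B.P \<mu> *v b) = radius k \<mu>" if "\<mu> \<in> spec k" for \<mu>
    using norm_w[OF that, of 0] e by (simp add: c0 b_def)
  have inactive: "B.P \<mu> *v \<xi> = 0" if m: "\<mu> \<in> spec k" "\<mu> \<notin> active k" for \<mu>
  proof -
    have r: "radius k \<mu> = 0" using m by (simp add: active_def)
    have "H' *v (B.P \<mu> *v b) + B.P \<mu> *v \<xi> = 0"
      by (rule vector_derivative_const_near[OF dw e]) (use norm_w[OF m(1)] r in auto)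
    moreover have "B.P \<mu> *v b = 0" using norm_b[OF m(1)] r by simp
    ultimately show ?thesis by simp
  qed
  \<comment> \<open>The component has constant norm along the curve, so its velocity is orthogonal
    to it. The \<open>H'\<close> part is orthogonal by skewness, hence so is the part of
    \<open>\<xi>\<close>.\<close>
  have perp: "(B.P \<mu> *v b) \<bullet> (B.P \<mu> *v \<xi>) = 0" if m: "\<mu> \<in> spec k" for \<mu>
  proof -
    let ?w = "\<lambda>t. proj k (spec k) \<mu> (block k (c t)) *v edge k (c t)"
    let ?w' = "H' *v (B.P \<mu> *v b) + B.P \<mu> *v \<xi>"
    have "((\<lambda>t. ?w t \<bullet> ?w t) has_vector_derivative ?w 0 \<bullet> ?w' + ?w' \<bullet> ?w 0) (at 0)"
      by (rule bounded_bilinear.has_vector_derivative[OF bounded_bilinear_inner dw dw])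
    from vector_derivative_const_near[OF this e, of "(radius k \<mu>)\<^sup>2"] norm_w[OF m]
    have "?w 0 \<bullet> ?w' + ?w' \<bullet> ?w 0 = 0" by (simp add: power2_norm_eq_inner[symmetric])
    then have "(B.P \<mu> *v b) \<bullet> ?w' = 0" by (simp add: c0 b_def inner_commute)
    then show ?thesis using skew_inner[OF H'(1), of "B.P \<mu> *v b"] by (simp add: inner_add_right)
  qed
  have "\<exists>Q. skew_hermitian Q \<and> Q *v (B.P \<mu> *v b) = B.P \<mu> *v \<xi> \<and> B.P \<mu> ** Q = Q \<and> Q ** B.P \<mu> = Q \<and>
      block k p ** Q = \<mu> *\<^sub>R Q \<and> Q ** block k p = \<mu> *\<^sub>R Q" if m: "\<mu> \<in> active k" for \<mu>
  proof -
    have ms: "\<mu> \<in> spec k" and "radius k \<mu> \<noteq> 0" using m by (auto simp: active_def)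
    then have nz: "B.P \<mu> *v b \<noteq> 0" using norm_b[OF ms] by auto
    have "B.P \<mu> *v (B.P \<mu> *v v) = B.P \<mu> *v v" "block k p *v (B.P \<mu> *v v) = \<mu> *\<^sub>R (B.P \<mu> *v v)" for v
      using B.proj_mult[OF ms ms] B.block_proj[OF ms] by (simp_all add: cvec_assoc cvec_scaleR_left)
    then show ?thesis
      using skew_generator[OF nz perp[OF ms]] B.hermitian_proj[of \<mu>] hermitian_block[OF hp, of k] by metis
  qed
  then obtain Q where Q: "\<And>\<mu>. \<mu> \<in> active k \<Longrightarrow> skew_hermitian (Q \<mu>) \<and> Q \<mu> *v (B.P \<mu> *v b) = B.P \<mu> *v \<xi> \<and>
      B.P \<mu> ** Q \<mu> = Q \<mu> \<and> Q \<mu> ** B.P \<mu> = Q \<mu> \<and> block k p ** Q \<mu> = \<mu> *\<^sub>R Q \<mu> \<and> Q \<mu> ** block k p = \<mu> *\<^sub>R Q \<mu>"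
    by metis
  define K where "K = (\<Sum>\<mu>\<in>active k. Q \<mu>)"
  have skew_K: "skew_hermitian K"
    using Q by (simp add: K_def skew_hermitian_def conj_transpose_sum sum_negf)
  have Q_corner: "corner k ** Q \<mu> = Q \<mu>" "Q \<mu> ** corner k = Q \<mu>" if "\<mu> \<in> active k" for \<mu>
    using Q[OF that] B.corner_proj[of \<mu>] B.proj_corner[of \<mu>] matrix_mul_assoc by metis+
  have KE: "block k K = K"
    by (simp add: block_def K_def cmat_sum_left cmat_sum_right Q_corner cong: sum.cong)
  \<comment> \<open>Each \<open>Q \<mu>\<close> acts inside one eigenspace, where the block is a
    scalar. The correction therefore moves the column without disturbing the motion of the
    block.\<close>
  have K_B: "bracket K (block k p) = 0"
    using Q by (simp add: bracket_def K_def cmat_sum_left cmat_sum_right cong: sum.cong)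
  have corner_\<xi>: "corner k *v \<xi> = \<xi>"
    using corner_block_absorb[OF H'(2)] by (simp add: \<xi>_def cvec_diff_right cvec_assoc)
  have "K *v b = (\<Sum>\<mu>\<in>active k. B.P \<mu> *v \<xi>)"
    unfolding K_def cvec_sum_left
  proof (rule sum.cong[OF refl])
    fix \<mu> assume "\<mu> \<in> active k"
    then have "Q \<mu> = Q \<mu> ** B.P \<mu>" "Q \<mu> *v (B.P \<mu> *v b) = B.P \<mu> *v \<xi>" using Q by auto
    then show "Q \<mu> *v b = B.P \<mu> *v \<xi>" by (metis cvec_assoc)
  qed
  also have "\<dots> = (\<Sum>\<mu>\<in>spec k. B.P \<mu> *v \<xi>)"
    using inactive finite_spec by (intro sum.mono_neutral_left) (auto simp: active_def)
  also have "\<dots> = \<xi>" by (simp add: cvec_sum_left[symmetric] B.sum_proj corner_\<xi>)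
  finally have Kb: "K *v b = \<xi>" .
  let ?H = "H' + K"
  have H: "skew_hermitian ?H"
    using H'(1) skew_K by (simp add: skew_hermitian_def conj_transpose_add)
  have HE: "block k ?H = ?H"
    using H'(2) KE linear_add[OF bounded_linear.linear[OF bounded_linear_block]] by metis
  have Hb: "?H *v b = edge k X"
    by (simp add: cvec_add_left Kb \<xi>_def)
  have "bracket ?H (block (Suc k) p) = bracket ?H (block k p) + bracket ?H (colrow k b)
      + bracket ?H (diag_entry k (p $ ?nk $ ?nk))"
    by (simp only: block_Suc[OF hp k] bracket_add_right b_def)
  also have "bracket ?H (block k p) = block k X" by (simp add: bracket_add_left H'(3) K_B)
  also have "bracket ?H (colrow k b) = colrow k (edge k X)"
    using bracket_colrow[OF H HE, of b] Hb by (simp add: b_def)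
  also have "bracket ?H (diag_entry k (p $ ?nk $ ?nk)) = diag_entry k (X $ ?nk $ ?nk)"
    unfolding bracket_diag_entry[OF HE] Xkk by (rule cmat_eqI) (simp add: diag_entry_def)
  finally have "bracket ?H (block (Suc k) p) = block (Suc k) X" by (simp only: block_Suc[OF hX k])
  then show ?thesis using H HE by blast
qed

lemma tangent_generator:
  assumes p: "p \<in> level_set CARD('n)" and X: "X \<in> tangent_space (level_set CARD('n)) p"
  shows "k \<le> CARD('n) \<Longrightarrow> \<exists>H. skew_hermitian H \<and> block k H = H \<and> bracket H (block k p) = block k X"
proof (induction k)
  case 0
  have "block 0 A = 0" for A :: "'n cmat" by (rule cmat_eqI) simp
  then show ?case by (intro exI[of _ 0]) (simp add: skew_hermitian_def bracket_def)
next
  case (Suc k)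
  then obtain H' where "skew_hermitian H'" "block k H' = H'" "bracket H' (block k p) = block k X" by auto
  from tangent_generator_step[OF p X _ this] Suc.prems
  obtain H where H: "skew_hermitian H" "block k H = H" "bracket H (block (Suc k) p) = block (Suc k) X" by auto
  have "block (Suc k) H = H" using H(2) block_block[of "Suc k" k H] by simp
  then show ?case using H by blast
qed

text \<open>The statement ranges over all generators within the corner, because each step of the
  induction exchanges them for generators in a smaller corner.\<close>

lemma trace_generators_zero:
  assumes p: "p \<in> level_set CARD('n)" and X: "X \<in> tangent_space (level_set CARD('n)) p"
    and Y: "Y \<in> tangent_space (level_set CARD('n)) p"
  shows "k \<le> CARD('n) \<Longrightarrow> block k H1 = H1 \<Longrightarrow> block k H2 = H2 \<Longrightarrow>
    bracket H1 (block k p) = block k X \<Longrightarrow> bracket H2 (block k p) = block k Y \<Longrightarrow>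
    trace (block k p ** bracket H1 H2) = 0"
proof (induction k arbitrary: H1 H2)
  case 0
  have "block 0 A = 0" for A :: "'n cmat" by (rule cmat_eqI) simp
  then show ?case by simp
next
  case (Suc k)
  then have k: "k < CARD('n)" by simp
  have gen: "\<exists>K. block k K = K \<and> bracket K (block (Suc k) p) = block (Suc k) Z \<and> bracket K (block k p) = block k Z"
    if Z: "Z \<in> tangent_space (level_set CARD('n)) p" for Z
  proof -
    obtain H' where "skew_hermitian H'" "block k H' = H'" "bracket H' (block k p) = block k Z"
      using tangent_generator[OF p Z, of k] k by auto
    from tangent_generator_step[OF p Z k this]
    obtain K where K: "block k K = K" "bracket K (block (Suc k) p) = block (Suc k) Z" by blast
    have "bracket K (block k p) = block k (bracket K (block (Suc k) p))"
    proof -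
      \<comment> \<open>\<open>K\<close> lies in the \<open>k\<close>-corner, so taking the
        \<open>k\<close>-block commutes with bracketing by \<open>K\<close>, and a generator for the
        larger block also generates the smaller one.\<close>
      note E = corner_block_absorb[OF K(1)]
      have "block k (bracket K A) = bracket K (block k A)" for A :: "'n cmat"
        unfolding block_def bracket_def cmat_mult_diff cmat_diff_mult
        by (simp add: matrix_mul_assoc E) (simp add: matrix_mul_assoc[symmetric] E)
      then show ?thesis by (simp add: block_block)
    qed
    then have "bracket K (block k p) = block k Z" by (simp add: K(2) block_block)
    then show ?thesis using K by blast
  qed
  obtain K1 K2 where K1: "block k K1 = K1" "bracket K1 (block (Suc k) p) = block (Suc k) X" "bracket K1 (block k p) = block k X"
    and K2: "block k K2 = K2" "bracket K2 (block (Suc k) p) = block (Suc k) Y" "bracket K2 (block k p) = block k Y"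
    using gen[OF X] gen[OF Y] by blast
  let ?A = "block (Suc k) p"
  \<comment> \<open>The trace sees \<open>H1\<close> only through its bracket with the block, which
    \<open>K1\<close> shares; then likewise for the other argument.\<close>
  have "trace (?A ** bracket H1 H2) = trace (?A ** bracket K1 H2)"
    using Suc.prems K1(2) by (simp add: trace_bracket_left)
  also have "\<dots> = trace (?A ** bracket K1 K2)"
    using Suc.prems K2(2) by (simp add: trace_bracket_right)
  also have "\<dots> = trace (block k p ** bracket K1 K2)"
  proof -
    \<comment> \<open>Both generators lie in the \<open>k\<close>-corner, hence so does their
      bracket, and the trace sees only the \<open>k\<close>-block of \<open>?A\<close>.\<close>
    let ?Z = "bracket K1 K2"
    have Z: "corner k ** ?Z = ?Z" "?Z ** corner k = ?Z"
      using corner_block_absorb[OF K1(1)] corner_block_absorb[OF K2(1)]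
      by (simp_all add: bracket_def cmat_mult_diff cmat_diff_mult matrix_mul_assoc)
        (simp_all add: matrix_mul_assoc[symmetric])
    have "trace (?A ** ?Z) = trace (?A ** corner k ** (?Z ** corner k))" by (simp only: Z matrix_mul_assoc[symmetric])
    also have "\<dots> = trace (corner k ** (?A ** corner k ** ?Z))"
      using trace_cmat_commute by (metis matrix_mul_assoc)
    also have "\<dots> = trace (block k ?A ** ?Z)" by (simp only: block_def[of k] matrix_mul_assoc)
    finally show ?thesis by (simp add: block_block)
  qed
  also have "\<dots> = 0" using Suc.IH[OF _ K1(1) K2(1) K1(3) K2(3)] k by simp
  finally show ?case .
qed

text \<open>\<open>kks_form\<close> has its intended value only when both vectors have
  skew-Hermitian generators; \<open>tangent_generator\<close> supplies them at full size.\<close>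

lemma kks_form_level_set:
  assumes p: "p \<in> level_set CARD('n)" and X: "X \<in> tangent_space (level_set CARD('n)) p"
    and Y: "Y \<in> tangent_space (level_set CARD('n)) p"
  shows "kks_form p X Y = 0"
proof -
  obtain H1 H2 where H: "skew_hermitian H1" "bracket H1 p = X" "skew_hermitian H2" "bracket H2 p = Y"
    using tangent_generator[OF p X order_refl] tangent_generator[OF p Y order_refl] by auto
  have "trace (p ** bracket H1 H2) = 0"
    using trace_generators_zero[OF p X Y order_refl, of H1 H2] H by simp
  then show ?thesis
    using kks_form_bracket[OF _ H(1,3), of p] p H by (simp add: level_set_def)
qed

end

section \<open>The fiber as a level set\<close>

lemma gelfand_cetlin_eq_iff:
  fixes A B :: "'n::{finite,linorder} cmat"
  shows "gelfand_cetlin A = gelfand_cetlin B \<longleftrightarrow> (\<forall>k<CARD('n). eigs k A = eigs k B)"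
proof -
  have "gelfand_cetlin A = gelfand_cetlin B \<longleftrightarrow>
      (\<forall>j<CARD('n). \<forall>i\<in>{1..j}. eigenval i j A = eigenval i j B)"
  proof
    assume eq: "gelfand_cetlin A = gelfand_cetlin B"
    show "\<forall>j<CARD('n). \<forall>i\<in>{1..j}. eigenval i j A = eigenval i j B"
    proof (intro allI impI ballI)
      fix j i assume "j < CARD('n)" "i \<in> {1..j}"
      then show "eigenval i j A = eigenval i j B"
        using fun_cong[OF eq, of "(i, j)"] by (simp add: gelfand_cetlin_def)
    qed
  next
    assume "\<forall>j<CARD('n). \<forall>i\<in>{1..j}. eigenval i j A = eigenval i j B"
    then show "gelfand_cetlin A = gelfand_cetlin B"
      by (auto simp: gelfand_cetlin_def restrict_def fun_eq_iff)
  qed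
  then show ?thesis by (simp only: eigenval_eq_iff)
qed

lemma coadjoint_orbit_eq:
  fixes R :: "'n::{finite,linorder} cmat"
  assumes "R \<in> coadjoint_orbit lam"
  shows "coadjoint_orbit lam = {A :: 'n cmat. hermitian A \<and> eigs CARD('n) A = eigs CARD('n) R}"
  using assms by (auto simp: coadjoint_orbit_def eigenval_eq_iff[symmetric])

theorem proposition6p1:
  fixes lam :: "nat \<Rightarrow> real" and \<Lambda> :: "nat \<times> nat \<Rightarrow> real"
  assumes "antimono_on {1..CARD('n::{finite,linorder})} lam"
    and "\<Lambda> \<in> gelfand_cetlin ` (coadjoint_orbit lam :: 'n cmat set)"
  shows "isotropic_submanifold (coadjoint_orbit lam :: 'n cmat set) kks_form
           (gelfand_cetlin_fiber lam \<Lambda>)"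
proof -
  obtain R :: "'n cmat" where R: "R \<in> coadjoint_orbit lam" "\<Lambda> = gelfand_cetlin R"
    using assms(2) by blast
  interpret gc_reference R using R(1) by unfold_locales (simp add: coadjoint_orbit_def)
  \<comment> \<open>The Gelfand--Cetlin values prescribe the blocks of size below
    \<open>CARD('n)\<close>, and membership in the orbit prescribes the remaining spectrum.\<close>
  have fiber: "gelfand_cetlin_fiber lam \<Lambda> = level_set CARD('n)"
    unfolding gelfand_cetlin_fiber_def R(2) gelfand_cetlin_eq_iff coadjoint_orbit_eq[OF R(1)] level_set_def
    by (auto simp: le_less)
  have "(gelfand_cetlin_fiber lam \<Lambda> :: 'n cmat set) \<subseteq> coadjoint_orbit lam"
    unfolding gelfand_cetlin_fiber_def by blast
  moreover have "embedded_submanifold ((CARD('n))\<^sup>2 - (\<Sum>\<mu>\<in>set_mset (eigs CARD('n) R). (count (eigs CARD('n) R) \<mu>)\<^sup>2))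
      (coadjoint_orbit lam :: 'n cmat set)"
    unfolding coadjoint_orbit_eq[OF R(1)] by (rule embedded_submanifold_orbit)
  ultimately have "submanifold_of (level_set CARD('n)) (coadjoint_orbit lam)"
    unfolding submanifold_of_def fiber using embedded_submanifold_level_set by blast
  then show ?thesis
    unfolding isotropic_submanifold_def fiber using kks_form_level_set by blast
qed

end
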